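(* There exists $c^*_K\in[0,+\infty]$ such that: (i) for every $c\ge 0$ with $c<c^*_K$, $\lim_{n\to\infty}\mathrm{LP}(n,c)/n=0$ with high probability, i.e. for every $\epsilon>0$, $\mathbb P\{\mathrm{LP}(n,c)/n>\epsilon\}\to0$ as $n\to\infty$; (ii) for every $c>c^*_K$, $\liminf_{n\to\infty}\mathrm{LP}(n,c)/n>0$ with high probability, i.e. there is $\delta(c)>0$ with $\mathbb P\{\mathrm{LP}(n,c)/n\ge\delta(c)\}\to1$ as $n\to\infty$. Moreover, if Condition $\mathcal A$ holds then $c^*_K>0$, and if Condition $\mathcal B$ holds then $c^*_K<+\infty$.
   Context: Fix an integer $K\ge 1$, reals $B^1_x\le B^2_x$, and a nonempty finite collection $\mathcal C$ of linear constraints $\sum_{k=1}^K a_{rk}y_k\le b_r$, $r=1,\dots,|\mathcal C|$, in $K$ variables, where $a_{rk},b_r$ are arbitrary fixed reals. Random K-LSAT problem: for $c\ge 0$ and a large integer $n$ put $m=cn$ (with the convention $m=\lfloor cn\rfloor$). Independently for each $j=1,\dots,m$, choose an ordered $K$-tuple $(i_1,\dots,i_K)$ of indices uniformly at random from $\{1,\dots,n\}$ (either always with replacement or always without; the statement is meant for either convention) and independently choose $r\in\{1,\dots,|\mathcal C|\}$ uniformly at random; the constraint $C_j$ is $\sum_{k=1}^K a_{rk}x_{i_k}\le b_r+\psi_j$. $\mathrm{LP}(n,c)$ denotes the (random) optimal value of the linear program: minimize $\sum_{j=1}^m\psi_j$ subject to $C_1,\dots,C_m$, $x_i\in[B^1_x,B^2_x]$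 ($1\le i\le n$), $\psi_j\ge0$ ($1\le j\le m$). Condition $\mathcal A$: for every $r\in\{1,\dots,|\mathcal C|\}$, every $k\in\{1,\dots,K\}$ and every $z\in[B^1_x,B^2_x]$ there exist $y_1,\dots,y_K\in[B^1_x,B^2_x]$ with $y_k=z$ and $\sum_{k'=1}^K a_{rk'}y_{k'}\le b_r$. Condition $\mathcal B$: there exist a positive integer $l$ and a constant $\nu>0$ such that for every $K$-dimensional cube $I=\prod_{k=1}^K[\frac{i_k}{l},\frac{i_k+1}{l}]$ with $i_1,\dots,i_K$ integers satisfying $B^1_x\le\frac{i_k}{l}<B^2_x$ for all $k$, there is at least one $r\in\{1,\dots,|\mathcal C|\}$ such that $\sum_{k=1}^K a_{rk}y_k-b_r\ge\nu$ for every $y\in I$.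
   Formalization: For c*_K<+∞, besides Condition B it is assumed, for the same l and ν, that every point of [B1,B2]^K lies in a grid cube on which some constraint is violated by at least ν (automatic if B1<B2 and l·B1 is an integer); Condition B alone does not suffice. *)

theory Defs
  imports "HOL-Probability.Probability"
begin

text \<open>
  All indices start at 0: the variables of a constraint are \<open>k < K\<close>, the constraints of the
  collection are \<open>r < R\<close> (so \<open>R\<close> is the size of the collection), and the variables of the random
  problem are \<open>i < n\<close>.  Constraint \<open>r\<close> is \<open>(\<Sum>k<K. a r k * y k) \<le> b r\<close>.
  The flag \<open>repl\<close> selects sampling of index tuples with (True) or without (False) replacement.
\<close>

definition index_tuples :: "bool \<Rightarrow> nat \<Rightarrow> nat \<Rightarrow> nat list set" where
  "index_tuples repl K n =
     {is. length is = K \<and> set is \<subseteq> {..<n} \<and> (\<not> repl \<longrightarrow> distinct is)}"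

text \<open>
  The law of \<open>m = \<lfloor>c n\<rfloor>\<close> independent pairs (index tuple, constraint number), each pair uniform with
  independent components.  Without replacement, the set of tuples is empty when \<open>n < K\<close>
  and the law is then an unspecified one; this does not affect limits in \<open>n\<close>.
\<close>

definition num_constraints :: "real \<Rightarrow> nat \<Rightarrow> nat" where
  "num_constraints c n = nat \<lfloor>c * real n\<rfloor>"

definition random_klsat :: "bool \<Rightarrow> nat \<Rightarrow> nat \<Rightarrow> nat \<Rightarrow> real \<Rightarrow> (nat \<Rightarrow> nat list \<times> nat) pmf" where
  "random_klsat repl K R n c =
     Pi_pmf {..<num_constraints c n} undefined
       (\<lambda>_. pair_pmf (pmf_of_set (index_tuples repl K n)) (pmf_of_set {..<R}))"

definition lp_feasible ::
  "nat \<Rightarrow> (nat \<Rightarrow> nat \<Rightarrow> real) \<Rightarrow> (nat \<Rightarrow> real) \<Rightarrow> real \<Rightarrow> real \<Rightarrow> nat \<Rightarrow> nat \<Rightarrow>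
   (nat \<Rightarrow> nat list \<times> nat) \<Rightarrow> (nat \<Rightarrow> real) \<Rightarrow> (nat \<Rightarrow> real) \<Rightarrow> bool" where
  "lp_feasible K a b B1 B2 n m C x \<psi> \<longleftrightarrow>
     (\<forall>j<m. (\<Sum>k<K. a (snd (C j)) k * x (fst (C j) ! k)) \<le> b (snd (C j)) + \<psi> j) \<and>
     (\<forall>i<n. x i \<in> {B1..B2}) \<and>
     (\<forall>j<m. 0 \<le> \<psi> j)"

text \<open>
  The infimum is over a set of nonnegative reals, nonempty whenever \<open>B1 \<le> B2\<close>.
\<close>

definition lp_value ::
  "nat \<Rightarrow> (nat \<Rightarrow> nat \<Rightarrow> real) \<Rightarrow> (nat \<Rightarrow> real) \<Rightarrow> real \<Rightarrow> real \<Rightarrow> nat \<Rightarrow> real \<Rightarrow>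
   (nat \<Rightarrow> nat list \<times> nat) \<Rightarrow> real" where
  "lp_value K a b B1 B2 n c C =
     Inf {\<Sum>j<num_constraints c n. \<psi> j | x \<psi>.
            lp_feasible K a b B1 B2 n (num_constraints c n) C x \<psi>}"

definition condition_A ::
  "nat \<Rightarrow> nat \<Rightarrow> (nat \<Rightarrow> nat \<Rightarrow> real) \<Rightarrow> (nat \<Rightarrow> real) \<Rightarrow> real \<Rightarrow> real \<Rightarrow> bool" where
  "condition_A K R a b B1 B2 \<longleftrightarrow>
     (\<forall>r<R. \<forall>k<K. \<forall>z\<in>{B1..B2}.
        \<exists>y. (\<forall>k'<K. y k' \<in> {B1..B2}) \<and> y k = z \<and> (\<Sum>k'<K. a r k' * y k') \<le> b r)"

definition grid_cube :: "nat \<Rightarrow> nat \<Rightarrow> (nat \<Rightarrow> int) \<Rightarrow> (nat \<Rightarrow> real) set" where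
  "grid_cube K l i =
     {y. \<forall>k<K. y k \<in> {real_of_int (i k) / real l .. (real_of_int (i k) + 1) / real l}}"

definition violated_on ::
  "nat \<Rightarrow> nat \<Rightarrow> (nat \<Rightarrow> nat \<Rightarrow> real) \<Rightarrow> (nat \<Rightarrow> real) \<Rightarrow> real \<Rightarrow> (nat \<Rightarrow> real) set \<Rightarrow> bool" where
  "violated_on K R a b \<nu> I \<longleftrightarrow> (\<exists>r<R. \<forall>y\<in>I. (\<Sum>k<K. a r k * y k) - b r \<ge> \<nu>)"

text \<open>
  The witnesses \<open>l\<close> and \<open>\<nu>\<close> are parameters; Condition B quantifies existentially over positive ones.
\<close>

definition condition_B ::
  "nat \<Rightarrow> nat \<Rightarrow> (nat \<Rightarrow> nat \<Rightarrow> real) \<Rightarrow> (nat \<Rightarrow> real) \<Rightarrow> real \<Rightarrow> real \<Rightarrow> nat \<Rightarrow> real \<Rightarrow> bool" where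
  "condition_B K R a b B1 B2 l \<nu> \<longleftrightarrow>
     (\<forall>i. (\<forall>k<K. B1 \<le> real_of_int (i k) / real l \<and> real_of_int (i k) / real l < B2)
          \<longrightarrow> violated_on K R a b \<nu> (grid_cube K l i))"

text \<open>
  The cubes in Condition B need not cover the box \<open>[B1, B2]^K\<close>: there are none if \<open>B1 = B2\<close>, and they
  miss points close to \<open>B1\<close> if \<open>l * B1\<close> is not an integer.  In those cases Condition B alone
  does not make the threshold finite (take \<open>K = 1\<close>, \<open>B1 = 1/2\<close>, \<open>B2 = 3/2\<close>, \<open>l = 1\<close> and the single
  constraint \<open>y \<le> 1/2\<close> with, say, \<open>\<nu> = 1/2\<close>: the only cube is \<open>[1, 2]\<close>, and setting all variables to
  \<open>1/2\<close> satisfies everything).  The next predicate says that the grid cubes on which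
  some constraint is violated by at least \<open>\<nu>\<close> do cover the box.  It is a consequence
  of Condition B when \<open>B1 < B2\<close> and \<open>l * B1\<close> is an integer.
\<close>

definition violated_cubes_cover ::
  "nat \<Rightarrow> nat \<Rightarrow> (nat \<Rightarrow> nat \<Rightarrow> real) \<Rightarrow> (nat \<Rightarrow> real) \<Rightarrow> real \<Rightarrow> real \<Rightarrow> nat \<Rightarrow> real \<Rightarrow> bool" where
  "violated_cubes_cover K R a b B1 B2 l \<nu> \<longleftrightarrow>
     (\<forall>y. (\<forall>k<K. y k \<in> {B1..B2}) \<longrightarrow>
          (\<exists>i. y \<in> grid_cube K l i \<and> violated_on K R a b \<nu> (grid_cube K l i)))"

lemma condition_B_imp_cover:
  assumes B: "condition_B K R a b B1 B2 l \<nu>"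
    and "l > 0" "B1 < B2" "real l * B1 \<in> \<int>"
  shows "violated_cubes_cover K R a b B1 B2 l \<nu>"
  unfolding violated_cubes_cover_def
proof (intro allI impI)
  fix y :: "nat \<Rightarrow> real"
  assume y: "\<forall>k<K. y k \<in> {B1..B2}"
  obtain q :: int where q: "real l * B1 = of_int q"
    using assms(4) by (auto elim: Ints_cases)
  define i where "i k = max q (\<lceil>real l * y k\<rceil> - 1)" for k
  have i: "B1 \<le> of_int (i k) / real l \<and> of_int (i k) / real l < B2 \<and>
           of_int (i k) / real l \<le> y k \<and> y k \<le> (of_int (i k) + 1) / real l" if "k < K" for k
  proof -
    have yk: "B1 \<le> y k" "y k \<le> B2" using y that by auto
    have l: "real l > 0" using assms(2) by simp
    have 1: "real l * B1 \<le> real l * y k" "real l * y k \<le> real l * B2" "real l * B1 < real l * B2"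
      using yk l assms(3) by (auto intro: mult_left_mono)
    have "real_of_int q \<le> of_int (i k)" "of_int (i k) < real l * B2" "of_int (i k) \<le> real l * y k"
         "real l * y k \<le> of_int (i k) + 1"
      using 1 q unfolding i_def max_def by (auto; linarith)+
    then show ?thesis using l q by (auto simp: field_simps)
  qed
  have "y \<in> grid_cube K l i" using i by (auto simp: grid_cube_def)
  moreover have "violated_on K R a b \<nu> (grid_cube K l i)"
    using B i unfolding condition_B_def by blast
  ultimately show "\<exists>i. y \<in> grid_cube K l i \<and> violated_on K R a b \<nu> (grid_cube K l i)" by blast
qed

end

theory Submission
  imports Defs "HOL-Real_Asymp.Real_Asymp"
begin

text \<open>
  Paying for a constraint costs the positive part of its excess, so the optimal value of the linear
  program is the minimum over the box of a convex function: a sum of one bounded, Lipschitz penalty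
  per constraint (\<open>lp_value_eq_opt\<close>).  The heart of the matter is that the expected optimum per
  variable has a limit \<open>limit_opt c\<close> as the number of variables grows.  Given this, the
  threshold is the supremum of the \<open>c\<close> with \<open>limit_opt c = 0\<close>: more constraints can only raise the
  optimum, so \<open>limit_opt\<close> is nondecreasing; and replacing one constraint moves the optimum by a
  bounded amount, so the optimum has variance of order \<open>n\<close> and the optimum per variable
  concentrates at its mean (\<open>variance_iid_le\<close>, \<open>threshold_exists\<close>).

  The limit exists because convexity makes the optimum a local quantity.  Projected subgradient
  descent, with the step at every variable divided by the degree of that variable, comes within
  \<open>O(1/q)\<close> per constraint of the optimum when its costs over \<open>q\<^sup>2\<close> steps are averaged, with a
  constant that is the same for all instances (\<open>opt_near_descent\<close>).  On the other hand the \<open>t\<close>-th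
  iterate at a variable is determined by the constraints at distance at most \<open>t\<close> from it
  (\<open>descent_local\<close>).  Hence it is enough to show that, for fixed \<open>t\<close>, the expected penalty of one
  constraint at the \<open>t\<close>-th iterate converges, which is a question about the neighbourhood of that
  constraint.  The expected size of this neighbourhood is bounded uniformly in \<open>n\<close>
  (\<open>expect_card_ball\<close>), so up to a small error only neighbourhoods of at most \<open>S\<close> constraints matter.
  For a fixed set of \<open>s\<close> constraints, being the whole neighbourhood means that these constraints are
  suitably connected and that all the others avoid the variables in the interior.  Sorting the
  configurations by the set of variables that they use turns the expectation into a finite
  sum with explicit coefficients (\<open>pattern_value_eq_sum\<close>), and these coefficients converge because
  a connected family of \<open>s\<close> constraints uses at most \<open>1 + s (K - 1)\<close> variables
  (\<open>pattern_value_convergent\<close>).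

  Condition A gives a positive threshold by peeling.  If no nonempty subfamily \<open>I\<close> of the
  constraints is crowded, that is, spans at most \<open>(K - 1) |I|\<close> variables, then some constraint shares at
  most one variable with the others; satisfy the others first and complete the assignment with
  Condition A (\<open>satisfiable_if_not_crowded\<close>).  At density \<open>1 / (2 e\<^sup>K K)\<close> the expected number of
  crowded subfamilies is at most 1 (\<open>expect_card_crowded\<close>), and giving up one constraint in each of them
  costs a bounded amount.

  Condition B, in the form that every point of the box violates some constraint of the collection by
  at least \<open>\<nu>\<close>, gives a finite threshold by a union bound: round assignments to a finite grid, and
  note that a random constraint is violated by a fixed grid assignment with probability at least
  \<open>1 / R\<close>.  At high density this beats the number of grid assignments (\<open>expect_opt_ge\<close>).
\<close>

section \<open>The optimum as a convex minimum\<close>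

text \<open>An index tuple together with the number of a constraint of the collection.\<close>

type_synonym constr = "nat list \<times> nat"

locale lsat =
  fixes K R :: nat and a :: "nat \<Rightarrow> nat \<Rightarrow> real" and b :: "nat \<Rightarrow> real"
    and B1 B2 :: real and repl :: bool
  assumes K_pos: "K \<ge> 1" and R_pos: "R \<ge> 1" and B_le: "B1 \<le> B2"
begin

definition slack :: "constr \<Rightarrow> (nat \<Rightarrow> real) \<Rightarrow> real" where
  "slack c x = (\<Sum>k<K. a (snd c) k * x (fst c ! k)) - b (snd c)"

definition pen :: "constr \<Rightarrow> (nat \<Rightarrow> real) \<Rightarrow> real" where
  "pen c x = max 0 (slack c x)"

text \<open>
  Assignments are total functions that lie in the interval at every index, not only below \<open>n\<close>; this
  makes the optimum independent of the number of variables.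
\<close>

definition box :: "(nat \<Rightarrow> real) set" where
  "box = {x. \<forall>i. x i \<in> {B1..B2}}"

definition constrs :: "nat set \<Rightarrow> constr set" where
  "constrs U = {c. length (fst c) = K \<and> set (fst c) \<subseteq> U \<and> (\<not> repl \<longrightarrow> distinct (fst c)) \<and> snd c < R}"

definition cost :: "nat set \<Rightarrow> (nat \<Rightarrow> constr) \<Rightarrow> (nat \<Rightarrow> real) \<Rightarrow> real" where
  "cost J C x = (\<Sum>j\<in>J. pen (C j) x)"

definition opt :: "nat set \<Rightarrow> (nat \<Rightarrow> constr) \<Rightarrow> real" where
  "opt J C = Inf (cost J C ` box)"

definition coef_bound :: real where
  "coef_bound = (\<Sum>r<R. \<Sum>k<K. \<bar>a r k\<bar>)"

text \<open>
  A crude common bound for all penalties over the box.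
\<close>

definition pen_bound :: real where
  "pen_bound = (\<Sum>r<R. (\<Sum>k<K. \<bar>a r k\<bar> * (\<bar>B1\<bar> + \<bar>B2\<bar>)) + \<bar>b r\<bar>)"

lemma constrsD:
  assumes "c \<in> constrs U"
  shows "length (fst c) = K" "set (fst c) \<subseteq> U" "snd c < R"
    "\<And>k. k < K \<Longrightarrow> fst c ! k \<in> set (fst c)"
  using assms by (auto simp: constrs_def)

lemma constrs_mono: "U \<subseteq> V \<Longrightarrow> constrs U \<subseteq> constrs V"
  by (auto simp: constrs_def)

lemma constrs_eq_Times: "constrs {..<n} = index_tuples repl K n \<times> {..<R}"
  by (auto simp: constrs_def index_tuples_def)

lemma boxD: "x \<in> box \<Longrightarrow> B1 \<le> x i \<and> x i \<le> B2"
  by (auto simp: box_def)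

lemma const_in_box: "(\<lambda>_. B1) \<in> box"
  using B_le by (auto simp: box_def)

lemma box_nonempty: "box \<noteq> {}"
  using const_in_box by blast

lemma coef_le:
  assumes "r < R" "k < K" shows "\<bar>a r k\<bar> \<le> coef_bound"
proof -
  have "\<bar>a r k\<bar> \<le> (\<Sum>k<K. \<bar>a r k\<bar>)"
    by (rule member_le_sum) (use assms in auto)
  also have "\<dots> \<le> coef_bound" unfolding coef_bound_def
    by (rule member_le_sum[of r _ "\<lambda>r. \<Sum>k<K. \<bar>a r k\<bar>"]) (use assms in \<open>auto intro: sum_nonneg\<close>)
  finally show ?thesis .
qed

lemma coef_bound_nonneg: "0 \<le> coef_bound"
  unfolding coef_bound_def by (intro sum_nonneg) auto

lemma pen_nonneg: "0 \<le> pen c x"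
  by (simp add: pen_def)

lemma pen_bound_nonneg: "0 \<le> pen_bound"
  unfolding pen_bound_def by (intro sum_nonneg add_nonneg_nonneg mult_nonneg_nonneg) auto

lemma pen_le:
  assumes "snd c < R" "x \<in> box"
  shows "pen c x \<le> pen_bound"
proof -
  let ?r = "snd c"
  have "slack c x \<le> (\<Sum>k<K. \<bar>a ?r k\<bar> * (\<bar>B1\<bar> + \<bar>B2\<bar>)) + \<bar>b ?r\<bar>"
    unfolding slack_def
  proof -
    have "(\<Sum>k<K. a ?r k * x (fst c ! k)) \<le> (\<Sum>k<K. \<bar>a ?r k\<bar> * (\<bar>B1\<bar> + \<bar>B2\<bar>))"
    proof (rule sum_mono)
      fix k
      have "\<bar>x (fst c ! k)\<bar> \<le> \<bar>B1\<bar> + \<bar>B2\<bar>"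
        using boxD[OF assms(2), of "fst c ! k"] by linarith
      then have "\<bar>a ?r k\<bar> * \<bar>x (fst c ! k)\<bar> \<le> \<bar>a ?r k\<bar> * (\<bar>B1\<bar> + \<bar>B2\<bar>)"
        by (intro mult_left_mono) auto
      then show "a ?r k * x (fst c ! k) \<le> \<bar>a ?r k\<bar> * (\<bar>B1\<bar> + \<bar>B2\<bar>)"
        by (metis abs_ge_self abs_mult order_trans)
    qed
    then show "(\<Sum>k<K. a ?r k * x (fst c ! k)) - b ?r \<le> (\<Sum>k<K. \<bar>a ?r k\<bar> * (\<bar>B1\<bar> + \<bar>B2\<bar>)) + \<bar>b ?r\<bar>"
      by linarith
  qed
  also have "\<dots> \<le> pen_bound" unfolding pen_bound_def
    by (rule member_le_sum[of ?r _ "\<lambda>r. (\<Sum>k<K. \<bar>a r k\<bar> * (\<bar>B1\<bar> + \<bar>B2\<bar>)) + \<bar>b r\<bar>"])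
       (use assms in \<open>auto intro!: sum_nonneg add_nonneg_nonneg\<close>)
  finally show ?thesis using pen_bound_nonneg by (simp add: pen_def)
qed

lemma slack_cong:
  assumes "c \<in> constrs U" "\<And>i. i \<in> set (fst c) \<Longrightarrow> x i = y i"
  shows "slack c x = slack c y" "pen c x = pen c y"
proof -
  show "slack c x = slack c y"
    using assms by (auto simp: slack_def constrs_def intro!: sum.cong)
  then show "pen c x = pen c y" by (simp add: pen_def)
qed

lemma cost_nonneg: "0 \<le> cost J C x"
  unfolding cost_def by (intro sum_nonneg pen_nonneg)

lemma opt_le_cost: "x \<in> box \<Longrightarrow> opt J C \<le> cost J C x"
  unfolding opt_def by (rule cINF_lower) (auto intro!: bdd_belowI2[of _ 0] cost_nonneg)

lemma opt_greatest: "(\<And>x. x \<in> box \<Longrightarrow> L \<le> cost J C x) \<Longrightarrow> L \<le> opt J C"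
  unfolding opt_def by (rule cINF_greatest[OF box_nonempty])

lemma opt_nonneg: "0 \<le> opt J C"
  by (rule opt_greatest) (rule cost_nonneg)

lemma opt_cong: "(\<And>j. j \<in> J \<Longrightarrow> C j = C' j) \<Longrightarrow> opt J C = opt J C'"
  unfolding opt_def cost_def by (simp cong: sum.cong)

lemma opt_empty: "opt {} C = 0"
  using opt_le_cost[OF const_in_box, of "{}" C] opt_nonneg[of "{}" C] by (simp add: cost_def)

lemma opt_mono:
  assumes "finite J" "I \<subseteq> J"
  shows "opt I C \<le> opt J C"
proof (rule opt_greatest)
  fix x assume "x \<in> box"
  then have "opt I C \<le> cost I C x" by (rule opt_le_cost)
  also have "\<dots> \<le> cost J C x"
    unfolding cost_def using assms by (intro sum_mono2) (auto intro: pen_nonneg)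
  finally show "opt I C \<le> cost J C x" .
qed

lemma opt_insert_le:
  assumes "finite J" "snd (C j) < R"
  shows "opt (insert j J) C \<le> opt J C + pen_bound"
proof -
  have "opt (insert j J) C - pen_bound \<le> opt J C"
  proof (rule opt_greatest)
    fix x assume x: "x \<in> box"
    have "opt (insert j J) C \<le> cost (insert j J) C x" by (rule opt_le_cost[OF x])
    also have "\<dots> \<le> cost J C x + pen (C j) x"
      unfolding cost_def using assms(1) by (cases "j \<in> J") (auto simp: insert_absorb pen_nonneg)
    finally show "opt (insert j J) C - pen_bound \<le> cost J C x"
      using pen_le[OF assms(2) x] by linarith
  qed
  then show ?thesis by linarith
qed

text \<open>
  The optimum without constraint \<open>j\<close> is a lower bound for both optima, and putting back any
  constraint at \<open>j\<close> raises it by at most one maximal penalty.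
\<close>

lemma opt_update_diff:
  assumes "finite J" "j \<in> J" "snd (C j) < R" "snd y < R"
  shows "\<bar>opt J (C(j := y)) - opt J C\<bar> \<le> pen_bound"
proof -
  let ?J = "J - {j}"
  have J: "insert j ?J = J" using assms by auto
  have eq: "opt ?J (C(j := y)) = opt ?J C" by (rule opt_cong) auto
  have "opt J (C(j := y)) \<le> opt ?J C + pen_bound" "opt J C \<le> opt ?J C + pen_bound"
    using opt_insert_le[of ?J "C(j := y)" j] opt_insert_le[of ?J "C" j] assms J eq by auto
  moreover have "opt ?J C \<le> opt J C" "opt ?J C \<le> opt J (C(j := y))"
    using opt_mono[of J ?J C] opt_mono[of J ?J "C(j := y)"] assms eq by auto
  ultimately show ?thesis by linarith
qed

text \<open>
  For a given assignment the cheapest slack variables are the penalties, and the value of the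
  assignment at indices not below \<open>n\<close> is irrelevant because no constraint mentions them.
\<close>

lemma lp_value_eq_opt:
  assumes "\<And>j. j < num_constraints c n \<Longrightarrow> C j \<in> constrs {..<n}"
  shows "lp_value K a b B1 B2 n c C = opt {..<num_constraints c n} C"
proof -
  let ?m = "num_constraints c n"
  let ?S = "{\<Sum>j<?m. \<psi> j | x \<psi>. lp_feasible K a b B1 B2 n ?m C x \<psi>}"
  have feas: "lp_feasible K a b B1 B2 n ?m C x \<psi> \<longleftrightarrow>
     (\<forall>j<?m. slack (C j) x \<le> \<psi> j \<and> 0 \<le> \<psi> j) \<and> (\<forall>i<n. x i \<in> {B1..B2})" for x \<psi>
    unfolding lp_feasible_def slack_def by force
  have in_S: "cost {..<?m} C x \<in> ?S" if "x \<in> box" for x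
  proof -
    have "lp_feasible K a b B1 B2 n ?m C x (\<lambda>j. pen (C j) x)"
      unfolding feas using boxD[OF that] by (auto simp: pen_def)
    then show ?thesis unfolding cost_def by blast
  qed
  have lower: "opt {..<?m} C \<le> s" if "s \<in> ?S" for s
  proof -
    from that obtain x \<psi> where s: "s = (\<Sum>j<?m. \<psi> j)" and f: "lp_feasible K a b B1 B2 n ?m C x \<psi>"
      by blast
    define x' where "x' i = (if i < n then x i else B1)" for i
    have "x' \<in> box" using f B_le unfolding feas x'_def box_def by auto
    then have "opt {..<?m} C \<le> cost {..<?m} C x'" by (rule opt_le_cost)
    also have "\<dots> = cost {..<?m} C x"
      unfolding cost_def using assms
      by (intro sum.cong refl slack_cong(2)[of _ "{..<n}"]) (auto simp: x'_def constrs_def)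
    also have "\<dots> \<le> s" unfolding s cost_def
      by (rule sum_mono) (use f in \<open>auto simp: feas pen_def\<close>)
    finally show ?thesis .
  qed
  show ?thesis unfolding lp_value_def
  proof (rule antisym)
    show "Inf ?S \<le> opt {..<?m} C"
      by (rule opt_greatest, rule cInf_lower[OF in_S]) (auto intro!: bdd_belowI lower)
    show "opt {..<?m} C \<le> Inf ?S"
      by (rule cInf_greatest) (use in_S[OF const_in_box] lower in blast)+
  qed
qed

section \<open>Degree-scaled subgradient descent\<close>

definition clip :: "real \<Rightarrow> real" where
  "clip u = max B1 (min B2 u)"

text \<open>
  Occurrences are counted with multiplicity, so that the degrees sum to \<open>K\<close> times the number of
  constraints also when index tuples have repetitions.
\<close>

definition deg :: "nat set \<Rightarrow> (nat \<Rightarrow> constr) \<Rightarrow> nat \<Rightarrow> real" where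
  "deg J C i = (\<Sum>j\<in>J. \<Sum>k<K. of_bool (fst (C j) ! k = i))"

text \<open>
  A subgradient of the cost: the penalty of a constraint has gradient 0 where it vanishes and the
  gradient of its linear form elsewhere.
\<close>

definition subgrad :: "nat set \<Rightarrow> (nat \<Rightarrow> constr) \<Rightarrow> (nat \<Rightarrow> real) \<Rightarrow> nat \<Rightarrow> real" where
  "subgrad J C x i = (\<Sum>j\<in>J. of_bool (slack (C j) x > 0) *
       (\<Sum>k<K. of_bool (fst (C j) ! k = i) * a (snd (C j)) k))"

text \<open>
  Projected subgradient descent from the constant assignment \<open>B1\<close>.  The step is divided by
  the degree; for an isolated variable the quotient is 0 and the variable stays at \<open>B1\<close>.
\<close>

fun descent :: "real \<Rightarrow> nat set \<Rightarrow> (nat \<Rightarrow> constr) \<Rightarrow> nat \<Rightarrow> nat \<Rightarrow> real" where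
  "descent \<eta> J C 0 i = B1"
| "descent \<eta> J C (Suc t) i =
     clip (descent \<eta> J C t i - \<eta> / deg J C i * subgrad J C (descent \<eta> J C t) i)"

lemma descent_in_box: "descent \<eta> J C t \<in> box"
  using B_le by (cases t) (auto simp: box_def clip_def)

lemma clip_contracts:
  assumes "B1 \<le> z" "z \<le> B2"
  shows "(clip u - z)\<^sup>2 \<le> (u - z)\<^sup>2"
proof -
  have "\<bar>clip u - z\<bar> \<le> \<bar>u - z\<bar>" using assms by (auto simp: clip_def)
  then show ?thesis by (simp add: abs_le_square_iff)
qed

lemma deg_nonneg: "0 \<le> deg J C i"
  unfolding deg_def by (intro sum_nonneg) auto

lemma abs_subgrad_le:
  assumes "\<And>j. j \<in> J \<Longrightarrow> snd (C j) < R"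
  shows "\<bar>subgrad J C x i\<bar> \<le> coef_bound * deg J C i"
proof -
  let ?g = "\<lambda>j. \<Sum>k<K. of_bool (fst (C j) ! k = i) * a (snd (C j)) k"
  have "\<bar>subgrad J C x i\<bar> \<le> (\<Sum>j\<in>J. \<bar>of_bool (slack (C j) x > 0) *  ?g j\<bar>)"
    unfolding subgrad_def by (rule sum_abs)
  also have "\<dots> \<le> (\<Sum>j\<in>J. \<Sum>k<K. \<bar>of_bool (fst (C j) ! k = i) * a (snd (C j)) k\<bar>)"
  proof (rule sum_mono)
    fix j
    have "\<bar>of_bool (slack (C j) x > 0) * ?g j\<bar>
        \<le> \<bar>\<Sum>k<K. of_bool (fst (C j) ! k = i) * a (snd (C j)) k\<bar>"
      by (simp add: abs_mult)
    also have "\<dots> \<le> (\<Sum>k<K. \<bar>of_bool (fst (C j) ! k = i) * a (snd (C j)) k\<bar>)" by (rule sum_abs)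
    finally show "\<bar>of_bool (slack (C j) x > 0) * ?g j\<bar>
      \<le> (\<Sum>k<K. \<bar>of_bool (fst (C j) ! k = i) * a (snd (C j)) k\<bar>)" .
  qed
  also have "\<dots> \<le> (\<Sum>j\<in>J. \<Sum>k<K. coef_bound * of_bool (fst (C j) ! k = i))"
    using coef_le assms by (intro sum_mono) (auto simp: abs_mult)
  finally show ?thesis by (simp only: deg_def sum_distrib_left)
qed

text \<open>
  Double counting: a degree-weighted sum over variables is a sum over the variable slots of the
  constraints.
\<close>

lemma sum_deg:
  assumes "finite J" "finite V" "C ` J \<subseteq> constrs V"
  shows "(\<Sum>i\<in>V. deg J C i * f i) = (\<Sum>j\<in>J. \<Sum>k<K. f (fst (C j) ! k))"
proof -
  have "(\<Sum>i\<in>V. deg J C i * f i) = (\<Sum>i\<in>V. \<Sum>j\<in>J. \<Sum>k<K. of_bool (fst (C j) ! k = i) * f i)"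
    by (simp add: deg_def sum_distrib_right)
  also have "\<dots> = (\<Sum>j\<in>J. \<Sum>i\<in>V. \<Sum>k<K. of_bool (fst (C j) ! k = i) * f i)"
    by (rule sum.swap)
  also have "\<dots> = (\<Sum>j\<in>J. \<Sum>k<K. \<Sum>i\<in>V. of_bool (fst (C j) ! k = i) * f i)"
    by (intro sum.cong refl sum.swap)
  also have "\<dots> = (\<Sum>j\<in>J. \<Sum>k<K. f (fst (C j) ! k))"
  proof (intro sum.cong refl)
    fix j k assume "j \<in> J" "k \<in> {..<K}"
    then have "fst (C j) ! k \<in> V" using assms(3) constrsD(2,4)[of "C j" V] by blast
    then show "(\<Sum>i\<in>V. of_bool (fst (C j) ! k = i) * f i) = f (fst (C j) ! k)"
      using assms(2) by (subst sum.remove[of _ "fst (C j) ! k"]) auto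
  qed
  finally show ?thesis .
qed

text \<open>
  The subgradient inequality for the cost, which is where convexity enters.
\<close>

lemma subgrad_inner:
  assumes "finite J" "finite V" "C ` J \<subseteq> constrs V"
  shows "cost J C x - cost J C z \<le> (\<Sum>i\<in>V. subgrad J C x i * (x i - z i))"
proof -
  let ?T = "\<lambda>j k i. of_bool (slack (C j) x > 0) * (of_bool (fst (C j) ! k = i) * (a (snd (C j)) k * (x i - z i)))"
  have "(\<Sum>i\<in>V. subgrad J C x i * (x i - z i)) =
    (\<Sum>i\<in>V. \<Sum>j\<in>J. \<Sum>k<K. ?T j k i)"
    by (simp only: subgrad_def sum_distrib_right sum_distrib_left mult.assoc)
  also have "\<dots> = (\<Sum>j\<in>J. \<Sum>i\<in>V. \<Sum>k<K. ?T j k i)"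
    by (rule sum.swap)
  also have "\<dots> = (\<Sum>j\<in>J. \<Sum>k<K. \<Sum>i\<in>V. ?T j k i)"
    by (intro sum.cong refl sum.swap)
  also have "\<dots> = (\<Sum>j\<in>J. \<Sum>k<K. of_bool (slack (C j) x > 0) * (a (snd (C j)) k * (x (fst (C j) ! k) - z (fst (C j) ! k))))"
  proof (intro sum.cong refl)
    fix j k assume "j \<in> J" "k \<in> {..<K}"
    then have "fst (C j) ! k \<in> V" using assms(3) constrsD(2,4)[of "C j" V] by blast
    then show "(\<Sum>i\<in>V. ?T j k i)
      = of_bool (slack (C j) x > 0) * (a (snd (C j)) k * (x (fst (C j) ! k) - z (fst (C j) ! k)))"
      using assms(2) by (subst sum.remove[of _ "fst (C j) ! k"]) auto
  qed
  also have "\<dots> = (\<Sum>j\<in>J. of_bool (slack (C j) x > 0) * (slack (C j) x - slack (C j) z))"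
    by (simp add: slack_def right_diff_distrib sum_distrib_left sum_subtractf)
  also have "\<dots> \<ge> (\<Sum>j\<in>J. pen (C j) x - pen (C j) z)"
    by (rule sum_mono) (auto simp: pen_def)
  finally show ?thesis by (simp add: cost_def sum_subtractf)
qed

text \<open>
  The standard one-step estimate, in the norm that weights variable \<open>i\<close> by its degree.  With this
  weighting the quadratic error term is a sum of \<open>subgrad\<^sup>2 / deg\<close>, and since the
  subgradient is at most \<open>coef_bound * deg\<close> this is linear in the degrees.  The total error is then
  proportional to the number of constraints, however irregular the degrees are.
\<close>

lemma descent_step:
  assumes J: "finite J" and V: "finite V" and C: "C ` J \<subseteq> constrs V" and z: "z \<in> box" and \<eta>: "\<eta> > 0"
  defines "x \<equiv> descent \<eta> J C"
  shows "(\<Sum>i\<in>V. deg J C i * (x (Suc t) i - z i)\<^sup>2) + 2 * \<eta> * (cost J C (x t) - cost J C z)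
    \<le> (\<Sum>i\<in>V. deg J C i * (x t i - z i)\<^sup>2) + \<eta>\<^sup>2 * coef_bound\<^sup>2 * (real (card J) * real K)"
proof -
  have R: "snd (C j) < R" if "j \<in> J" for j using C that constrsD(3) by blast
  let ?d = "deg J C" and ?g = "subgrad J C (x t)"
  have step: "?d i * (x (Suc t) i - z i)\<^sup>2 \<le> ?d i * (x t i - z i)\<^sup>2 - 2 * \<eta> * (?g i * (x t i - z i))
      + \<eta>\<^sup>2 * coef_bound\<^sup>2 * ?d i" for i
  proof (cases "?d i = 0")
    case True
    then have "?g i = 0" using abs_subgrad_le[of J C "x t" i] R by auto
    then show ?thesis using True by simp
  next
    case False
    then have d: "?d i > 0" using deg_nonneg[of J C i] by simp
    let ?u = "x t i - \<eta> / ?d i * ?g i"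
    have "(x (Suc t) i - z i)\<^sup>2 \<le> (?u - z i)\<^sup>2"
      unfolding x_def descent.simps by (rule clip_contracts) (use boxD[OF z] in auto)
    then have "?d i * (x (Suc t) i - z i)\<^sup>2 \<le> ?d i * (?u - z i)\<^sup>2"
      using d by (intro mult_left_mono) auto
    also have "\<dots> = ?d i * (x t i - z i)\<^sup>2 - 2 * \<eta> * (?g i * (x t i - z i)) + \<eta>\<^sup>2 * ((?g i)\<^sup>2 / ?d i)"
      using d by (simp add: field_simps power2_eq_square)
    also have "(?g i)\<^sup>2 / ?d i \<le> coef_bound\<^sup>2 * ?d i"
    proof -
      have "\<bar>?g i\<bar> \<le> \<bar>coef_bound * ?d i\<bar>" using abs_subgrad_le[of J C "x t" i] R by force
      then have "(?g i)\<^sup>2 \<le> (coef_bound * ?d i)\<^sup>2" by (simp add: abs_le_square_iff)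
      then show ?thesis using d by (simp add: divide_le_eq power2_eq_square mult_ac)
    qed
    then have "\<eta>\<^sup>2 * ((?g i)\<^sup>2 / ?d i) \<le> \<eta>\<^sup>2 * (coef_bound\<^sup>2 * ?d i)" by (rule mult_left_mono) auto
    finally show ?thesis by (simp add: mult.assoc)
  qed
  have "(\<Sum>i\<in>V. ?d i * (x (Suc t) i - z i)\<^sup>2) \<le> (\<Sum>i\<in>V. ?d i * (x t i - z i)\<^sup>2
      - 2 * \<eta> * (?g i * (x t i - z i)) + \<eta>\<^sup>2 * coef_bound\<^sup>2 * ?d i)"
    by (rule sum_mono) (rule step)
  also have "\<dots> = (\<Sum>i\<in>V. ?d i * (x t i - z i)\<^sup>2) - 2 * \<eta> * (\<Sum>i\<in>V. ?g i * (x t i - z i))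
      + \<eta>\<^sup>2 * coef_bound\<^sup>2 * (\<Sum>i\<in>V. ?d i)"
    by (simp add: sum.distrib sum_subtractf sum_distrib_left)
  also have "(\<Sum>i\<in>V. ?d i) = real (card J) * real K"
    using sum_deg[OF J V C, where f = "\<lambda>_. 1"] by simp
  finally have *: "(\<Sum>i\<in>V. ?d i * (x (Suc t) i - z i)\<^sup>2) \<le> (\<Sum>i\<in>V. ?d i * (x t i - z i)\<^sup>2)
     - 2 * \<eta> * (\<Sum>i\<in>V. ?g i * (x t i - z i)) + \<eta>\<^sup>2 * coef_bound\<^sup>2 * (real (card J) * real K)" .
  have "2 * \<eta> * (cost J C (x t) - cost J C z) \<le> 2 * \<eta> * (\<Sum>i\<in>V. ?g i * (x t i - z i))"
    using subgrad_inner[OF J V C, where x = "x t" and z = z] \<eta> by (intro mult_left_mono) auto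
  with * show ?thesis by linarith
qed

lemma descent_sum:
  assumes J: "finite J" and V: "finite V" and C: "C ` J \<subseteq> constrs V" and z: "z \<in> box" and \<eta>: "\<eta> > 0"
  shows "(\<Sum>i\<in>V. deg J C i * (descent \<eta> J C T i - z i)\<^sup>2)
      + 2 * \<eta> * (\<Sum>t<T. cost J C (descent \<eta> J C t) - cost J C z)
    \<le> real (card J) * real K * (B2 - B1)\<^sup>2 + real T * (\<eta>\<^sup>2 * coef_bound\<^sup>2 * (real (card J) * real K))"
proof (induction T)
  case 0
  have "(\<Sum>i\<in>V. deg J C i * (descent \<eta> J C 0 i - z i)\<^sup>2) = (\<Sum>j\<in>J. \<Sum>k<K. (B1 - z (fst (C j) ! k))\<^sup>2)"
    using sum_deg[OF J V C] by simp
  also have "\<dots> \<le> (\<Sum>j\<in>J. \<Sum>k<K. (B2 - B1)\<^sup>2)"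
    using boxD[OF z] B_le by (intro sum_mono) (auto simp: abs_le_square_iff[symmetric])
  finally show ?case by simp
next
  case (Suc T)
  then show ?case using descent_step[OF J V C z \<eta>, where t = T]
    by (simp add: distrib_left distrib_right del: descent.simps)
qed

text \<open>
  Step size \<open>1/q\<close> over \<open>q\<^sup>2\<close> steps balances the initial distance, which is divided by
  step size times number of steps, against the accumulated quadratic error, which is proportional to
  the step size.
\<close>

lemma opt_near_descent:
  assumes J: "finite J" and C: "C ` J \<subseteq> constrs V" and V: "finite V" and q: "q > 0"
  defines "F \<equiv> (\<Sum>t<q\<^sup>2. cost J C (descent (1 / real q) J C t)) / real (q\<^sup>2)"
  shows "opt J C \<le> F"
    and "F \<le> opt J C + real (card J) * real K * ((B2 - B1)\<^sup>2 + coef_bound\<^sup>2) / (2 * real q)"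
proof -
  let ?x = "descent (1 / real q) J C"
  have q2: "real (q\<^sup>2) > 0" using q by simp
  have "(\<Sum>t<q\<^sup>2. opt J C) \<le> (\<Sum>t<q\<^sup>2. cost J C (?x t))"
    by (intro sum_mono opt_le_cost descent_in_box)
  then show "opt J C \<le> F" unfolding F_def using q2 by (simp add: field_simps)
  let ?e = "real (card J) * real K * ((B2 - B1)\<^sup>2 + coef_bound\<^sup>2) / (2 * real q)"
  have "F - ?e \<le> opt J C"
  proof (rule opt_greatest)
    fix z assume z: "z \<in> box"
    let ?S = "\<Sum>t<q\<^sup>2. cost J C (?x t) - cost J C z" and ?M = "real (card J) * real K"
    have "0 \<le> (\<Sum>i\<in>V. deg J C i * (?x (q\<^sup>2) i - z i)\<^sup>2)"
      by (intro sum_nonneg mult_nonneg_nonneg deg_nonneg) auto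
    moreover have "1 / real q > 0" using q by simp
    ultimately have "2 * (1 / real q) * ?S \<le> ?M * (B2 - B1)\<^sup>2
        + real (q\<^sup>2) * ((1 / real q)\<^sup>2 * coef_bound\<^sup>2 * ?M)"
      using descent_sum[OF J V C z, where \<eta> = "1 / real q" and T = "q\<^sup>2"] by linarith
    also have "real (q\<^sup>2) * ((1 / real q)\<^sup>2 * coef_bound\<^sup>2 * ?M) = coef_bound\<^sup>2 * ?M"
      using q by (simp add: power_divide)
    finally have "2 * (1 / real q) * ?S \<le> ?M * ((B2 - B1)\<^sup>2 + coef_bound\<^sup>2)"
      by (simp add: algebra_simps)
    then have "(real q / 2) * (2 * (1 / real q) * ?S)
        \<le> (real q / 2) * (?M * ((B2 - B1)\<^sup>2 + coef_bound\<^sup>2))"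
      by (rule mult_left_mono) simp
    moreover have "(real q / 2) * (2 * (1 / real q) * ?S) = ?S"
      using q by simp
    moreover have "(real q / 2) * (?M * ((B2 - B1)\<^sup>2 + coef_bound\<^sup>2)) = real (q\<^sup>2) * ?e"
      using q by (simp add: power2_eq_square)
    ultimately have "?S \<le> real (q\<^sup>2) * ?e"
      by linarith
    moreover have "?S = (\<Sum>t<q\<^sup>2. cost J C (?x t)) - real (q\<^sup>2) * cost J C z"
      by (simp add: sum_subtractf)
    ultimately have "(\<Sum>t<q\<^sup>2. cost J C (?x t)) \<le> real (q\<^sup>2) * (cost J C z + ?e)"
      by (subst distrib_left) linarith
    then have "(\<Sum>t<q\<^sup>2. cost J C (?x t)) / real (q\<^sup>2) \<le> cost J C z + ?e"
      using q2 by (simp only: pos_divide_le_eq mult.commute)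
    then show "F - ?e \<le> cost J C z" unfolding F_def by linarith
  qed
  then show "F \<le> opt J C + ?e" by linarith
qed


section \<open>Locality of the descent\<close>

definition verts :: "nat set \<Rightarrow> (nat \<Rightarrow> constr) \<Rightarrow> nat set" where
  "verts S C = (\<Union>j\<in>S. set (fst (C j)))"

definition grow :: "nat set \<Rightarrow> (nat \<Rightarrow> constr) \<Rightarrow> nat set \<Rightarrow> nat set" where
  "grow J C S = {j\<in>J. set (fst (C j)) \<inter> verts S C \<noteq> {}}"

text \<open>
  Breadth-first search among the constraints in \<open>J\<close>: those reached from \<open>S\<close> by at most \<open>t\<close> hops
  through shared variables.
\<close>

definition ball :: "nat set \<Rightarrow> (nat \<Rightarrow> constr) \<Rightarrow> nat \<Rightarrow> nat set \<Rightarrow> nat set" where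
  "ball J C t S = (grow J C ^^ t) S"

lemma ball_0 [simp]: "ball J C 0 S = S"
  by (simp add: ball_def)

lemma ball_Suc: "ball J C (Suc t) S = grow J C (ball J C t S)"
  by (simp add: ball_def)

lemma ball_Suc': "ball J C (Suc t) S = ball J C t (grow J C S)"
  by (simp add: ball_def funpow_swap1)

lemma constrs_nonempty:
  assumes "c \<in> constrs U" shows "set (fst c) \<noteq> {}"
  using assms K_pos by (auto simp: constrs_def)

lemma verts_mono: "S \<subseteq> T \<Longrightarrow> verts S C \<subseteq> verts T C"
  by (auto simp: verts_def)

lemma verts_subset: "C ` S \<subseteq> constrs U \<Longrightarrow> verts S C \<subseteq> U"
  by (auto simp: verts_def constrs_def)

lemma finite_verts: "finite S \<Longrightarrow> finite (verts S C)"
  by (auto simp: verts_def)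

lemma ball_subset: "S \<subseteq> J \<Longrightarrow> ball J C t S \<subseteq> J"
  by (cases t) (auto simp: ball_Suc grow_def)

lemma subset_grow:
  assumes "C ` J \<subseteq> constrs U" "S \<subseteq> J" shows "S \<subseteq> grow J C S"
proof
  fix j assume j: "j \<in> S"
  then have "set (fst (C j)) \<noteq> {}" using assms constrs_nonempty[of "C j" U] by blast
  moreover have "set (fst (C j)) \<subseteq> verts S C" using j by (auto simp: verts_def)
  ultimately have "set (fst (C j)) \<inter> verts S C \<noteq> {}" by (simp add: Int_absorb2)
  then show "j \<in> grow J C S" using j assms(2) by (simp add: grow_def subset_iff)
qed

lemma ball_Suc_superset:
  assumes "C ` J \<subseteq> constrs U" "S \<subseteq> J" shows "ball J C t S \<subseteq> ball J C (Suc t) S"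
  unfolding ball_Suc by (rule subset_grow[OF assms(1) ball_subset[OF assms(2)]])

lemma ball_le_superset:
  assumes "C ` J \<subseteq> constrs U" "S \<subseteq> J" "s \<le> t" shows "ball J C s S \<subseteq> ball J C t S"
  using assms(3)
proof (induction rule: dec_induct)
  case (step n)
  then show ?case using ball_Suc_superset[OF assms(1,2), of n] by simp
qed simp

lemma subset_ball:
  assumes "C ` J \<subseteq> constrs U" "S \<subseteq> J" shows "S \<subseteq> ball J C t S"
  using ball_le_superset[OF assms, of 0 t] by simp

lemma deg_incident:
  assumes "finite J" "C ` J \<subseteq> constrs U"
  shows "deg J C i = deg {j\<in>J. i \<in> set (fst (C j))} C i"
  unfolding deg_def
proof (rule sum.mono_neutral_right)
  show "\<forall>j\<in>J - {j\<in>J. i \<in> set (fst (C j))}. (\<Sum>k<K. of_bool (fst (C j) ! k = i)) = (0::real)"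
  proof (intro ballI sum.neutral)
    fix j k assume "j \<in> J - {j\<in>J. i \<in> set (fst (C j))}" "k \<in> {..<K}"
    then show "of_bool (fst (C j) ! k = i) = (0::real)"
      using constrsD(4)[of "C j" U k] assms(2) by auto
  qed
qed (use assms in auto)

lemma subgrad_incident:
  assumes "finite J" "C ` J \<subseteq> constrs U"
  shows "subgrad J C x i = subgrad {j\<in>J. i \<in> set (fst (C j))} C x i"
  unfolding subgrad_def
proof (rule sum.mono_neutral_right)
  show "\<forall>j\<in>J - {j\<in>J. i \<in> set (fst (C j))}. of_bool (slack (C j) x > 0) *
      (\<Sum>k<K. of_bool (fst (C j) ! k = i) * a (snd (C j)) k) = 0"
  proof
    fix j assume j: "j \<in> J - {j\<in>J. i \<in> set (fst (C j))}"
    have "(\<Sum>k<K. of_bool (fst (C j) ! k = i) * a (snd (C j)) k) = 0"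
    proof (rule sum.neutral, rule ballI)
      fix k assume "k \<in> {..<K}"
      then show "of_bool (fst (C j) ! k = i) * a (snd (C j)) k = 0"
        using constrsD(4)[of "C j" U k] assms(2) j by auto
    qed
    then show "of_bool (slack (C j) x > 0) * (\<Sum>k<K. of_bool (fst (C j) ! k = i) * a (snd (C j)) k) = 0"
      by simp
  qed
qed (use assms in auto)

text \<open>
  A descent step at a variable reads only the constraints that contain it and the current values at
  their variables, so \<open>t\<close> steps at the variables of \<open>S\<close> read only the ball of radius \<open>t\<close> around \<open>S\<close>.
\<close>

lemma descent_local:
  assumes "finite J" "C ` J \<subseteq> constrs U" "I \<subseteq> J" "S \<subseteq> J" "ball J C t S \<subseteq> I" "i \<in> verts S C"
  shows "descent \<eta> J C t i = descent \<eta> I C t i"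
  using assms(4-6)
proof (induction t arbitrary: S i)
  case 0
  then show ?case by simp
next
  case (Suc t)
  define T where "T = grow J C S"
  have TJ: "T \<subseteq> J" by (auto simp: T_def grow_def)
  have ball_T: "ball J C t T \<subseteq> I" using Suc.prems by (simp add: T_def ball_Suc')
  have T_I: "T \<subseteq> I" using subset_ball[OF assms(2) TJ] ball_T by blast
  have ST: "S \<subseteq> T" unfolding T_def by (rule subset_grow[OF assms(2) Suc.prems(1)])
  have IH: "descent \<eta> J C t v = descent \<eta> I C t v" if "v \<in> verts T C" for v
    by (rule Suc.IH[OF TJ ball_T that])
  let ?N = "{j\<in>J. i \<in> set (fst (C j))}"
  have N_T: "?N \<subseteq> T" using Suc.prems(3) by (auto simp: T_def grow_def)
  then have N_I: "?N = {j\<in>I. i \<in> set (fst (C j))}" using T_I assms(3) by blast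
  have I: "finite I" "C ` I \<subseteq> constrs U" using assms(1-3) finite_subset by auto
  have deg: "deg J C i = deg I C i"
    using deg_incident[OF assms(1,2), of i] deg_incident[OF I, of i] N_I by simp
  have sl: "slack (C j) (descent \<eta> J C t) = slack (C j) (descent \<eta> I C t)" if "j \<in> ?N" for j
  proof (rule slack_cong(1))
    show "C j \<in> constrs U" using assms(2) that by auto
    fix v assume "v \<in> set (fst (C j))"
    then show "descent \<eta> J C t v = descent \<eta> I C t v" using N_T that by (intro IH) (auto simp: verts_def)
  qed
  have "subgrad J C (descent \<eta> J C t) i = subgrad ?N C (descent \<eta> J C t) i"
    by (rule subgrad_incident[OF assms(1,2)])
  also have "\<dots> = subgrad ?N C (descent \<eta> I C t) i"
    unfolding subgrad_def using sl by (intro sum.cong refl) auto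
  also have "\<dots> = subgrad I C (descent \<eta> I C t) i"
    unfolding N_I by (rule subgrad_incident[OF I, symmetric])
  finally have sg: "subgrad J C (descent \<eta> J C t) i = subgrad I C (descent \<eta> I C t) i" .
  have "descent \<eta> J C t i = descent \<eta> I C t i"
    by (rule IH) (use verts_mono[OF ST, of C] Suc.prems(3) in blast)
  with deg sg show ?case by simp
qed

text \<open>
  The event that the ball is \<open>I\<close> splits into a condition on the constraints in \<open>I\<close> alone and the
  condition that every other constraint avoids the variables of the ball of radius one less.  This
  is the form in which independence can be used.
\<close>

lemma ball_eq_iff:
  assumes "C ` J \<subseteq> constrs U" "I \<subseteq> J" "j \<in> I"
  shows "ball J C (Suc t) {j} = I \<longleftrightarrow>
    ball I C (Suc t) {j} = I \<and> (\<forall>l\<in>J - I. set (fst (C l)) \<inter> verts (ball I C t {j}) C = {})"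
    (is "?L \<longleftrightarrow> ?P \<and> ?Q")
proof
  assume L: ?L
  have eq: "ball I C s {j} = ball J C s {j}" if "s \<le> Suc t" for s
    using that
  proof (induction s)
    case (Suc s)
    have "ball J C (Suc s) {j} \<subseteq> I"
      using ball_le_superset[OF assms(1), of "{j}", OF _ Suc.prems] assms(2,3) L by blast
    then show ?case using Suc assms(2) by (auto simp: ball_Suc grow_def)
  qed simp
  have ?P using eq[of "Suc t"] L by simp
  moreover have ?Q
  proof (rule ballI, rule ccontr)
    fix l assume l: "l \<in> J - I" "set (fst (C l)) \<inter> verts (ball I C t {j}) C \<noteq> {}"
    then have "l \<in> ball J C (Suc t) {j}" using eq[of t] by (auto simp: ball_Suc grow_def)
    then show False using L l by simp
  qed
  ultimately show "?P \<and> ?Q" by blast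
next
  assume PQ: "?P \<and> ?Q"
  have CI: "C ` I \<subseteq> constrs U" using assms by blast
  have "ball J C s {j} = ball I C s {j}" if "s \<le> Suc t" for s
    using that
  proof (induction s)
    case (Suc s)
    have "ball I C s {j} \<subseteq> ball I C t {j}"
      using Suc.prems assms(3) by (intro ball_le_superset[OF CI]) auto
    then have sub: "verts (ball I C s {j}) C \<subseteq> verts (ball I C t {j}) C" by (rule verts_mono)
    have "set (fst (C l)) \<inter> verts (ball I C s {j}) C = {}" if "l \<in> J - I" for l
      using PQ that sub by blast
    then show ?case using Suc assms(2) by (auto simp: ball_Suc grow_def)
  qed simp
  then show ?L using PQ by simp
qed

text \<open>
  A constraint that touches what is already there brings at most \<open>K - 1\<close> new variables.
\<close>

lemma card_verts_union:
  assumes "finite T" "C ` T \<subseteq> constrs U" "S \<subseteq> T"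
    "\<And>j. j \<in> T - S \<Longrightarrow> set (fst (C j)) \<inter> verts S C \<noteq> {}"
  shows "card (verts T C) \<le> card (verts S C) + card (T - S) * (K - 1)"
proof -
  have fin: "finite (verts S C)" using assms finite_subset finite_verts by metis
  have "verts T C = verts S C \<union> (\<Union>j\<in>T - S. set (fst (C j)) - verts S C)"
    using assms(3) by (auto simp: verts_def)
  then have "card (verts T C) \<le> card (verts S C) + card (\<Union>j\<in>T - S. set (fst (C j)) - verts S C)"
    by (metis card_Un_le)
  also have "card (\<Union>j\<in>T - S. set (fst (C j)) - verts S C) \<le> (\<Sum>j\<in>T - S. card (set (fst (C j)) - verts S C))"
    using assms(1) by (intro card_UN_le) auto
  also have "\<dots> \<le> (\<Sum>j\<in>T - S. K - 1)"
  proof (rule sum_mono)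
    fix j assume j: "j \<in> T - S"
    have "card (set (fst (C j)) - verts S C) < card (set (fst (C j)))"
      using assms(4)[OF j] by (intro psubset_card_mono) auto
    also have "\<dots> \<le> K" using j assms(2) constrsD(1)[of "C j" U] card_length[of "fst (C j)"] by auto
    finally show "card (set (fst (C j)) - verts S C) \<le> K - 1" by simp
  qed
  finally show ?thesis by simp
qed

text \<open>
  A connected family of \<open>s\<close> constraints has at most as many variables as a hypertree,
  \<open>1 + s (K - 1)\<close>.
\<close>

lemma card_verts_ball:
  assumes "finite J" "C ` J \<subseteq> constrs U" "j \<in> J"
  shows "card (verts (ball J C t {j}) C) \<le> 1 + card (ball J C t {j}) * (K - 1)"
proof (induction t)
  case 0
  have "card (verts {j} C) \<le> length (fst (C j))" by (simp add: verts_def card_length)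
  also have "\<dots> = 1 + (K - 1)" using assms K_pos constrsD(1)[of "C j" U] by auto
  finally show ?case by simp
next
  case (Suc t)
  let ?S = "ball J C t {j}" and ?T = "ball J C (Suc t) {j}"
  have sub: "?S \<subseteq> ?T" using assms by (intro ball_Suc_superset) auto
  have TJ: "?T \<subseteq> J" using assms by (intro ball_subset) auto
  have fin: "finite ?T" using TJ assms(1) finite_subset by blast
  have "card (verts ?T C) \<le> card (verts ?S C) + card (?T - ?S) * (K - 1)"
  proof (rule card_verts_union[OF fin _ sub])
    show "C ` ?T \<subseteq> constrs U" using TJ assms by blast
  qed (auto simp: ball_Suc grow_def)
  also have "\<dots> \<le> 1 + card ?S * (K - 1) + card (?T - ?S) * (K - 1)" using Suc by simp
  also have "\<dots> = 1 + card ?T * (K - 1)"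
    using card_Diff_subset[OF finite_subset[OF sub fin] sub] card_mono[OF fin sub]
    by (simp add: distrib_right[symmetric])
  finally show ?case .
qed

text \<open>
  A walk from \<open>j\<close> can be cut at its last visit to \<open>j\<close>; what follows starts at a neighbour of \<open>j\<close> and
  never uses \<open>j\<close>.  The right-hand balls do not depend on the constraint at \<open>j\<close>, which
  gives the recursion for their expected size.
\<close>

lemma ball_remove_root:
  assumes "C ` J \<subseteq> constrs U" "j \<in> J"
  shows "ball J C (Suc t) {j} \<subseteq>
    insert j (\<Union>l\<in>{l\<in>J - {j}. set (fst (C l)) \<inter> set (fst (C j)) \<noteq> {}}. ball (J - {j}) C t {l})"
    (is "_ \<subseteq> ?B t")
proof (induction t)
  case 0
  then show ?case by (auto simp: ball_Suc grow_def verts_def)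
next
  case (Suc t)
  show ?case
  proof
    fix x assume "x \<in> ball J C (Suc (Suc t)) {j}"
    then obtain y where x: "x \<in> J" and y: "y \<in> ball J C (Suc t) {j}"
      and xy: "set (fst (C x)) \<inter> set (fst (C y)) \<noteq> {}"
      unfolding ball_Suc[of _ _ "Suc t"] grow_def verts_def by blast
    show "x \<in> ?B (Suc t)"
    proof (cases "x = j")
      case False
      have CJ: "C ` (J - {j}) \<subseteq> constrs U" using assms by auto
      show ?thesis
      proof (cases "y = j")
        case True
        have "x \<in> ball (J - {j}) C (Suc t) {x}"
          using subset_ball[OF CJ, of "{x}"] x False by blast
        then show ?thesis using x False True xy by blast
      next
        case yj: False
        with y Suc obtain l where l: "l \<in> J - {j}" "set (fst (C l)) \<inter> set (fst (C j)) \<noteq> {}"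
          "y \<in> ball (J - {j}) C t {l}" by blast
        then have "x \<in> ball (J - {j}) C (Suc t) {l}"
          using x False xy unfolding ball_Suc grow_def verts_def by blast
        then show ?thesis using l by blast
      qed
    qed simp
  qed
qed

section \<open>Invariance under renaming\<close>

definition rename :: "(nat \<Rightarrow> nat) \<Rightarrow> constr \<Rightarrow> constr" where
  "rename \<sigma> c = (map \<sigma> (fst c), snd c)"

lemma verts_rename: "verts S (rename \<sigma> \<circ> C) = \<sigma> ` verts S C"
  by (auto simp: verts_def rename_def)

lemma rename_touch:
  assumes "inj_on \<sigma> (verts J C)" "j \<in> J" "S \<subseteq> J"
  shows "set (fst ((rename \<sigma> \<circ> C) j)) \<inter> verts S (rename \<sigma> \<circ> C) = {} \<longleftrightarrow>
    set (fst (C j)) \<inter> verts S C = {}"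
proof -
  have "set (fst (C j)) \<subseteq> verts J C" using assms(2) by (auto simp: verts_def)
  moreover have "verts S C \<subseteq> verts J C" by (rule verts_mono[OF assms(3)])
  ultimately have "\<sigma> ` set (fst (C j)) \<inter> \<sigma> ` verts S C = \<sigma> ` (set (fst (C j)) \<inter> verts S C)"
    using inj_on_image_Int[OF assms(1)] by metis
  then show ?thesis unfolding verts_rename by (simp add: rename_def)
qed

lemma ball_rename:
  assumes "inj_on \<sigma> (verts J C)" "S \<subseteq> J"
  shows "ball J (rename \<sigma> \<circ> C) t S = ball J C t S"
proof (induction t)
  case (Suc t)
  show ?case unfolding ball_Suc Suc grow_def
    using rename_touch[OF assms(1) _ ball_subset[OF assms(2)]] by blast
qed simp

lemma slack_rename:
  assumes "c \<in> constrs U" shows "slack (rename \<sigma> c) x = slack c (x \<circ> \<sigma>)"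
  using assms by (simp add: slack_def rename_def constrs_def)

lemma pen_rename:
  assumes "c \<in> constrs U" shows "pen (rename \<sigma> c) x = pen c (x \<circ> \<sigma>)"
  using slack_rename[OF assms] by (simp add: pen_def)

lemma descent_rename:
  assumes "C ` J \<subseteq> constrs U" "inj_on \<sigma> (verts J C)" "i \<in> verts J C"
  shows "descent \<eta> J (rename \<sigma> \<circ> C) t (\<sigma> i) = descent \<eta> J C t i"
  using assms(3)
proof (induction t arbitrary: i)
  case (Suc t)
  have eq: "fst (rename \<sigma> (C j)) ! k = \<sigma> i \<longleftrightarrow> fst (C j) ! k = i" if "j \<in> J" "k < K" for j k
  proof -
    have C: "C j \<in> constrs U" using that assms(1) by blast
    have v: "fst (C j) ! k \<in> verts J C"
      using constrsD(4)[OF C that(2)] that(1) by (auto simp: verts_def)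
    have "fst (rename \<sigma> (C j)) ! k = \<sigma> (fst (C j) ! k)"
      using C that(2) by (simp add: rename_def constrs_def)
    then show ?thesis using inj_onD[OF assms(2) _ v Suc.prems] by auto
  qed
  have deg: "deg J (rename \<sigma> \<circ> C) (\<sigma> i) = deg J C i"
    unfolding deg_def comp_apply using eq by (intro sum.cong refl arg_cong[where f = of_bool]) auto
  have sl: "slack (rename \<sigma> (C j)) (descent \<eta> J (rename \<sigma> \<circ> C) t) = slack (C j) (descent \<eta> J C t)"
    if "j \<in> J" for j
  proof -
    have C: "C j \<in> constrs U" using that assms(1) by blast
    show ?thesis unfolding slack_rename[OF C]
    proof (rule slack_cong(1)[OF C])
      fix v assume "v \<in> set (fst (C j))"
      then have "v \<in> verts J C" using that by (auto simp: verts_def)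
      then show "(descent \<eta> J (rename \<sigma> \<circ> C) t \<circ> \<sigma>) v = descent \<eta> J C t v"
        using Suc.IH[of v] by (metis comp_apply)
    qed
  qed
  have coef: "(\<Sum>k<K. of_bool (fst (rename \<sigma> (C j)) ! k = \<sigma> i) * a (snd (rename \<sigma> (C j))) k)
       = (\<Sum>k<K. of_bool (fst (C j) ! k = i) * a (snd (C j)) k)" if "j \<in> J" for j
    using eq[OF that] by (intro sum.cong refl) (auto simp: rename_def)
  have "subgrad J (rename \<sigma> \<circ> C) (descent \<eta> J (rename \<sigma> \<circ> C) t) (\<sigma> i) = subgrad J C (descent \<eta> J C t) i"
    unfolding subgrad_def
  proof (intro sum.cong refl)
    fix j assume j: "j \<in> J"
    have D: "(rename \<sigma> \<circ> C) j = rename \<sigma> (C j)" by simp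
    show "of_bool (0 < slack ((rename \<sigma> \<circ> C) j) (descent \<eta> J (rename \<sigma> \<circ> C) t)) *
         (\<Sum>k<K. of_bool (fst ((rename \<sigma> \<circ> C) j) ! k = \<sigma> i) * a (snd ((rename \<sigma> \<circ> C) j)) k) =
         of_bool (0 < slack (C j) (descent \<eta> J C t)) *
         (\<Sum>k<K. of_bool (fst (C j) ! k = i) * a (snd (C j)) k)"
      by (simp only: D sl[OF j] coef[OF j])
  qed
  then show ?case unfolding descent.simps deg Suc.IH[OF Suc.prems] by (simp only:)
qed simp

lemma descent_reindex:
  assumes "bij_betw h I J"
  shows "descent \<eta> I (C \<circ> h) t = descent \<eta> J C t"
proof (induction t)
  case (Suc t)
  have deg: "deg I (C \<circ> h) i = deg J C i" for i
    unfolding deg_def comp_apply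
    by (rule sum.reindex_bij_betw[OF assms, of "\<lambda>j. \<Sum>k<K. of_bool (fst (C j) ! k = i)"])
  have sub: "subgrad I (C \<circ> h) x i = subgrad J C x i" for x i
    unfolding subgrad_def comp_apply
    by (rule sum.reindex_bij_betw[OF assms, of "\<lambda>j. of_bool (0 < slack (C j) x) *
         (\<Sum>k<K. of_bool (fst (C j) ! k = i) * a (snd (C j)) k)"])
  show ?case
  proof
    fix i show "descent \<eta> I (C \<circ> h) (Suc t) i = descent \<eta> J C (Suc t) i"
      unfolding descent.simps Suc deg sub ..
  qed
qed (simp add: fun_eq_iff)

lemma verts_reindex: "verts S (C \<circ> h) = verts (h ` S) C"
  by (auto simp: verts_def)

lemma ball_reindex:
  assumes "bij_betw h I J"
  shows "ball J C t (h ` S) = h ` ball I (C \<circ> h) t S"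
proof (induction t)
  case (Suc t)
  show ?case unfolding ball_Suc Suc grow_def verts_reindex
    using bij_betw_imp_surj_on[OF assms] by auto
qed simp

end

section \<open>Finite products of identical laws\<close>

abbreviation iid :: "nat set \<Rightarrow> 'a pmf \<Rightarrow> (nat \<Rightarrow> 'a) pmf" where
  "iid J p \<equiv> Pi_pmf J undefined (\<lambda>_. p)"

abbreviation expect :: "'a pmf \<Rightarrow> ('a \<Rightarrow> real) \<Rightarrow> real" where
  "expect p f \<equiv> measure_pmf.expectation p f"

definition depends_on :: "nat set \<Rightarrow> ((nat \<Rightarrow> 'a) \<Rightarrow> 'b) \<Rightarrow> bool" where
  "depends_on I f \<longleftrightarrow> (\<forall>C C'. (\<forall>j\<in>I. C j = C' j) \<longrightarrow> f C = f C')"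

lemma depends_onD: "depends_on I f \<Longrightarrow> (\<And>j. j \<in> I \<Longrightarrow> C j = C' j) \<Longrightarrow> f C = f C'"
  by (auto simp: depends_on_def)

lemma finite_set_iid: "finite J \<Longrightarrow> finite (set_pmf p) \<Longrightarrow> finite (set_pmf (iid J p))"
  by (simp add: set_Pi_pmf finite_PiE_dflt)

lemma set_iid_D: "finite J \<Longrightarrow> C \<in> set_pmf (iid J p) \<Longrightarrow> C ` J \<subseteq> set_pmf p"
  by (auto simp: set_Pi_pmf PiE_dflt_def)

lemma expect_cong:
  "(\<And>x. x \<in> set_pmf p \<Longrightarrow> f x = g x) \<Longrightarrow> expect p f = expect p g"
  by (intro integral_cong_AE) (auto simp: AE_measure_pmf_iff)

lemma expect_mono:
  assumes "finite (set_pmf p)" "\<And>x. x \<in> set_pmf p \<Longrightarrow> f x \<le> g x"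
  shows "expect p f \<le> expect p g"
  using assms by (intro integral_mono_AE integrable_measure_pmf_finite) (auto simp: AE_measure_pmf_iff)

lemma expect_le_const:
  assumes "finite (set_pmf p)" "\<And>x. x \<in> set_pmf p \<Longrightarrow> f x \<le> (L::real)"
  shows "expect p f \<le> L"
  using expect_mono[OF assms(1), of f "\<lambda>_. L"] assms(2) by simp

lemma const_le_expect:
  assumes "finite (set_pmf p)" "\<And>x. x \<in> set_pmf p \<Longrightarrow> (L::real) \<le> f x"
  shows "L \<le> expect p f"
  using expect_mono[OF assms(1), of "\<lambda>_. L" f] assms(2) by simp

lemma expect_add:
  "finite (set_pmf p) \<Longrightarrow> expect p (\<lambda>x. f x + g x) = expect p f + expect p g"
  by (intro Bochner_Integration.integral_add integrable_measure_pmf_finite)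

lemma expect_diff:
  "finite (set_pmf p) \<Longrightarrow> expect p (\<lambda>x. f x - g x) = expect p f - expect p g"
  by (intro Bochner_Integration.integral_diff integrable_measure_pmf_finite)

lemma expect_sum:
  "finite (set_pmf p) \<Longrightarrow> expect p (\<lambda>x. \<Sum>i\<in>I. f i x) = (\<Sum>i\<in>I. expect p (f i))"
  by (intro Bochner_Integration.integral_sum integrable_measure_pmf_finite)

lemma expect_pair:
  assumes "finite (set_pmf p)" "finite (set_pmf q)"
  shows "expect (pair_pmf p q) f = expect p (\<lambda>x. expect q (\<lambda>y. f (x, y)))"
proof -
  have "expect (pair_pmf p q) f = (\<Sum>x\<in>set_pmf p. pmf p x *\<^sub>R expect (bind_pmf q (\<lambda>y. return_pmf (x, y))) f)"
    unfolding pair_pmf_def using assms by (intro pmf_expectation_bind) auto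
  also have "\<dots> = (\<Sum>x\<in>set_pmf p. pmf p x *\<^sub>R expect q (\<lambda>y. f (x, y)))"
    by (simp flip: map_pmf_def)
  also have "\<dots> = expect p (\<lambda>x. expect q (\<lambda>y. f (x, y)))"
    using assms by (intro integral_measure_pmf[symmetric]) auto
  finally show ?thesis .
qed

lemma expect_swap:
  assumes "finite (set_pmf p)" "finite (set_pmf q)"
  shows "expect p (\<lambda>x. expect q (\<lambda>y. f x y)) = expect q (\<lambda>y. expect p (\<lambda>x. f x y))"
proof -
  have "expect p (\<lambda>x. expect q (\<lambda>y. f x y)) = expect (pair_pmf p q) (\<lambda>(x, y). f x y)"
    using expect_pair[OF assms, of "\<lambda>(x, y). f x y"] by simp
  also have "\<dots> = expect (pair_pmf q p) (\<lambda>(y, x). f x y)"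
    by (subst pair_commute_pmf) (simp add: case_prod_unfold)
  also have "\<dots> = expect q (\<lambda>y. expect p (\<lambda>x. f x y))"
    using expect_pair[OF assms(2,1), of "\<lambda>(y, x). f x y"] by simp
  finally show ?thesis .
qed

lemma expect_iid_insert:
  assumes "finite J" "x \<notin> J" "finite (set_pmf p)"
  shows "expect (iid (insert x J) p) f = expect (iid J p) (\<lambda>C. expect p (\<lambda>y. f (C(x := y))))"
proof -
  have "expect (iid (insert x J) p) f = expect (pair_pmf p (iid J p)) (\<lambda>(y, C). f (C(x := y)))"
    by (simp add: Pi_pmf_insert[OF assms(1,2)] case_prod_unfold)
  also have "\<dots> = expect p (\<lambda>y. expect (iid J p) (\<lambda>C. f (C(x := y))))"
    using expect_pair[OF assms(3) finite_set_iid[OF assms(1,3)], where f = "\<lambda>(y, C). f (C(x := y))"] by simp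
  also have "\<dots> = expect (iid J p) (\<lambda>C. expect p (\<lambda>y. f (C(x := y))))"
    by (rule expect_swap[OF assms(3) finite_set_iid[OF assms(1,3)]])
  finally show ?thesis .
qed

lemma expect_iid_subset:
  assumes "finite J" "I \<subseteq> J" "depends_on I f"
  shows "expect (iid J p) f = expect (iid I p) f"
proof -
  have "expect (iid I p) f = expect (iid J p) (\<lambda>C. f (\<lambda>j. if j \<in> I then C j else undefined))"
    by (subst Pi_pmf_subset[OF assms(1,2)]) simp
  also have "\<dots> = expect (iid J p) f"
  proof -
    have "f (\<lambda>j. if j \<in> I then C j else undefined) = f C" for C
      by (rule depends_onD[OF assms(3)]) simp
    then show ?thesis by simp
  qed
  finally show ?thesis by simp
qed

text \<open>
  Conditionally on the coordinates in \<open>I\<close>, the remaining coordinates are independent and each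
  contributes the same factor.
\<close>

lemma expect_iid_split:
  fixes g :: "(nat \<Rightarrow> 'a) \<Rightarrow> 'a \<Rightarrow> real"
  assumes "finite J" "I \<subseteq> J" "finite (set_pmf p)" "depends_on I F" "depends_on I g"
    and g: "\<And>C c. 0 \<le> g C c"
  shows "expect (iid J p) (\<lambda>C. F C * (\<Prod>j\<in>J - I. g C (C j))) =
    expect (iid I p) (\<lambda>C. F C * expect p (g C) ^ card (J - I))"
proof -
  let ?D = "J - I" and ?h = "\<lambda>C D x. if x \<in> I then C x else D x"
  have I: "finite I" "finite ?D" using assms finite_subset by auto
  have J: "J = I \<union> ?D" using assms(2) by blast
  have FC: "F (?h C D) = F C" and gC: "g (?h C D) = g C" for C D
    by (rule depends_onD[OF assms(4)], simp) (rule depends_onD[OF assms(5)], simp)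
  have "expect (iid J p) (\<lambda>C. F C * (\<Prod>j\<in>?D. g C (C j))) =
    expect (pair_pmf (iid I p) (iid ?D p)) (\<lambda>(C, D). F (?h C D) * (\<Prod>j\<in>?D. g (?h C D) (?h C D j)))"
  proof -
    have "iid J p = map_pmf (\<lambda>(C, D). ?h C D) (pair_pmf (iid I p) (iid ?D p))"
      using Pi_pmf_union[OF I, of undefined "\<lambda>_. p"] J by auto
    then show ?thesis by (simp add: case_prod_unfold)
  qed
  also have "\<dots> = expect (iid I p) (\<lambda>C. expect (iid ?D p) (\<lambda>D. F C * (\<Prod>j\<in>?D. g C (D j))))"
  proof -
    have "(\<Prod>j\<in>?D. g (?h C D) (?h C D j)) = (\<Prod>j\<in>?D. g C (D j))" for C D
      unfolding gC by (rule prod.cong) auto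
    then show ?thesis unfolding FC
      using expect_pair[OF finite_set_iid[OF I(1) assms(3)] finite_set_iid[OF I(2) assms(3)],
        of "\<lambda>(C, D). F C * (\<Prod>j\<in>?D. g C (D j))"] by simp
  qed
  also have "\<dots> = expect (iid I p) (\<lambda>C. F C * expect p (g C) ^ card ?D)"
  proof -
    have "expect (iid ?D p) (\<lambda>D. F C * (\<Prod>j\<in>?D. g C (D j))) = F C * expect p (g C) ^ card ?D" for C
      using expectation_prod_Pi_pmf[OF I(2), of "\<lambda>_. p" "\<lambda>_. g C" undefined] assms(3) g
      by (simp add: integrable_measure_pmf_finite)
    then show ?thesis by (simp only:)
  qed
  finally show ?thesis .
qed

lemma expect_iid_bij:
  assumes "finite I" "finite J" "bij_betw h I J" "depends_on I f"
  shows "expect (iid I p) f = expect (iid J p) (\<lambda>C. f (C \<circ> h))"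
proof -
  \<comment> \<open>Outside \<open>I\<close> the bijection is redirected to an index outside \<open>J\<close>, so that defaults match.\<close>
  obtain z where z: "z \<notin> J" using assms(2) ex_new_if_finite infinite_UNIV_nat by blast
  define h' where "h' x = (if x \<in> I then h x else z)" for x
  have bij: "bij_betw h' I J" using assms(3) bij_betw_cong[of I h h' J] by (simp add: h'_def)
  have "expect (iid I p) f = expect (iid J p) (\<lambda>C. f (C \<circ> h'))"
    by (subst Pi_pmf_bij_betw[OF assms(1) bij]) (auto simp: h'_def z)
  moreover have "f (C \<circ> h') = f (C \<circ> h)" for C
    by (rule depends_onD[OF assms(4)]) (simp add: h'_def)
  ultimately show ?thesis by simp
qed

text \<open>
  The bounded-difference form of the Efron--Stein inequality.  Integrating out one coordinate
  contributes at most \<open>H\<^sup>2\<close>, and the averaged function inherits the bound \<open>H\<close> on its differences.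
\<close>

lemma variance_iid_le:
  assumes "finite J" "finite (set_pmf p)" "0 \<le> H"
    and "\<And>C j y. C ` J \<subseteq> set_pmf p \<Longrightarrow> j \<in> J \<Longrightarrow> y \<in> set_pmf p \<Longrightarrow> \<bar>f (C(j := y)) - f C\<bar> \<le> H"
  shows "expect (iid J p) (\<lambda>C. (f C - expect (iid J p) f)\<^sup>2) \<le> real (card J) * H\<^sup>2"
  using assms(1,4)
proof (induction J arbitrary: f rule: finite_induct)
  case empty
  then show ?case by simp
next
  case (insert x J)
  define g where "g C = expect p (\<lambda>y. f (C(x := y)))" for C
  let ?E = "expect (iid J p)"
  define \<mu> where "\<mu> = ?E g"
  note fin = finite_set_iid[OF insert.hyps(1) assms(2)]
  have \<mu>: "expect (iid (insert x J) p) f = \<mu>"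
    unfolding \<mu>_def g_def by (rule expect_iid_insert[OF insert.hyps assms(2)])
  have inner: "expect p (\<lambda>y. (f (C(x := y)) - \<mu>)\<^sup>2) \<le> H\<^sup>2 + (g C - \<mu>)\<^sup>2" if C: "C ` J \<subseteq> set_pmf p" for C
  proof -
    have close: "(f (C(x := y)) - g C)\<^sup>2 \<le> H\<^sup>2" if y: "y \<in> set_pmf p" for y
    proof -
      have "\<bar>f (C(x := y)) - f (C(x := y'))\<bar> \<le> H" if "y' \<in> set_pmf p" for y'
      proof -
        have "(C(x := y')) ` insert x J \<subseteq> set_pmf p" using C that by auto
        then have "\<bar>f (C(x := y', x := y)) - f (C(x := y'))\<bar> \<le> H"
          by (rule insert.prems) (use y in auto)
        then show ?thesis by (simp only: fun_upd_upd)
      qed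
      then have *: "f (C(x := y)) - H \<le> f (C(x := y'))" "f (C(x := y')) \<le> f (C(x := y)) + H"
        if "y' \<in> set_pmf p" for y' using that by (force simp: abs_le_iff)+
      have "f (C(x := y)) - H \<le> g C" "g C \<le> f (C(x := y)) + H"
        unfolding g_def using * by (auto intro!: const_le_expect expect_le_const assms(2))
      then have "\<bar>f (C(x := y)) - g C\<bar> \<le> \<bar>H\<bar>" by linarith
      then show ?thesis by (simp add: abs_le_square_iff)
    qed
    have "expect p (\<lambda>y. (f (C(x := y)) - \<mu>)\<^sup>2) = expect p (\<lambda>y. (f (C(x := y)) - g C)\<^sup>2
        + (2 * (g C - \<mu>) * (f (C(x := y)) - g C) + (g C - \<mu>)\<^sup>2))"
      by (intro expect_cong) (simp add: power2_eq_square algebra_simps)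
    also have "\<dots> = expect p (\<lambda>y. (f (C(x := y)) - g C)\<^sup>2)
        + (2 * (g C - \<mu>) * (expect p (\<lambda>y. f (C(x := y))) - g C) + (g C - \<mu>)\<^sup>2)"
      by (simp add: expect_add expect_diff assms(2))
    also have "\<dots> \<le> H\<^sup>2 + (g C - \<mu>)\<^sup>2"
      using expect_le_const[OF assms(2) close] by (simp add: g_def)
    finally show ?thesis .
  qed
  have "?E (\<lambda>C. (g C - ?E g)\<^sup>2) \<le> real (card J) * H\<^sup>2"
  proof (rule insert.IH)
    fix C j z assume C: "C ` J \<subseteq> set_pmf p" and j: "j \<in> J" and z: "z \<in> set_pmf p"
    have "j \<noteq> x" using j insert.hyps by auto
    then have tw: "C(j := z, x := y) = C(x := y, j := z)" for y by (rule fun_upd_twist)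
    have "\<bar>f (C(j := z, x := y)) - f (C(x := y))\<bar> \<le> H" if "y \<in> set_pmf p" for y
    proof -
      have "(C(x := y)) ` insert x J \<subseteq> set_pmf p" using C that by auto
      then have "\<bar>f (C(x := y, j := z)) - f (C(x := y))\<bar> \<le> H"
        by (rule insert.prems) (use j z in auto)
      then show ?thesis by (simp only: tw)
    qed
    then have *: "f (C(x := y)) - H \<le> f (C(j := z, x := y))" "f (C(j := z, x := y)) \<le> f (C(x := y)) + H"
      if "y \<in> set_pmf p" for y using that by (force simp: abs_le_iff)+
    have "expect p (\<lambda>y. f (C(x := y)) - H) \<le> g (C(j := z))" "g (C(j := z)) \<le> expect p (\<lambda>y. f (C(x := y)) + H)"
      unfolding g_def using * by (auto intro!: expect_mono assms(2))
    then have "g C - H \<le> g (C(j := z))" "g (C(j := z)) \<le> g C + H"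
      by (simp_all add: expect_add expect_diff assms(2) g_def)
    then show "\<bar>g (C(j := z)) - g C\<bar> \<le> H" by linarith
  qed
  moreover have "expect (iid (insert x J) p) (\<lambda>C. (f C - \<mu>)\<^sup>2)
      = ?E (\<lambda>C. expect p (\<lambda>y. (f (C(x := y)) - \<mu>)\<^sup>2))"
    by (rule expect_iid_insert[OF insert.hyps assms(2)])
  moreover have "\<dots> \<le> ?E (\<lambda>C. H\<^sup>2 + (g C - \<mu>)\<^sup>2)"
    by (intro expect_mono fin inner set_iid_D[OF insert.hyps(1)])
  moreover have "\<dots> = H\<^sup>2 + ?E (\<lambda>C. (g C - \<mu>)\<^sup>2)"
    by (simp add: expect_add fin)
  ultimately show ?case
    using insert.hyps unfolding \<mu> \<mu>_def by (simp add: distrib_right)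
qed

context lsat
begin

section \<open>A single random constraint\<close>

text \<open>
  The number of index tuples over \<open>u\<close> variables: a power of \<open>u\<close> with replacement and a falling
  factorial without.  Writing both as one product lets all later estimates treat the two
  sampling modes together.
\<close>

definition ntuples :: "nat \<Rightarrow> nat" where
  "ntuples u = (\<Prod>i<K. u - (if repl then 0 else i))"

definition law :: "nat \<Rightarrow> constr pmf" where
  "law n = pmf_of_set (constrs {..<n})"

lemma card_lists_eq_ntuples:
  assumes "finite U"
  shows "card {xs. length xs = K \<and> set xs \<subseteq> U \<and> (\<not> repl \<longrightarrow> distinct xs)} = ntuples (card U)"
    and "finite {xs. length xs = K \<and> set xs \<subseteq> U \<and> (\<not> repl \<longrightarrow> distinct xs)}"
proof -
  let ?L = "{xs. length xs = K \<and> set xs \<subseteq> U \<and> (\<not> repl \<longrightarrow> distinct xs)}"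
  show "finite ?L"
    by (rule finite_subset[OF _ finite_lists_length_eq[OF assms, of K]]) auto
  show "card ?L = ntuples (card U)"
  proof (cases repl)
    case True
    then have "?L = {xs. set xs \<subseteq> U \<and> length xs = K}"
      by auto
    then show ?thesis unfolding ntuples_def using True card_lists_length_eq[OF assms, of K] by simp
  next
    case False
    then have eq: "?L
        = {xs. length xs = K \<and> distinct xs \<and> set xs \<subseteq> U}" by auto
    show ?thesis
    proof (cases "K \<le> card U")
      case True
      have "\<Prod>{card U - K + 1..card U} = (\<Prod>i<K. card U - i)"
      proof (rule prod.reindex_bij_witness[of _ "\<lambda>i. card U - i" "\<lambda>i. card U - i"])
      qed (use True in auto)
      then show ?thesis unfolding eq card_lists_distinct_length_eq[OF assms True]
        unfolding ntuples_def using False by simp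
    next
      case big: False
      have empty: "{xs. length xs = K \<and> distinct xs \<and> set xs \<subseteq> U} = {}"
      proof (rule equals0I)
        fix xs assume "xs \<in> {xs. length xs = K \<and> distinct xs \<and> set xs \<subseteq> U}"
        then have "card (set xs) = K" "card (set xs) \<le> card U"
          using card_mono[OF assms, of "set xs"] by (auto simp: distinct_card)
        then show False using big by simp
      qed
      have zero: "(\<Prod>i<K. card U - i) = 0"
        using big by (intro prod_zero) auto
      show ?thesis unfolding eq empty ntuples_def using False by (simp only: card.empty if_False zero)
    qed
  qed
qed

lemma constrs_eq: "constrs U = {xs. length xs = K \<and> set xs \<subseteq> U \<and> (\<not> repl \<longrightarrow> distinct xs)} \<times> {..<R}"
  by (auto simp: constrs_def)

lemma card_constrs: "finite U \<Longrightarrow> card (constrs U) = ntuples (card U) * R"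
  by (simp add: constrs_eq card_cartesian_product card_lists_eq_ntuples)

lemma finite_constrs: "finite U \<Longrightarrow> finite (constrs U)"
  by (simp add: constrs_eq card_lists_eq_ntuples)

lemma ntuples_pos: "K \<le> n \<Longrightarrow> 0 < ntuples n"
  by (auto simp: ntuples_def)

lemma constrs_lessThan_nonempty: "K \<le> n \<Longrightarrow> constrs {..<n} \<noteq> {}"
  using card_constrs[of "{..<n}"] ntuples_pos[of n] R_pos by force

lemma set_law: "K \<le> n \<Longrightarrow> set_pmf (law n) = constrs {..<n}"
  unfolding law_def by (intro set_pmf_of_set constrs_lessThan_nonempty finite_constrs) auto

lemma finite_set_law: "K \<le> n \<Longrightarrow> finite (set_pmf (law n))"
  by (simp add: set_law finite_constrs)

lemma random_klsat_eq_iid: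
  assumes "K \<le> n"
  shows "random_klsat repl K R n c = iid {..<num_constraints c n} (law n)"
proof -
  let ?A = "index_tuples repl K n"
  have ne: "?A \<times> {..<R} \<noteq> {}" "finite (?A \<times> {..<R})"
    using constrs_lessThan_nonempty[OF assms] finite_constrs[of "{..<n}"] by (auto simp: constrs_eq_Times)
  then have A: "?A \<noteq> {}" "finite ?A" "{..<R} \<noteq> {}"
    using finite_cartesian_productD1 by (auto simp: lessThan_empty_iff)
  have "pair_pmf (pmf_of_set ?A) (pmf_of_set {..<R}) = law n"
  proof (rule pmf_eqI)
    fix x
    show "pmf (pair_pmf (pmf_of_set ?A) (pmf_of_set {..<R})) x = pmf (law n) x"
      unfolding law_def constrs_eq_Times using A ne
      by (cases x) (simp add: pmf_pair pmf_of_set card_cartesian_product indicator_def)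
  qed
  then show ?thesis unfolding random_klsat_def by simp
qed

lemma expect_law_inside:
  assumes "K \<le> n" "U \<subseteq> {..<n}"
  shows "expect (law n) (\<lambda>c. of_bool (set (fst c) \<subseteq> U)) = real (ntuples (card U)) / real (ntuples n)"
proof -
  have U: "finite U" using assms finite_subset by blast
  have "expect (law n) (\<lambda>c. of_bool (set (fst c) \<subseteq> U))
      = (\<Sum>c\<in>constrs {..<n}. of_bool (set (fst c) \<subseteq> U)) / real (card (constrs {..<n}))"
    unfolding law_def by (intro integral_pmf_of_set constrs_lessThan_nonempty finite_constrs assms) auto
  also have "(\<Sum>c\<in>constrs {..<n}. of_bool (set (fst c) \<subseteq> U)) = (\<Sum>c\<in>constrs U. 1::real)"
    using constrs_mono[OF assms(2)] finite_constrs[of "{..<n}"]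
    by (intro sum.mono_neutral_cong_right) (auto simp: constrs_def)
  finally show ?thesis using R_pos U by (simp add: card_constrs)
qed

lemma expect_law_avoid:
  assumes "K \<le> n" "U \<subseteq> {..<n}"
  shows "expect (law n) (\<lambda>c. of_bool (set (fst c) \<inter> U = {}))
    = real (ntuples (n - card U)) / real (ntuples n)"
proof -
  have "expect (law n) (\<lambda>c. of_bool (set (fst c) \<inter> U = {})) =
      expect (law n) (\<lambda>c. of_bool (set (fst c) \<subseteq> {..<n} - U))"
    by (rule expect_cong) (auto simp: set_law[OF assms(1)] constrs_def)
  also have "\<dots> = real (ntuples (card ({..<n} - U))) / real (ntuples n)"
    by (rule expect_law_inside) (use assms in auto)
  finally show ?thesis using assms(2) finite_subset[OF assms(2)] by (simp add: card_Diff_subset)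
qed

lemma ntuples_ratio:
  assumes "K \<le> n"
  shows "real (ntuples u) / real (ntuples n)
    = (\<Prod>i<K. real (u - (if repl then 0 else i)) / real (n - (if repl then 0 else i)))"
  by (simp add: ntuples_def prod_dividef)

lemma ntuples_ratio_le:
  assumes "K \<le> n" "u \<le> n"
  shows "real (ntuples u) / real (ntuples n) \<le> (real u / real n) ^ K"
proof -
  have "(\<Prod>i<K. real (u - (if repl then 0 else i)) / real (n - (if repl then 0 else i)))
     \<le> (\<Prod>i<K. real u / real n)"
  proof (rule prod_mono, rule conjI)
    fix i assume i: "i \<in> {..<K}"
    let ?d = "if repl then 0 else i"
    have d: "?d < n" using i assms by auto
    show "real (u - ?d) / real (n - ?d) \<le> real u / real n"
    proof (cases "?d \<le> u")
      case True
      have "real ?d * real u \<le> real ?d * real n" using assms by (intro mult_left_mono) auto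
      then have "(real u - real ?d) * real n \<le> real u * (real n - real ?d)"
        by (simp add: algebra_simps)
      then show ?thesis using True d by (simp add: divide_simps of_nat_diff)
    qed auto
  qed auto
  then show ?thesis unfolding ntuples_ratio[OF assms(1)] by simp
qed

text \<open>
  A random tuple meets a given set of \<open>q\<close> variables with probability \<open>O(q/n)\<close>.  For \<open>2 q \<le> n\<close>
  this is Bernoulli's inequality, and otherwise the left-hand side is not positive.
\<close>

lemma ntuples_ratio_ge:
  assumes "2 * K \<le> n"
  shows "1 - 2 * real K * real q / real n \<le> real (ntuples (n - q)) / real (ntuples n)"
proof (cases "2 * q \<le> n")
  case True
  have n: "n > 0" using assms K_pos by linarith
  have "1 + real K * (- (2 * real q / real n)) \<le> (1 + - (2 * real q / real n)) ^ K"
  proof (rule Bernoulli_inequality)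
    have "2 * real q \<le> real n" using True by linarith
    then show "- 1 \<le> - (2 * real q / real n)" using n by simp
  qed
  also have "\<dots> = (\<Prod>i<K. 1 + - (2 * real q / real n))" by simp
  also have "\<dots> \<le> (\<Prod>i<K. real (n - q - (if repl then 0 else i)) / real (n - (if repl then 0 else i)))"
  proof (rule prod_mono, rule conjI)
    fix i assume "i \<in> {..<K}"
    then have i: "i < K" by simp
    let ?d = "if repl then 0 else i"
    have d: "2 * ?d \<le> n" "?d < n" using i assms by auto
    have "1 - 2 * real q / real n \<le> 1 - real q / (real n - real ?d)"
    proof -
      have "real n / 2 \<le> real n - real ?d" using d by linarith
      then have "real q / (real n - real ?d) \<le> real q / (real n / 2)"
        using n by (intro divide_left_mono) auto
      then show ?thesis by (simp add: mult.commute)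
    qed
    also have "\<dots> = (real n - real q - real ?d) / (real n - real ?d)"
      using d by (simp add: field_simps)
    also have "\<dots> \<le> real (n - q - ?d) / real (n - ?d)"
      using d by (intro frac_le) auto
    finally show "1 + - (2 * real q / real n) \<le> real (n - q - ?d) / real (n - ?d)" by simp
    show "0 \<le> 1 + - (2 * real q / real n)" using True n by (simp add: field_simps)
  qed
  finally have "1 - 2 * real K * real q / real n
      \<le> (\<Prod>i<K. real (n - q - (if repl then 0 else i)) / real (n - (if repl then 0 else i)))"
    by (simp add: mult_ac)
  then show ?thesis using assms by (subst ntuples_ratio) auto
next
  case False
  have n: "n > 0" using assms K_pos by linarith
  have "real n \<le> real K * (2 * real q)"
    using False K_pos mult_mono[of 1 "real K" "real n" "2 * real q"] by simp
  then have "1 - 2 * real K * real q / real n \<le> 0" using n by (simp add: field_simps)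
  then show ?thesis by (meson divide_nonneg_nonneg of_nat_0_le_iff order_trans)
qed

lemma expect_law_touch:
  assumes "2 * K \<le> n" "U \<subseteq> {..<n}" "card U \<le> K"
  shows "expect (law n) (\<lambda>c. of_bool (set (fst c) \<inter> U \<noteq> {})) \<le> 2 * (real K)\<^sup>2 / real n"
proof -
  have Kn: "K \<le> n" using assms by simp
  have "expect (law n) (\<lambda>c. of_bool (set (fst c) \<inter> U \<noteq> {}))
     = expect (law n) (\<lambda>c. 1 - of_bool (set (fst c) \<inter> U = {}))"
    by (rule expect_cong) auto
  also have "\<dots> = 1 - real (ntuples (n - card U)) / real (ntuples n)"
    by (simp add: expect_diff finite_set_law[OF Kn] expect_law_avoid[OF Kn assms(2)])
  also have "\<dots> \<le> 2 * real K * real (card U) / real n"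
    using ntuples_ratio_ge[OF assms(1), of "card U"] by simp
  also have "\<dots> \<le> 2 * real K * real K / real n"
    using assms(3) by (intro divide_right_mono mult_left_mono) auto
  finally show ?thesis by (simp add: power2_eq_square mult.assoc)
qed

lemma iid_law_D:
  assumes "K \<le> n" "finite J" "C \<in> set_pmf (iid J (law n))" shows "C ` J \<subseteq> constrs {..<n}"
  using set_iid_D[OF assms(2,3)] by (simp add: set_law[OF assms(1)])

lemma finite_set_iid_law: "K \<le> n \<Longrightarrow> finite J \<Longrightarrow> finite (set_pmf (iid J (law n)))"
  by (intro finite_set_iid finite_set_law)

section \<open>The expected size of a ball\<close>

text \<open>
  A bound, uniform in \<open>n\<close>, for the expected size of a ball of radius \<open>t\<close> at density \<open>c\<close>, obtained
  as the mean total progeny up to generation \<open>t\<close> of a branching process with mean offspring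
  \<open>2 K\<^sup>2 c\<close>.
\<close>

fun ball_size :: "real \<Rightarrow> nat \<Rightarrow> real" where
  "ball_size c 0 = 1"
| "ball_size c (Suc t) = 1 + 2 * (real K)\<^sup>2 * c * ball_size c t"

lemma ball_size_nonneg: "0 \<le> c \<Longrightarrow> 0 \<le> ball_size c t"
  by (induction t) auto

lemma verts_cong: "(\<And>j. j \<in> S \<Longrightarrow> C j = C' j) \<Longrightarrow> verts S C = verts S C'"
  by (auto simp: verts_def)

lemma ball_cong:
  assumes "\<And>j. j \<in> J \<Longrightarrow> C j = C' j" "S \<subseteq> J"
  shows "ball J C t S = ball J C' t S"
proof (induction t)
  case (Suc t)
  have "verts (ball J C' t S) C = verts (ball J C' t S) C'"
    using assms(1) ball_subset[OF assms(2), of C' t] by (intro verts_cong) blast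
  then show ?case unfolding ball_Suc Suc grow_def using assms(1) by auto
qed simp

text \<open>
  By \<open>ball_remove_root\<close> the ball is covered by the root and the balls around its neighbours in the
  instance without the root.  The latter are independent of the root, which touches a given constraint
  with probability at most \<open>2 K\<^sup>2 / n\<close>.
\<close>

lemma expect_card_ball:
  assumes n: "2 * K \<le> n" and c: "0 \<le> c" and J: "finite J" "j \<in> J" "real (card J) \<le> c * real n"
  shows "expect (iid J (law n)) (\<lambda>C. real (card (ball J C t {j}))) \<le> ball_size c t"
  using J
proof (induction t arbitrary: J j)
  case 0
  then show ?case by simp
next
  case (Suc t)
  have Kn: "K \<le> n" and n0: "n > 0" using n K_pos by auto
  let ?J = "J - {j}"
  let ?touch = "\<lambda>C l. of_bool (set (fst (C l)) \<inter> set (fst (C j)) \<noteq> {}) :: real"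
  let ?size = "\<lambda>C l. real (card (ball ?J C t {l}))"
  have fin: "finite (set_pmf (iid J (law n)))" "finite (set_pmf (iid ?J (law n)))"
    using Suc.prems by (auto intro!: finite_set_iid_law[OF Kn])
  have pointwise: "real (card (ball J C (Suc t) {j})) \<le> 1 + (\<Sum>l\<in>?J. ?touch C l * ?size C l)"
    if "C \<in> set_pmf (iid J (law n))" for C
  proof -
    let ?T = "{l\<in>?J. set (fst (C l)) \<inter> set (fst (C j)) \<noteq> {}}"
    have C: "C ` J \<subseteq> constrs {..<n}" using iid_law_D[OF Kn Suc.prems(1) that] .
    have finb: "finite (ball ?J C t {l})" if "l \<in> ?J" for l
      using ball_subset[of "{l}" ?J C t] that Suc.prems(1) finite_subset by fastforce
    have "card (ball J C (Suc t) {j}) \<le> card (insert j (\<Union>l\<in>?T. ball ?J C t {l}))"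
      using Suc.prems finb by (intro card_mono ball_remove_root[OF C]) auto
    also have "\<dots> \<le> 1 + card (\<Union>l\<in>?T. ball ?J C t {l})"
      by (rule order_trans[OF card_insert_le_m1]) auto
    also have "\<dots> \<le> 1 + (\<Sum>l\<in>?T. card (ball ?J C t {l}))"
      using Suc.prems(1) by (intro add_mono card_UN_le) auto
    finally have "real (card (ball J C (Suc t) {j})) \<le> 1 + (\<Sum>l\<in>?T. ?size C l)"
      by (simp flip: of_nat_sum)
    also have "(\<Sum>l\<in>?T. ?size C l) = (\<Sum>l\<in>?J. ?touch C l * ?size C l)"
      using Suc.prems(1) by (intro sum.mono_neutral_cong_left) auto
    finally show ?thesis .
  qed
  have touch_le: "expect (iid J (law n)) (\<lambda>C. ?touch C l * ?size C l) \<le> 2 * (real K)\<^sup>2 / real n * ball_size c t"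
    if l: "l \<in> ?J" for l
  proof -
    have J_eq: "J = insert j ?J" using Suc.prems by auto
    have lj: "l \<noteq> j" using l by auto
    have "expect (iid J (law n)) (\<lambda>C. ?touch C l * ?size C l) =
        expect (iid (insert j ?J) (law n)) (\<lambda>C. ?touch C l * ?size C l)"
      using J_eq by simp
    also have "\<dots> = expect (iid ?J (law n)) (\<lambda>C. expect (law n) (\<lambda>y. ?touch (C(j := y)) l * ?size (C(j := y)) l))"
      by (rule expect_iid_insert) (use Suc.prems finite_set_law[OF Kn] in auto)
    also have "\<dots> \<le> expect (iid ?J (law n)) (\<lambda>C. 2 * (real K)\<^sup>2 / real n * ?size C l)"
    proof (rule expect_mono[OF fin(2)])
      fix C assume C: "C \<in> set_pmf (iid ?J (law n))"
      have Cl: "C l \<in> constrs {..<n}" using iid_law_D[OF Kn _ C] l Suc.prems by auto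
      have same: "ball ?J (C(j := y)) t {l} = ball ?J C t {l}" for y
        by (rule ball_cong) (use l in auto)
      have "expect (law n) (\<lambda>y. ?touch (C(j := y)) l * ?size (C(j := y)) l)
          = expect (law n) (\<lambda>y. of_bool (set (fst y) \<inter> set (fst (C l)) \<noteq> {})) * ?size C l"
        unfolding same using lj by (simp add: Int_commute)
      also have "\<dots> \<le> 2 * (real K)\<^sup>2 / real n * ?size C l"
        using constrsD(1,2)[OF Cl] card_length[of "fst (C l)"]
        by (intro mult_right_mono expect_law_touch[OF n]) auto
      finally show "expect (law n) (\<lambda>y. ?touch (C(j := y)) l * ?size (C(j := y)) l)
        \<le> 2 * (real K)\<^sup>2 / real n * ?size C l" .
    qed
    also have "\<dots> = 2 * (real K)\<^sup>2 / real n * expect (iid ?J (law n)) (\<lambda>C. ?size C l)"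
      by simp
    also have "\<dots> \<le> 2 * (real K)\<^sup>2 / real n * ball_size c t"
    proof (intro mult_left_mono Suc.IH)
      have "real (card ?J) \<le> real (card J)" using Suc.prems(1) by (simp add: card_mono)
      then show "real (card ?J) \<le> c * real n" using Suc.prems(3) by linarith
    qed (use l Suc.prems(1) in auto)
    finally show ?thesis .
  qed
  have "expect (iid J (law n)) (\<lambda>C. real (card (ball J C (Suc t) {j})))
      \<le> expect (iid J (law n)) (\<lambda>C. 1 + (\<Sum>l\<in>?J. ?touch C l * ?size C l))"
    by (rule expect_mono[OF fin(1) pointwise])
  also have "\<dots> = 1 + (\<Sum>l\<in>?J. expect (iid J (law n)) (\<lambda>C. ?touch C l * ?size C l))"
    by (simp only: expect_add[OF fin(1)] expect_sum[OF fin(1)]) simp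
  also have "\<dots> \<le> 1 + (\<Sum>l\<in>?J. 2 * (real K)\<^sup>2 / real n * ball_size c t)"
    by (intro add_mono sum_mono touch_le) auto
  also have "\<dots> = 1 + real (card ?J) * (2 * (real K)\<^sup>2 / real n * ball_size c t)" by simp
  also have "\<dots> \<le> 1 + (c * real n) * (2 * (real K)\<^sup>2 / real n * ball_size c t)"
  proof -
    have "real (card ?J) \<le> real (card J)" using Suc.prems(1) by (simp add: card_mono)
    then show ?thesis
      using Suc.prems(3) ball_size_nonneg[OF c, of t] by (intro add_mono mult_right_mono) auto
  qed
  also have "\<dots> = ball_size c (Suc t)" using n0 by (simp add: field_simps)
  finally show ?case .
qed

end

section \<open>Asymptotics of the counting factors\<close>

lemma num_constraints_le: "0 \<le> c \<Longrightarrow> real (num_constraints c n) \<le> c * real n"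
  unfolding num_constraints_def by simp

lemma num_constraints_ge: "c * real n - 1 \<le> real (num_constraints c n)"
  unfolding num_constraints_def by linarith

lemma num_constraints_ratio:
  assumes "0 \<le> c" shows "(\<lambda>n. real (num_constraints c n) / real n) \<longlonglongrightarrow> c"
proof (rule tendsto_sandwich)
  show "(\<lambda>n. (c * real n - 1) / real n) \<longlonglongrightarrow> c" by real_asymp
  show "(\<lambda>_. c) \<longlonglongrightarrow> c" by simp
  show "\<forall>\<^sub>F n in sequentially. (c * real n - 1) / real n \<le> real (num_constraints c n) / real n"
    using num_constraints_ge by (intro always_eventually allI divide_right_mono) auto
  show "\<forall>\<^sub>F n in sequentially. real (num_constraints c n) / real n \<le> c"
    using eventually_gt_at_top[of 0]
    by eventually_elim (use num_constraints_le[OF assms] in \<open>simp add: divide_le_eq\<close>)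
qed

lemma ratio_diff_nat:
  assumes "(\<lambda>n. real (x n) / real n) \<longlonglongrightarrow> c"
  shows "(\<lambda>n. real (x n - k) / real n) \<longlonglongrightarrow> c"
proof (rule tendsto_sandwich)
  have "(\<lambda>n. real (x n) / real n - real k / real n) \<longlonglongrightarrow> c - 0"
    by (intro tendsto_diff assms) real_asymp
  then show "(\<lambda>n. real (x n) / real n - real k / real n) \<longlonglongrightarrow> c" by simp
  show "(\<lambda>n. real (x n) / real n) \<longlonglongrightarrow> c" by fact
  show "\<forall>\<^sub>F n in sequentially. real (x n) / real n - real k / real n \<le> real (x n - k) / real n"
    by (intro always_eventually allI) (simp add: diff_divide_distrib[symmetric] divide_right_mono)
  show "\<forall>\<^sub>F n in sequentially. real (x n - k) / real n \<le> real (x n) / real n"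
    by (intro always_eventually allI divide_right_mono) auto
qed

lemma binomial_ratio:
  assumes "(\<lambda>n. real (x n) / real n) \<longlonglongrightarrow> c"
  shows "(\<lambda>n. real (x n choose k) / real n ^ k) \<longlonglongrightarrow> c ^ k / fact k"
proof -
  have "real (x n choose k) / real n ^ k = (\<Prod>i<k. real (x n) / real n - real i / real n) / fact k" for n
  proof -
    have "real (x n choose k) / real n ^ k = (\<Prod>i<k. real (x n) - real i) / real n ^ k / fact k"
      by (simp add: binomial_gbinomial gbinomial_prod_rev atLeast0LessThan)
    also have "(\<Prod>i<k. real (x n) - real i) / real n ^ k = (\<Prod>i<k. (real (x n) - real i) / real n)"
      by (simp add: prod_dividef)
    finally show ?thesis by (simp only: diff_divide_distrib)
  qed
  moreover have "(\<lambda>n. (\<Prod>i<k. real (x n) / real n - real i / real n) / fact k) \<longlonglongrightarrow> (\<Prod>i<k. c - 0) / fact k"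
  proof -
    have "(\<lambda>n. real i / real n) \<longlonglongrightarrow> 0" for i by real_asymp
    then have "(\<lambda>n. \<Prod>i<k. real (x n) / real n - real i / real n) \<longlonglongrightarrow> (\<Prod>i<k. c - 0)"
      by (intro tendsto_prod tendsto_diff assms)
    then show ?thesis by (rule tendsto_divide) auto
  qed
  ultimately show ?thesis by simp
qed

text \<open>
  The limit of \<open>(1 - q/n)\<^sup>m\<close> for \<open>m\<close> of order \<open>c n\<close>, with a bounded shift of \<open>n\<close>.
\<close>

lemma power_ratio:
  assumes "(\<lambda>n. real (x n) / real n) \<longlonglongrightarrow> c"
  shows "(\<lambda>n. (real (n - q - d) / real (n - d)) ^ x n) \<longlonglongrightarrow> exp (- c * real q)"
proof -
  have "(\<lambda>n. real n * ln ((real n - real q - real d) / (real n - real d))) \<longlonglongrightarrow> - real q"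
    by real_asymp
  then have "(\<lambda>n. exp (real (x n) / real n * (real n * ln ((real n - real q - real d) / (real n - real d)))))
      \<longlonglongrightarrow> exp (c * - real q)"
    by (intro tendsto_exp tendsto_mult assms)
  moreover have "\<forall>\<^sub>F n in sequentially.
      exp (real (x n) / real n * (real n * ln ((real n - real q - real d) / (real n - real d))))
      = (real (n - q - d) / real (n - d)) ^ x n"
    using eventually_gt_at_top[of "q + d"]
  proof eventually_elim
    case (elim n)
    have eq: "(real n - real q - real d) / (real n - real d) = real (n - q - d) / real (n - d)"
      using elim by (simp add: of_nat_diff)
    have pos: "real (n - q - d) / real (n - d) > 0" using elim by simp
    have "exp (real (x n) * ln (real (n - q - d) / real (n - d))) = (real (n - q - d) / real (n - d)) ^ x n"
      using pos by (simp only: exp_of_nat_mult exp_ln)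
    then show ?case unfolding eq using elim by simp
  qed
  ultimately have "(\<lambda>n. (real (n - q - d) / real (n - d)) ^ x n) \<longlonglongrightarrow> exp (c * - real q)"
    by (rule Lim_transform_eventually)
  then show ?thesis by simp
qed

context lsat
begin

lemma ntuples_asymp: "(\<lambda>n. real (ntuples n) / real n ^ K) \<longlonglongrightarrow> 1"
proof -
  have "(\<lambda>n. \<Prod>i<K. real (n - (if repl then 0 else i)) / real n) \<longlonglongrightarrow> (\<Prod>i<K. 1)"
  proof (intro tendsto_prod ratio_diff_nat)
    show "(\<lambda>n. real n / real n) \<longlonglongrightarrow> 1" by real_asymp
  qed
  moreover have "(\<Prod>i<K. real (n - (if repl then 0 else i)) / real n) = real (ntuples n) / real n ^ K" for n
    by (simp add: ntuples_def prod_dividef)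
  ultimately show ?thesis by simp
qed

lemma ntuples_power_ratio:
  assumes "(\<lambda>n. real (x n) / real n) \<longlonglongrightarrow> c"
  shows "(\<lambda>n. (real (ntuples (n - q)) / real (ntuples n)) ^ x n) \<longlonglongrightarrow> exp (- c * real q) ^ K"
proof -
  have "(\<lambda>n. \<Prod>i<K. (real (n - q - (if repl then 0 else i)) / real (n - (if repl then 0 else i))) ^ x n)
     \<longlonglongrightarrow> (\<Prod>i<K. exp (- c * real q))"
    by (intro tendsto_prod power_ratio assms)
  moreover have "(\<Prod>i<K. (real (n - q - (if repl then 0 else i)) / real (n - (if repl then 0 else i))) ^ x n)
     = (real (ntuples (n - q)) / real (ntuples n)) ^ x n" for n
    by (simp only: ntuples_def of_nat_prod prod_dividef prod_power_distrib power_divide)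
  ultimately show ?thesis by simp
qed

section \<open>Counting configurations by the variables they use\<close>

text \<open>
  The configurations of \<open>s\<close> constraints over the variables \<open>U\<close>, with the default value \<open>undefined\<close>
  that the support of \<^const>\<open>iid\<close> has outside its index set.
\<close>

definition confs :: "nat \<Rightarrow> nat set \<Rightarrow> (nat \<Rightarrow> constr) set" where
  "confs s U = PiE_dflt {..<s} undefined (\<lambda>_. constrs U)"

definition exact_confs :: "nat \<Rightarrow> nat set \<Rightarrow> (nat \<Rightarrow> constr) set" where
  "exact_confs s U = {C \<in> confs s U. verts {..<s} C = U}"

definition rename_conf :: "nat \<Rightarrow> (nat \<Rightarrow> nat) \<Rightarrow> (nat \<Rightarrow> constr) \<Rightarrow> nat \<Rightarrow> constr" where
  "rename_conf s \<sigma> C j = (if j < s then rename \<sigma> (C j) else undefined)"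

lemma finite_confs: "finite U \<Longrightarrow> finite (confs s U)"
  unfolding confs_def by (intro finite_PiE_dflt finite_constrs) auto

lemma confs_D: "C \<in> confs s U \<Longrightarrow> C ` {..<s} \<subseteq> constrs U"
  by (auto simp: confs_def PiE_dflt_def)

lemma rename_constrs:
  assumes "c \<in> constrs U" "inj_on \<sigma> U" shows "rename \<sigma> c \<in> constrs (\<sigma> ` U)"
  using assms by (auto simp: constrs_def rename_def distinct_map intro: inj_on_subset)

lemma rename_conf_confs:
  assumes "C \<in> confs s U" "inj_on \<sigma> U" shows "rename_conf s \<sigma> C \<in> confs s (\<sigma> ` U)"
  using assms rename_constrs by (auto simp: confs_def PiE_dflt_def rename_conf_def)

lemma verts_rename_conf: "verts {..<s} (rename_conf s \<sigma> C) = \<sigma> ` verts {..<s} C"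
  by (auto simp: verts_def rename_conf_def rename_def)

lemma rename_conf_inverse:
  assumes "C \<in> confs s U" "\<And>i. i \<in> U \<Longrightarrow> \<tau> (\<sigma> i) = i"
  shows "rename_conf s \<tau> (rename_conf s \<sigma> C) = C"
proof
  fix j
  show "rename_conf s \<tau> (rename_conf s \<sigma> C) j = C j"
  proof (cases "j < s")
    case True
    then have "C j \<in> constrs U" using confs_D[OF assms(1)] by auto
    then have "map (\<tau> \<circ> \<sigma>) (fst (C j)) = fst (C j)"
      using assms(2) by (intro map_idI) (auto simp: constrs_def)
    then show ?thesis using True by (simp add: rename_conf_def rename_def)
  next
    case False
    then show ?thesis using assms(1) by (auto simp: rename_conf_def confs_def PiE_dflt_def)
  qed
qed

text \<open>
  An injective renaming of the variables carries configurations on one set to configurations on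
  another, so only the number of variables matters.
\<close>

lemma sum_exact_confs:
  assumes "finite V" and inv: "\<And>U C \<sigma>. C \<in> confs s U \<Longrightarrow> inj_on \<sigma> U \<Longrightarrow> F (rename_conf s \<sigma> C) = F C"
  shows "(\<Sum>C\<in>exact_confs s V. F C) = (\<Sum>C\<in>exact_confs s {..<card V}. F C :: real)"
proof -
  obtain \<sigma> where bij: "bij_betw \<sigma> {..<card V} V"
    using assms(1) by (metis finite_same_card_bij card_lessThan finite_lessThan)
  define \<tau> where "\<tau> = inv_into {..<card V} \<sigma>"
  have bij': "bij_betw \<tau> V {..<card V}" unfolding \<tau>_def by (rule bij_betw_inv_into[OF bij])
  have \<tau>\<sigma>: "\<tau> (\<sigma> i) = i" if "i \<in> {..<card V}" for i
    unfolding \<tau>_def by (rule bij_betw_inv_into_left[OF bij that])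
  have \<sigma>\<tau>: "\<sigma> (\<tau> i) = i" if "i \<in> V" for i
    unfolding \<tau>_def by (rule bij_betw_inv_into_right[OF bij that])
  have inj: "inj_on \<sigma> {..<card V}" "inj_on \<tau> V" using bij bij' by (auto simp: bij_betw_def)
  have im: "\<sigma> ` {..<card V} = V" "\<tau> ` V = {..<card V}" using bij bij' by (auto simp: bij_betw_def)
  show ?thesis
  proof (rule sum.reindex_bij_witness[of _ "rename_conf s \<sigma>" "rename_conf s \<tau>"])
    fix C assume "C \<in> exact_confs s V"
    then have C: "C \<in> confs s V" "verts {..<s} C = V" by (auto simp: exact_confs_def)
    show "rename_conf s \<sigma> (rename_conf s \<tau> C) = C" by (rule rename_conf_inverse[OF C(1)]) (rule \<sigma>\<tau>)
    show "rename_conf s \<tau> C \<in> exact_confs s {..<card V}"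
      using rename_conf_confs[OF C(1) inj(2)] C(2) by (simp add: exact_confs_def verts_rename_conf im)
    show "F (rename_conf s \<tau> C) = F C" by (rule inv[OF C(1) inj(2)])
  next
    fix C assume "C \<in> exact_confs s {..<card V}"
    then have C: "C \<in> confs s {..<card V}" "verts {..<s} C = {..<card V}" by (auto simp: exact_confs_def)
    show "rename_conf s \<tau> (rename_conf s \<sigma> C) = C" by (rule rename_conf_inverse[OF C(1)]) (rule \<tau>\<sigma>)
    show "rename_conf s \<sigma> C \<in> exact_confs s V"
      using rename_conf_confs[OF C(1) inj(1)] C(2) by (simp add: exact_confs_def verts_rename_conf im)
  qed
qed

lemma card_verts_le:
  assumes "C ` J \<subseteq> constrs U" "finite J" shows "card (verts J C) \<le> card J * K"
proof -
  have "card (verts J C) \<le> (\<Sum>j\<in>J. card (set (fst (C j))))"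
    unfolding verts_def by (rule card_UN_le[OF assms(2)])
  also have "\<dots> \<le> (\<Sum>j\<in>J. K)"
  proof (rule sum_mono)
    fix j assume "j \<in> J"
    then have "length (fst (C j)) = K" using assms(1) constrsD(1) by blast
    then show "card (set (fst (C j))) \<le> K" using card_length[of "fst (C j)"] by simp
  qed
  finally show ?thesis by simp
qed

text \<open>
  Sort the configurations by the set of variables that they use.  As \<open>n\<close> grows only the
  binomial coefficients change; the inner sums run over fixed finite sets.
\<close>

lemma sum_confs:
  assumes inv: "\<And>U C \<sigma>. C \<in> confs s U \<Longrightarrow> inj_on \<sigma> U \<Longrightarrow> F (rename_conf s \<sigma> C) = F C"
  shows "(\<Sum>C\<in>confs s {..<n}. F C) = (\<Sum>p\<le>s * K. real (n choose p) * (\<Sum>C\<in>exact_confs s {..<p}. F C))"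
proof -
  let ?T = "{V. V \<subseteq> {..<n} \<and> card V \<le> s * K}"
  have finT: "finite ?T" by (rule finite_subset[of _ "Pow {..<n}"]) auto
  have "(\<Sum>C\<in>confs s {..<n}. F C) = (\<Sum>V\<in>?T. \<Sum>C\<in>{C\<in>confs s {..<n}. verts {..<s} C = V}. F C)"
  proof (rule sum.group[symmetric])
    show "verts {..<s} ` confs s {..<n} \<subseteq> ?T"
    proof
      fix V assume "V \<in> verts {..<s} ` confs s {..<n}"
      then obtain C where V: "V = verts {..<s} C" and C: "C ` {..<s} \<subseteq> constrs {..<n}"
        using confs_D by blast
      show "V \<in> ?T" unfolding V using verts_subset[OF C] card_verts_le[OF C] by simp
    qed
  qed (auto intro: finite_confs finT)
  also have "\<dots> = (\<Sum>V\<in>?T. \<Sum>C\<in>exact_confs s {..<card V}. F C)"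
  proof (rule sum.cong[OF refl])
    fix V assume V: "V \<in> ?T"
    then have "finite V" using finite_subset by blast
    have "{C\<in>confs s {..<n}. verts {..<s} C = V} = exact_confs s V"
    proof -
      have "C \<in> confs s {..<n} \<longleftrightarrow> C \<in> confs s V" if "verts {..<s} C = V" for C
        using that V unfolding confs_def PiE_dflt_def constrs_def verts_def by auto
      then show ?thesis unfolding exact_confs_def by blast
    qed
    then show "(\<Sum>C\<in>{C\<in>confs s {..<n}. verts {..<s} C = V}. F C) = (\<Sum>C\<in>exact_confs s {..<card V}. F C)"
      using sum_exact_confs[OF \<open>finite V\<close> inv] by simp
  qed
  also have "\<dots> = (\<Sum>p\<le>s * K. \<Sum>V\<in>{V\<in>?T. card V = p}. \<Sum>C\<in>exact_confs s {..<card V}. F C)"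
    by (rule sum.group[symmetric]) (use finT in auto)
  also have "\<dots> = (\<Sum>p\<le>s * K. real (n choose p) * (\<Sum>C\<in>exact_confs s {..<p}. F C))"
  proof (rule sum.cong[OF refl])
    fix p assume p: "p \<in> {..s * K}"
    then have "{V\<in>?T. card V = p} = {V. V \<subseteq> {..<n} \<and> card V = p}" by auto
    moreover have "card {V. V \<subseteq> {..<n} \<and> card V = p} = n choose p"
      using n_subsets[of "{..<n}" p] by simp
    ultimately show "(\<Sum>V\<in>{V\<in>?T. card V = p}. \<Sum>C\<in>exact_confs s {..<card V}. F C)
        = real (n choose p) * (\<Sum>C\<in>exact_confs s {..<p}. F C)"
      by simp
  qed
  finally show ?thesis .
qed

lemma expect_iid_law_eq_sum:
  assumes "K \<le> n"
  shows "expect (iid {..<s} (law n)) F = (\<Sum>C\<in>confs s {..<n}. F C) / (real (ntuples n) * real R) ^ s"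
proof -
  have "iid {..<s} (law n) = pmf_of_set (confs s {..<n})"
    unfolding law_def confs_def using constrs_lessThan_nonempty[OF assms]
    by (intro Pi_pmf_of_set finite_constrs) auto
  moreover have "confs s {..<n} \<noteq> {}"
    unfolding confs_def using constrs_lessThan_nonempty[OF assms] by simp
  moreover have "card (confs s {..<n}) = (ntuples n * R) ^ s"
    unfolding confs_def by (subst card_PiE_dflt) (auto intro: finite_constrs simp: card_constrs)
  ultimately show ?thesis by (simp add: integral_pmf_of_set finite_confs)
qed


section \<open>The descent seen from one constraint\<close>

text \<open>
  The penalty of the root \<open>j\<close> after \<open>t\<close> steps, counted only if \<open>I\<close> is its own ball of radius
  \<open>t + 1\<close>.  The descent needs radius \<open>t\<close> only; the extra hop makes the radius of the ball positive,
  as \<open>ball_eq_iff\<close> requires.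
\<close>

definition root_value :: "real \<Rightarrow> nat \<Rightarrow> nat set \<Rightarrow> nat \<Rightarrow> (nat \<Rightarrow> constr) \<Rightarrow> real" where
  "root_value \<eta> t I j C = of_bool (ball I C (Suc t) {j} = I) * pen (C j) (descent \<eta> I C t)"

text \<open>
  The variables that the constraints outside \<open>I\<close> must avoid for \<open>I\<close> to be the whole ball.
\<close>

definition core :: "nat \<Rightarrow> nat set \<Rightarrow> nat \<Rightarrow> (nat \<Rightarrow> constr) \<Rightarrow> nat set" where
  "core t I j C = verts (ball I C t {j}) C"

text \<open>
  The contribution to the expected penalty of the event that the ball of the root is a given set of
  \<open>s\<close> out of \<open>m\<close> constraints; the power is the probability that the other \<open>m - s\<close> avoid the core.
\<close>

definition pattern_value :: "real \<Rightarrow> nat \<Rightarrow> nat \<Rightarrow> nat \<Rightarrow> nat \<Rightarrow> real" where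
  "pattern_value \<eta> t s n m = expect (iid {..<s} (law n))
     (\<lambda>C. root_value \<eta> t {..<s} 0 C *
       (real (ntuples (n - card (core t {..<s} 0 C))) / real (ntuples n)) ^ (m - s))"

lemma descent_cong:
  assumes "\<And>j. j \<in> I \<Longrightarrow> C j = C' j"
  shows "descent \<eta> I C t = descent \<eta> I C' t"
proof (induction t)
  case (Suc t)
  have deg: "deg I C i = deg I C' i" for i
    unfolding deg_def using assms by (intro sum.cong refl) simp
  have sg: "subgrad I C x i = subgrad I C' x i" for x i
    unfolding subgrad_def using assms by (intro sum.cong refl) simp
  show ?case
  proof
    fix i show "descent \<eta> I C (Suc t) i = descent \<eta> I C' (Suc t) i"
      unfolding descent.simps Suc deg sg ..
  qed
qed (simp add: fun_eq_iff)

lemma core_cong: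
  assumes "\<And>j. j \<in> I \<Longrightarrow> C j = C' j" "j \<in> I"
  shows "core t I j C = core t I j C'"
proof -
  have "ball I C t {j} = ball I C' t {j}" using assms by (intro ball_cong) auto
  then show ?thesis unfolding core_def
    using assms(1) ball_subset[of "{j}" I C' t] assms(2) by (metis empty_subsetI insert_subset subset_iff verts_cong)
qed

lemma root_value_cong:
  assumes "\<And>j. j \<in> I \<Longrightarrow> C j = C' j" "j \<in> I"
  shows "root_value \<eta> t I j C = root_value \<eta> t I j C'"
proof -
  have "ball I C (Suc t) {j} = ball I C' (Suc t) {j}" using assms by (intro ball_cong) auto
  moreover have "descent \<eta> I C t = descent \<eta> I C' t" by (rule descent_cong[OF assms(1)])
  ultimately show ?thesis unfolding root_value_def using assms by simp
qed

lemma root_value_reindex: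
  assumes "bij_betw h {..<s} I" "h 0 = j" "0 < s"
  shows "root_value \<eta> t {..<s} 0 (C \<circ> h) = root_value \<eta> t I j C"
    and "core t {..<s} 0 (C \<circ> h) = core t I j C"
proof -
  have ball: "ball I C u {j} = h ` ball {..<s} (C \<circ> h) u {0}" for u
    using ball_reindex[OF assms(1), of C u "{0}"] assms(2) by simp
  have im: "h ` {..<s} = I" using assms(1) by (rule bij_betw_imp_surj_on)
  have sub: "ball {..<s} (C \<circ> h) (Suc t) {0} \<subseteq> {..<s}" using assms(3) by (intro ball_subset) auto
  have "ball {..<s} (C \<circ> h) (Suc t) {0} = {..<s} \<longleftrightarrow> ball I C (Suc t) {j} = I"
  proof -
    have "h ` ball {..<s} (C \<circ> h) (Suc t) {0} = h ` {..<s} \<longleftrightarrow> ball {..<s} (C \<circ> h) (Suc t) {0} = {..<s}"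
      by (rule inj_on_image_eq_iff[OF bij_betw_imp_inj_on[OF assms(1)] sub subset_refl])
    then show ?thesis unfolding ball im by blast
  qed
  then show "root_value \<eta> t {..<s} 0 (C \<circ> h) = root_value \<eta> t I j C"
    unfolding root_value_def descent_reindex[OF assms(1)] using assms(2) by simp
  show "core t {..<s} 0 (C \<circ> h) = core t I j C"
    unfolding core_def ball verts_reindex ..
qed

lemma pen_descent_exact_ball:
  assumes "finite J" "C ` J \<subseteq> constrs U" "I \<subseteq> J" "j \<in> I"
  shows "of_bool (ball J C (Suc t) {j} = I) * pen (C j) (descent \<eta> J C t) =
    root_value \<eta> t I j C * (\<Prod>l\<in>J - I. of_bool (set (fst (C l)) \<inter> core t I j C = {}))"
proof (cases "ball J C (Suc t) {j} = I")
  case True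
  have P: "ball I C (Suc t) {j} = I" "\<forall>l\<in>J - I. set (fst (C l)) \<inter> core t I j C = {}"
    using ball_eq_iff[OF assms(2-4), of t] True by (auto simp: core_def)
  have "ball J C t {j} \<subseteq> I" using ball_Suc_superset[OF assms(2), of "{j}" t] True assms by auto
  then have "descent \<eta> J C t i = descent \<eta> I C t i" if "i \<in> set (fst (C j))" for i
    using that assms by (intro descent_local[OF assms(1-3), of "{j}"]) (auto simp: verts_def)
  then have "pen (C j) (descent \<eta> J C t) = pen (C j) (descent \<eta> I C t)"
    using assms by (intro slack_cong(2)[of _ U]) auto
  moreover have "(\<Prod>l\<in>J - I. of_bool (set (fst (C l)) \<inter> core t I j C = {})) = (1::real)"
    using P(2) by (intro prod.neutral) auto
  ultimately show ?thesis using True P(1) by (simp add: root_value_def)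
next
  case False
  have "root_value \<eta> t I j C = 0 \<or> (\<exists>l\<in>J - I. set (fst (C l)) \<inter> core t I j C \<noteq> {})"
    using ball_eq_iff[OF assms(2-4), of t] False by (auto simp: core_def root_value_def)
  then have "root_value \<eta> t I j C * (\<Prod>l\<in>J - I. of_bool (set (fst (C l)) \<inter> core t I j C = {})) = 0"
    using assms(1) by (auto intro!: prod_zero)
  then show ?thesis using False by simp
qed

lemma bij_fixing_root:
  assumes "finite I" "j \<in> I"
  obtains h where "bij_betw h {..<card I} I" "h (0::nat) = (j::nat)"
proof -
  have pos: "card I > 0" using assms card_gt_0_iff by blast
  have "card {1..<card I} = card (I - {j})" using assms by simp
  then obtain g where g: "bij_betw g {1..<card I} (I - {j})"
    using finite_same_card_bij[of "{1..<card I}" "I - {j}"] assms by auto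
  define h where "h = g(0 := j)"
  have "bij_betw h {1..<card I} (I - {j})"
    using g bij_betw_cong[of "{1..<card I}" g h "I - {j}"] by (simp add: h_def)
  then have "bij_betw h ({1..<card I} \<union> {0}) ((I - {j}) \<union> {h 0})"
    by (intro notIn_Un_bij_betw) (auto simp: h_def)
  moreover have "{1..<card I} \<union> {0} = {..<card I}" using pos by auto
  moreover have "(I - {j}) \<union> {h 0} = I" using assms by (auto simp: h_def)
  ultimately show ?thesis using that[of h] by (simp add: h_def)
qed

text \<open>
  Given the constraints in \<open>I\<close>, the others are independent of them and each avoids the core with a
  probability that depends only on the size of the core.  Renumbering the constraints shows that
  the result depends on \<open>I\<close> only through its size.
\<close>

lemma expect_exact_ball:
  assumes n: "K \<le> n" and J: "finite J" "I \<subseteq> J" "j \<in> I"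
  shows "expect (iid J (law n)) (\<lambda>C. of_bool (ball J C (Suc t) {j} = I) * pen (C j) (descent \<eta> J C t))
    = pattern_value \<eta> t (card I) n (card J)"
proof -
  let ?s = "card I"
  have I: "finite I" using J finite_subset by blast
  have s0: "0 < ?s" using I J card_gt_0_iff by blast
  obtain h where h: "bij_betw h {..<?s} I" "h 0 = j" using bij_fixing_root[OF I J(3)] .
  let ?G = "\<lambda>I j C. root_value \<eta> t I j C *
     (real (ntuples (n - card (core t I j C))) / real (ntuples n)) ^ (card J - ?s)"
  have "expect (iid J (law n)) (\<lambda>C. of_bool (ball J C (Suc t) {j} = I) * pen (C j) (descent \<eta> J C t))
     = expect (iid J (law n)) (\<lambda>C. root_value \<eta> t I j C *
         (\<Prod>l\<in>J - I. of_bool (set (fst (C l)) \<inter> core t I j C = {})))"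
    by (rule expect_cong, rule pen_descent_exact_ball[OF J(1) _ J(2,3)], rule iid_law_D[OF n J(1)])
  also have "\<dots> = expect (iid I (law n)) (\<lambda>C. root_value \<eta> t I j C *
      expect (law n) (\<lambda>c. of_bool (set (fst c) \<inter> core t I j C = {})) ^ card (J - I))"
  proof (rule expect_iid_split[OF J(1,2) finite_set_law[OF n]])
    show "depends_on I (root_value \<eta> t I j)"
      unfolding depends_on_def using root_value_cong[OF _ J(3)] by blast
    show "depends_on I (\<lambda>C c. of_bool (set (fst c) \<inter> core t I j C = {}) :: real)"
      unfolding depends_on_def using core_cong[OF _ J(3)] by metis
  qed auto
  also have "\<dots> = expect (iid I (law n)) (?G I j)"
  proof (rule expect_cong)
    fix C assume "C \<in> set_pmf (iid I (law n))"
    then have C: "C ` I \<subseteq> constrs {..<n}" by (rule iid_law_D[OF n I])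
    have "core t I j C \<subseteq> {..<n}" unfolding core_def
      using ball_subset[of "{j}" I C t] J(3) C by (intro verts_subset) blast
    then show "root_value \<eta> t I j C * expect (law n) (\<lambda>c. of_bool (set (fst c) \<inter> core t I j C = {})) ^ card (J - I)
        = ?G I j C"
      using expect_law_avoid[OF n] card_Diff_subset[OF I J(2)] by simp
  qed
  also have "\<dots> = expect (iid I (law n)) (\<lambda>C. ?G {..<?s} 0 (C \<circ> h))"
    unfolding root_value_reindex[OF h s0] ..
  also have "\<dots> = expect (iid {..<?s} (law n)) (?G {..<?s} 0)"
  proof (rule expect_iid_bij[symmetric, OF _ I h(1)])
    have "?G {..<?s} 0 C = ?G {..<?s} 0 C'" if "\<And>j. j \<in> {..<?s} \<Longrightarrow> C j = C' j" for C C'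
      using root_value_cong[of "{..<?s}" C C' 0] core_cong[of "{..<?s}" C C' 0] that s0 by simp
    then show "depends_on {..<?s} (?G {..<?s} 0)"
      unfolding depends_on_def by blast
  qed simp
  finally show ?thesis unfolding pattern_value_def .
qed

lemma card_subsets_through:
  assumes "finite J" "j \<in> J" "0 < s"
  shows "card {I. I \<subseteq> J \<and> j \<in> I \<and> card I = s} = (card J - 1) choose (s - 1)"
proof -
  have "{I. I \<subseteq> J \<and> j \<in> I \<and> card I = s} = insert j ` {I. I \<subseteq> J - {j} \<and> card I = s - 1}" (is "?L = ?R")
  proof
    show "?L \<subseteq> ?R"
    proof
      fix I assume I: "I \<in> ?L"
      then have "finite I" using assms finite_subset by auto
      then have "I = insert j (I - {j})" "card (I - {j}) = s - 1" using I by auto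
      then show "I \<in> ?R" using I by blast
    qed
    show "?R \<subseteq> ?L"
    proof
      fix I assume "I \<in> ?R"
      then obtain I' where I': "I = insert j I'" "I' \<subseteq> J - {j}" "card I' = s - 1" by blast
      moreover have "finite I'" "j \<notin> I'" using I' assms finite_subset by blast+
      ultimately show "I \<in> ?L" using assms by auto
    qed
  qed
  moreover have "inj_on (insert j) {I. I \<subseteq> J - {j} \<and> card I = s - 1}"
  proof (rule inj_onI)
    fix A B assume AB: "A \<in> {I. I \<subseteq> J - {j} \<and> card I = s - 1}" "B \<in> {I. I \<subseteq> J - {j} \<and> card I = s - 1}"
      and eq: "insert j A = insert j B"
    have "A = insert j A - {j}" "B = insert j B - {j}" using AB by blast+
    then show "A = B" using eq by simp
  qed
  ultimately show ?thesis using n_subsets[of "J - {j}" "s - 1"] assms by (simp add: card_image)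
qed

lemma expect_pen_truncated:
  assumes n: "K \<le> n" and J: "finite J" "j \<in> J"
  shows "expect (iid J (law n)) (\<lambda>C. of_bool (card (ball J C (Suc t) {j}) \<le> S) * pen (C j) (descent \<eta> J C t))
    = (\<Sum>s=1..S. real ((card J - 1) choose (s - 1)) * pattern_value \<eta> t s n (card J))"
proof -
  let ?v = "\<lambda>s. real ((card J - 1) choose (s - 1)) * pattern_value \<eta> t s n (card J)"
  let ?E = "expect (iid J (law n))"
  let ?X = "\<lambda>I C. of_bool (ball J C (Suc t) {j} = I) * pen (C j) (descent \<eta> J C t)"
  let ?T = "{I. I \<subseteq> J \<and> j \<in> I \<and> card I \<in> {1..S}}"
  have finT: "finite ?T" by (rule finite_subset[of _ "Pow J"]) (use J in auto)
  have "?E (\<lambda>C. of_bool (card (ball J C (Suc t) {j}) \<le> S) * pen (C j) (descent \<eta> J C t))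
     = ?E (\<lambda>C. \<Sum>I\<in>?T. ?X I C)"
  proof (rule expect_cong)
    fix C assume "C \<in> set_pmf (iid J (law n))"
    then have C: "C ` J \<subseteq> constrs {..<n}" by (rule iid_law_D[OF n J(1)])
    let ?B = "ball J C (Suc t) {j}"
    have B: "?B \<subseteq> J" "j \<in> ?B" using ball_subset[of "{j}" J] subset_ball[OF C, of "{j}"] J by blast+
    then have B1: "1 \<le> card ?B" using J finite_subset by (metis card_gt_0_iff empty_iff less_eq_Suc_le One_nat_def)
    have "(\<Sum>I\<in>?T. ?X I C) = (\<Sum>I\<in>?T \<inter> {?B}. pen (C j) (descent \<eta> J C t))"
      using finT by (intro sum.mono_neutral_cong_right) auto
    also have "\<dots> = of_bool (card ?B \<le> S) * pen (C j) (descent \<eta> J C t)"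
      using B B1 by (cases "card ?B \<le> S") auto
    finally show "of_bool (card ?B \<le> S) * pen (C j) (descent \<eta> J C t) = (\<Sum>I\<in>?T. ?X I C)" ..
  qed
  also have "\<dots> = (\<Sum>I\<in>?T. ?E (?X I))"
    by (rule expect_sum[OF finite_set_iid_law[OF n J(1)]])
  also have "\<dots> = (\<Sum>I\<in>?T. pattern_value \<eta> t (card I) n (card J))"
    by (intro sum.cong refl expect_exact_ball n J) auto
  also have "\<dots> = (\<Sum>s=1..S. \<Sum>I\<in>{I\<in>?T. card I = s}. pattern_value \<eta> t (card I) n (card J))"
    by (rule sum.group[symmetric, OF finT]) auto
  also have "\<dots> = (\<Sum>s=1..S. ?v s)"
  proof (rule sum.cong[OF refl])
    fix s assume s: "s \<in> {1..S}"
    have eq: "{I\<in>?T. card I = s} = {I. I \<subseteq> J \<and> j \<in> I \<and> card I = s}" using s by auto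
    show "(\<Sum>I\<in>{I\<in>?T. card I = s}. pattern_value \<eta> t (card I) n (card J))
        = ?v s"
      unfolding eq using card_subsets_through[OF J, of s] s by simp
  qed
  finally show ?thesis .
qed

text \<open>
  Balls with more than \<open>S\<close> constraints are discarded; by Markov's inequality they carry probability
  at most their expected size divided by \<open>S\<close>.
\<close>

lemma expect_pen_approx:
  assumes n: "2 * K \<le> n" and c: "0 \<le> c" and J: "finite J" "j \<in> J" "real (card J) \<le> c * real n" and S: "0 < S"
  shows "\<bar>expect (iid J (law n)) (\<lambda>C. pen (C j) (descent \<eta> J C t))
      - (\<Sum>s=1..S. real ((card J - 1) choose (s - 1)) * pattern_value \<eta> t s n (card J))\<bar>
    \<le> pen_bound * ball_size c (Suc t) / real S"
proof -
  have Kn: "K \<le> n" using n by simp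
  let ?E = "expect (iid J (law n))"
  let ?pen = "\<lambda>C. pen (C j) (descent \<eta> J C t)" and ?B = "\<lambda>C. card (ball J C (Suc t) {j})"
  note fin = finite_set_iid_law[OF Kn J(1)]
  have diff: "?E ?pen - ?E (\<lambda>C. of_bool (?B C \<le> S) * ?pen C) = ?E (\<lambda>C. ?pen C - of_bool (?B C \<le> S) * ?pen C)"
    by (rule expect_diff[OF fin, symmetric])
  have "0 \<le> ?E (\<lambda>C. ?pen C - of_bool (?B C \<le> S) * ?pen C)"
    by (rule const_le_expect[OF fin]) (simp add: pen_nonneg of_bool_def)
  moreover have "?E (\<lambda>C. ?pen C - of_bool (?B C \<le> S) * ?pen C) \<le> ?E (\<lambda>C. pen_bound / real S * real (?B C))"
  proof (rule expect_mono[OF fin])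
    fix C assume "C \<in> set_pmf (iid J (law n))"
    then have "snd (C j) < R" using iid_law_D[OF Kn J(1)] J(2) constrsD(3) by blast
    then have pen: "?pen C \<le> pen_bound" by (rule pen_le[OF _ descent_in_box])
    show "?pen C - of_bool (?B C \<le> S) * ?pen C \<le> pen_bound / real S * real (?B C)"
    proof (cases "?B C \<le> S")
      case True
      then show ?thesis using pen_bound_nonneg by simp
    next
      case False
      then have "pen_bound * 1 \<le> pen_bound * (real (?B C) / real S)"
        using S by (intro mult_left_mono pen_bound_nonneg) simp
      then show ?thesis using pen False by simp
    qed
  qed
  moreover have "\<dots> = pen_bound / real S * ?E (\<lambda>C. real (?B C))" by simp
  moreover have "\<dots> \<le> pen_bound / real S * ball_size c (Suc t)"
    by (intro mult_left_mono expect_card_ball[OF n c J] divide_nonneg_nonneg pen_bound_nonneg) auto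
  ultimately show ?thesis unfolding expect_pen_truncated[OF Kn J(1,2), symmetric] using diff by simp
qed

section \<open>The local limit\<close>

lemma core_subset_verts: "j \<in> I \<Longrightarrow> core t I j C \<subseteq> verts I C"
  unfolding core_def using ball_subset[of "{j}" I C t] by (intro verts_mono) auto

lemma root_value_rename:
  assumes C: "C \<in> confs s U" and \<sigma>: "inj_on \<sigma> U" and s: "0 < s"
  shows "root_value \<eta> t {..<s} 0 (rename_conf s \<sigma> C) = root_value \<eta> t {..<s} 0 C"
    and "card (core t {..<s} 0 (rename_conf s \<sigma> C)) = card (core t {..<s} 0 C)"
proof -
  let ?I = "{..<s}"
  have CI: "C ` ?I \<subseteq> constrs U" by (rule confs_D[OF C])
  have inj: "inj_on \<sigma> (verts ?I C)" by (rule inj_on_subset[OF \<sigma> verts_subset[OF CI]])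
  have 0: "0 \<in> ?I" using s by simp
  have agree: "j \<in> ?I \<Longrightarrow> rename_conf s \<sigma> C j = (rename \<sigma> \<circ> C) j" for j
    by (simp add: rename_conf_def)
  have ball: "ball ?I (rename \<sigma> \<circ> C) u {0} = ball ?I C u {0}" for u
    by (rule ball_rename[OF inj]) (use 0 in auto)
  have C0: "C 0 \<in> constrs U" using CI 0 by blast
  have "pen (rename \<sigma> (C 0)) (descent \<eta> ?I (rename \<sigma> \<circ> C) t) = pen (C 0) (descent \<eta> ?I C t)"
    unfolding pen_rename[OF C0]
  proof (rule slack_cong(2)[OF C0])
    fix i assume "i \<in> set (fst (C 0))"
    then have "i \<in> verts ?I C" using 0 by (auto simp: verts_def)
    then show "(descent \<eta> ?I (rename \<sigma> \<circ> C) t \<circ> \<sigma>) i = descent \<eta> ?I C t i"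
      using descent_rename[OF CI inj, of i \<eta> t] by (metis comp_apply)
  qed
  then have "root_value \<eta> t ?I 0 (rename \<sigma> \<circ> C) = root_value \<eta> t ?I 0 C"
    unfolding root_value_def ball by (metis comp_apply)
  then show "root_value \<eta> t ?I 0 (rename_conf s \<sigma> C) = root_value \<eta> t ?I 0 C"
    using root_value_cong[of ?I "rename_conf s \<sigma> C" "rename \<sigma> \<circ> C" 0] agree 0 by metis
  have "core t ?I 0 (rename_conf s \<sigma> C) = core t ?I 0 (rename \<sigma> \<circ> C)"
    by (rule core_cong[OF _ 0]) (rule agree)
  then have "core t ?I 0 (rename_conf s \<sigma> C) = \<sigma> ` core t ?I 0 C"
    unfolding core_def ball verts_rename .
  then show "card (core t ?I 0 (rename_conf s \<sigma> C)) = card (core t ?I 0 C)"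
    using card_image[OF inj_on_subset[OF inj core_subset_verts[OF 0]]] by simp
qed

lemma pattern_value_eq_sum:
  assumes "K \<le> n" "0 < s"
  shows "pattern_value \<eta> t s n m = (\<Sum>p\<le>s * K. \<Sum>C\<in>exact_confs s {..<p}. root_value \<eta> t {..<s} 0 C *
     (real (n choose p) / (real (ntuples n) * real R) ^ s *
      (real (ntuples (n - card (core t {..<s} 0 C))) / real (ntuples n)) ^ (m - s)))"
proof -
  let ?F = "\<lambda>C. root_value \<eta> t {..<s} 0 C *
    (real (ntuples (n - card (core t {..<s} 0 C))) / real (ntuples n)) ^ (m - s)"
  have "pattern_value \<eta> t s n m = (\<Sum>C\<in>confs s {..<n}. ?F C) / (real (ntuples n) * real R) ^ s"
    unfolding pattern_value_def by (rule expect_iid_law_eq_sum[OF assms(1)])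
  also have "(\<Sum>C\<in>confs s {..<n}. ?F C) = (\<Sum>p\<le>s * K. real (n choose p) * (\<Sum>C\<in>exact_confs s {..<p}. ?F C))"
    by (rule sum_confs) (simp only: root_value_rename[OF _ _ assms(2)])
  finally show ?thesis by (simp add: sum_divide_distrib sum_distrib_left mult_ac)
qed

text \<open>
  A configuration with nonzero root value is the ball of its root, hence connected.
\<close>

lemma root_value_few_verts:
  assumes "C \<in> exact_confs s {..<p}" "0 < s" "root_value \<eta> t {..<s} 0 C \<noteq> 0"
  shows "p \<le> 1 + s * (K - 1)"
proof -
  have C: "C ` {..<s} \<subseteq> constrs {..<p}" "verts {..<s} C = {..<p}"
    using assms(1) confs_D by (auto simp: exact_confs_def)
  have "ball {..<s} C (Suc t) {0} = {..<s}" using assms(3) by (auto simp: root_value_def)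
  then show ?thesis using card_verts_ball[OF _ C(1), of 0 "Suc t"] assms(2) C(2) by simp
qed

text \<open>
  The powers of \<open>n\<close> balance: choosing the other \<open>s - 1\<close> constraints of the ball contributes
  \<open>n\<^bsup>s-1\<^esup>\<close>, choosing the variables \<open>n\<^sup>p\<close>, and the probability of a configuration \<open>n\<^bsup>-sK\<^esup>\<close>.  The total
  exponent is not positive when \<open>p \<le> 1 + s (K - 1)\<close>.
\<close>

lemma pattern_coefficient_convergent:
  assumes x: "(\<lambda>n. real (m n) / real n) \<longlonglongrightarrow> c" and p: "p \<le> 1 + s * (K - 1)" and s: "0 < s"
  shows "convergent (\<lambda>n. real ((m n - 1) choose (s - 1)) * (real (n choose p) / (real (ntuples n) * real R) ^ s *
      (real (ntuples (n - q)) / real (ntuples n)) ^ (m n - s)))"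
proof -
  \<comment> \<open>The surplus of powers of \<open>1 / n\<close>; the bound on \<open>p\<close> makes this an honest difference.\<close>
  let ?e = "s * K - (s - 1) - p"
  have e: "(s - 1) + p + ?e = s * K"
  proof -
    have "s * K = s * (K - 1) + s" using K_pos by (metis Suc_pred' add.commute less_eq_Suc_le mult_Suc_right One_nat_def)
    then show ?thesis using p s by linarith
  qed
  let ?g = "\<lambda>n. (real ((m n - 1) choose (s - 1)) / real n ^ (s - 1)) * (real (n choose p) / real n ^ p)
      * (1 / real n) ^ ?e * (1 / (real (ntuples n) / real n ^ K * real R) ^ s)
      * (real (ntuples (n - q)) / real (ntuples n)) ^ (m n - s)"
  have id: "(\<lambda>n. real n / real n) \<longlonglongrightarrow> 1" by real_asymp
  have inv: "(\<lambda>n. 1 / real n) \<longlonglongrightarrow> 0" by real_asymp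
  have "convergent ?g"
  proof (intro convergent_mult)
    show "convergent (\<lambda>n. real ((m n - 1) choose (s - 1)) / real n ^ (s - 1))"
      using binomial_ratio[OF ratio_diff_nat[OF x, of 1]] by (rule convergentI)
    show "convergent (\<lambda>n. real (n choose p) / real n ^ p)"
      using binomial_ratio[OF id] by (rule convergentI)
    show "convergent (\<lambda>n. (1 / real n) ^ ?e)"
      using tendsto_power[OF inv] by (rule convergentI)
    have "(\<lambda>n. 1 / (real (ntuples n) / real n ^ K * real R) ^ s) \<longlonglongrightarrow> 1 / (1 * real R) ^ s"
      using R_pos by (intro tendsto_intros ntuples_asymp) auto
    then show "convergent (\<lambda>n. 1 / (real (ntuples n) / real n ^ K * real R) ^ s)" by (rule convergentI)
    show "convergent (\<lambda>n. (real (ntuples (n - q)) / real (ntuples n)) ^ (m n - s))"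
      using ntuples_power_ratio[OF ratio_diff_nat[OF x, of s]] by (rule convergentI)
  qed
  then obtain L where "?g \<longlonglongrightarrow> L" unfolding convergent_def by blast
  moreover have "\<forall>\<^sub>F n in sequentially. ?g n = real ((m n - 1) choose (s - 1)) *
     (real (n choose p) / (real (ntuples n) * real R) ^ s * (real (ntuples (n - q)) / real (ntuples n)) ^ (m n - s))"
    using eventually_gt_at_top[of 0]
  proof eventually_elim
    case (elim n)
    have "real n ^ (s * K) = real n ^ (s - 1) * real n ^ p * real n ^ ?e"
      unfolding power_add[symmetric] e ..
    then have "real n ^ (s - 1) * real n ^ p * real n ^ ?e * (1 / (real n ^ K) ^ s) = 1"
      using elim by (simp add: power_mult[symmetric] mult.commute[of K s])
    then have "1 / (real n ^ K) ^ s = 1 / (real n ^ (s - 1) * real n ^ p * real n ^ ?e)"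
      using elim by (simp add: field_simps)
    then have *: "(real n ^ K) ^ s = real n ^ (s - 1) * real n ^ p * real n ^ ?e" using elim by simp
    have "?g n = real ((m n - 1) choose (s - 1)) * (real (n choose p) / (real (ntuples n) * real R) ^ s
        * ((real n ^ K) ^ s / (real n ^ (s - 1) * real n ^ p * real n ^ ?e))
        * (real (ntuples (n - q)) / real (ntuples n)) ^ (m n - s))"
      by (simp add: power_mult_distrib power_divide mult_ac)
    also have "(real n ^ K) ^ s / (real n ^ (s - 1) * real n ^ p * real n ^ ?e) = 1"
      unfolding * using elim by simp
    finally show ?case by simp
  qed
  ultimately show ?thesis by (rule convergentI[OF Lim_transform_eventually])
qed

lemma pattern_value_convergent:
  assumes x: "(\<lambda>n. real (m n) / real n) \<longlonglongrightarrow> c" and s: "0 < s"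
  shows "convergent (\<lambda>n. real ((m n - 1) choose (s - 1)) * pattern_value \<eta> t s n (m n))"
proof -
  let ?coef = "\<lambda>p C n. real ((m n - 1) choose (s - 1)) * (real (n choose p) / (real (ntuples n) * real R) ^ s *
      (real (ntuples (n - card (core t {..<s} 0 C))) / real (ntuples n)) ^ (m n - s))"
  let ?g = "\<lambda>n. \<Sum>p\<le>s * K. \<Sum>C\<in>exact_confs s {..<p}. root_value \<eta> t {..<s} 0 C * ?coef p C n"
  have "convergent ?g"
  proof (intro convergent_sum)
    fix p C assume C: "C \<in> exact_confs s {..<p}"
    show "convergent (\<lambda>n. root_value \<eta> t {..<s} 0 C * ?coef p C n)"
    proof (cases "root_value \<eta> t {..<s} 0 C = 0")
      case True
      then show ?thesis by (simp add: convergent_const)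
    next
      case False
      then show ?thesis
        by (intro convergent_mult convergent_const pattern_coefficient_convergent[OF x _ s]
            root_value_few_verts[OF C s])
    qed
  qed
  then obtain L where "?g \<longlonglongrightarrow> L" unfolding convergent_def by blast
  moreover have "\<forall>\<^sub>F n in sequentially. ?g n = real ((m n - 1) choose (s - 1)) * pattern_value \<eta> t s n (m n)"
    using eventually_ge_at_top[of K]
    by eventually_elim (simp only: pattern_value_eq_sum[OF _ s] sum_distrib_left mult.left_commute)
  ultimately show ?thesis by (rule convergentI[OF Lim_transform_eventually])
qed

end

text \<open>
  Such a sequence is Cauchy, so its limit need not be identified.
\<close>

lemma convergent_if_approximable:
  fixes v :: "nat \<Rightarrow> real"
  assumes "\<And>\<epsilon>. \<epsilon> > 0 \<Longrightarrow> \<exists>w. convergent w \<and> (\<forall>\<^sub>F n in sequentially. \<bar>v n - w n\<bar> \<le> \<epsilon>)"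
  shows "convergent v"
proof (rule Cauchy_convergent, rule metric_CauchyI)
  fix e :: real assume e: "0 < e"
  then obtain w where w: "convergent w" and close: "\<forall>\<^sub>F n in sequentially. \<bar>v n - w n\<bar> \<le> e / 4"
    using assms[of "e / 4"] by auto
  obtain M1 where M1: "\<And>m n. m \<ge> M1 \<Longrightarrow> n \<ge> M1 \<Longrightarrow> dist (w m) (w n) < e / 4"
    using metric_CauchyD[OF convergent_Cauchy[OF w], of "e / 4"] e by auto
  obtain M2 where M2: "\<And>n. n \<ge> M2 \<Longrightarrow> \<bar>v n - w n\<bar> \<le> e / 4"
    using close by (auto simp: eventually_sequentially)
  show "\<exists>M. \<forall>m\<ge>M. \<forall>n\<ge>M. dist (v m) (v n) < e"
  proof (intro exI allI impI)
    fix m n assume "max M1 M2 \<le> m" "max M1 M2 \<le> n"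
    then have "\<bar>w m - w n\<bar> < e / 4" "\<bar>v m - w m\<bar> \<le> e / 4" "\<bar>v n - w n\<bar> \<le> e / 4"
      using M1[of m n] M2[of m] M2[of n] by (simp_all add: dist_real_def)
    then show "dist (v m) (v n) < e" unfolding dist_real_def using e by linarith
  qed
qed

lemma prob_le_expect:
  assumes "finite (set_pmf p)" "0 < e" "\<And>x. x \<in> set_pmf p \<Longrightarrow> 0 \<le> (g x :: real)"
    "\<And>x. x \<in> set_pmf p \<Longrightarrow> x \<in> A \<Longrightarrow> e \<le> g x"
  shows "measure_pmf.prob p A \<le> expect p g / e"
proof -
  have "measure_pmf.prob p A = expect p (indicator A)" by simp
  also have "\<dots> \<le> expect p (\<lambda>x. g x / e)"
    using assms by (intro expect_mono) (auto simp: indicator_def divide_simps)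
  finally show ?thesis by simp
qed

context lsat
begin

section \<open>Existence of the limiting expected cost per variable\<close>

definition instance_law :: "real \<Rightarrow> nat \<Rightarrow> (nat \<Rightarrow> constr) pmf" where
  "instance_law c n = iid {..<num_constraints c n} (law n)"

definition instance_opt :: "real \<Rightarrow> nat \<Rightarrow> (nat \<Rightarrow> constr) \<Rightarrow> real" where
  "instance_opt c n C = opt {..<num_constraints c n} C / real n"

definition mean_opt :: "real \<Rightarrow> nat \<Rightarrow> real" where
  "mean_opt c n = expect (instance_law c n) (instance_opt c n)"

definition mean_descent :: "real \<Rightarrow> real \<Rightarrow> nat \<Rightarrow> nat \<Rightarrow> real" where
  "mean_descent c \<eta> t n = expect (instance_law c n)
     (\<lambda>C. cost {..<num_constraints c n} C (descent \<eta> {..<num_constraints c n} C t) / real n)"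

lemma finite_set_instance_law: "K \<le> n \<Longrightarrow> finite (set_pmf (instance_law c n))"
  unfolding instance_law_def by (rule finite_set_iid_law) auto

lemma instance_law_D: "K \<le> n \<Longrightarrow> C \<in> set_pmf (instance_law c n) \<Longrightarrow> C ` {..<num_constraints c n} \<subseteq> constrs {..<n}"
  unfolding instance_law_def by (rule iid_law_D) auto

text \<open>
  By symmetry every constraint has the same truncated expected penalty.  It converges, and so does
  the number of constraints per variable.
\<close>

lemma mean_descent_convergent:
  assumes c: "0 \<le> c" shows "convergent (mean_descent c \<eta> t)"
proof (rule convergent_if_approximable)
  fix \<epsilon> :: real assume \<epsilon>: "\<epsilon> > 0"
  let ?m = "num_constraints c"
  define B where "B = pen_bound * ball_size c (Suc t)"
  have B: "0 \<le> B" unfolding B_def by (intro mult_nonneg_nonneg pen_bound_nonneg ball_size_nonneg c)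
  \<comment> \<open>\<open>c B / S\<close> bounds the truncation error per variable.\<close>
  obtain S :: nat where S: "c * B / \<epsilon> < real S" using reals_Archimedean2 by blast
  have S0: "0 < S" using S B c \<epsilon> by (metis divide_nonneg_pos mult_nonneg_nonneg not_less of_nat_0 gr0I)
  let ?\<theta> = "\<lambda>n. \<Sum>s=1..S. real ((?m n - 1) choose (s - 1)) * pattern_value \<eta> t s n (?m n)"
  let ?w = "\<lambda>n. real (?m n) / real n * ?\<theta> n"
  have "convergent ?w"
  proof (rule convergent_mult)
    show "convergent (\<lambda>n. real (?m n) / real n)" by (rule convergentI[OF num_constraints_ratio[OF c]])
    show "convergent ?\<theta>"
      by (rule convergent_sum, rule pattern_value_convergent[OF num_constraints_ratio[OF c]]) auto
  qed
  moreover have "\<forall>\<^sub>F n in sequentially. \<bar>mean_descent c \<eta> t n - ?w n\<bar> \<le> \<epsilon>"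
    using eventually_ge_at_top[of "2 * K"]
  proof eventually_elim
    case (elim n)
    have Kn: "K \<le> n" and n0: "0 < n" using elim K_pos by auto
    let ?J = "{..<?m n}"
    let ?pen = "\<lambda>j. expect (iid ?J (law n)) (\<lambda>C. pen (C j) (descent \<eta> ?J C t))"
    have J: "real (card ?J) \<le> c * real n" using num_constraints_le[OF c] by simp
    have "mean_descent c \<eta> t n = (\<Sum>j\<in>?J. ?pen j) / real n"
      unfolding mean_descent_def instance_law_def cost_def
      by (simp only: integral_divide_zero[where c = "real n"] expect_sum[OF finite_set_iid_law[OF Kn finite_lessThan]])
    moreover have "(\<Sum>j\<in>?J. ?pen j - ?\<theta> n) = (\<Sum>j\<in>?J. ?pen j) - real (?m n) * ?\<theta> n"
      by (simp only: sum_subtractf sum_constant card_lessThan)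
    ultimately have "mean_descent c \<eta> t n - ?w n = (\<Sum>j\<in>?J. ?pen j - ?\<theta> n) / real n"
      by (simp only: diff_divide_distrib times_divide_eq_left)
    then have "\<bar>mean_descent c \<eta> t n - ?w n\<bar> = \<bar>\<Sum>j\<in>?J. ?pen j - ?\<theta> n\<bar> / real n"
      by (simp only: abs_divide abs_of_nat)
    also have "\<dots> \<le> (\<Sum>j\<in>?J. B / real S) / real n"
    proof (rule divide_right_mono[OF order_trans[OF sum_abs sum_mono]])
      fix j assume "j \<in> ?J"
      then show "\<bar>?pen j - ?\<theta> n\<bar> \<le> B / real S"
        using expect_pen_approx[OF elim c _ _ J S0, of j \<eta> t] by (simp add: B_def)
    qed simp
    also have "\<dots> = real (?m n) / real n * (B / real S)" by simp
    also have "\<dots> \<le> c * (B / real S)"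
      using J n0 B by (intro mult_right_mono) (auto simp: divide_le_eq)
    also have "\<dots> \<le> \<epsilon>" using S S0 \<epsilon> by (simp add: field_simps)
    finally show ?case .
  qed
  ultimately show "\<exists>w. convergent w \<and> (\<forall>\<^sub>F n in sequentially. \<bar>mean_descent c \<eta> t n - w n\<bar> \<le> \<epsilon>)" by blast
qed

lemma mean_opt_near_descent:
  assumes c: "0 \<le> c" and n: "K \<le> n" and q: "0 < q"
  shows "\<bar>mean_opt c n - (\<Sum>t<q\<^sup>2. mean_descent c (1 / real q) t n) / real (q\<^sup>2)\<bar>
    \<le> c * real K * ((B2 - B1)\<^sup>2 + coef_bound\<^sup>2) / (2 * real q)"
proof -
  let ?J = "{..<num_constraints c n}"
  let ?e = "c * real K * ((B2 - B1)\<^sup>2 + coef_bound\<^sup>2) / (2 * real q)"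
  let ?F = "\<lambda>C. (\<Sum>t<q\<^sup>2. cost ?J C (descent (1 / real q) ?J C t) / real n) / real (q\<^sup>2)"
  have n0: "real n > 0" using n K_pos by simp
  note fin = finite_set_instance_law[OF n, of c]
  have eq: "(\<Sum>t<q\<^sup>2. mean_descent c (1 / real q) t n) / real (q\<^sup>2) = expect (instance_law c n) ?F"
    unfolding mean_descent_def by (simp only: integral_divide_zero[where c = "real (q\<^sup>2)"] expect_sum[OF fin])
  have "instance_opt c n C \<le> ?F C \<and> ?F C \<le> instance_opt c n C + ?e" if "C \<in> set_pmf (instance_law c n)" for C
  proof -
    note C = instance_law_D[OF n that]
    let ?G = "(\<Sum>t<q\<^sup>2. cost ?J C (descent (1 / real q) ?J C t)) / real (q\<^sup>2)"
    have F: "?F C = ?G / real n" by (simp add: sum_divide_distrib mult.commute)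
    have "real (card ?J) * real K * ((B2 - B1)\<^sup>2 + coef_bound\<^sup>2) / (2 * real q)
        \<le> (c * real n) * real K * ((B2 - B1)\<^sup>2 + coef_bound\<^sup>2) / (2 * real q)"
      using num_constraints_le[OF c] by (intro divide_right_mono mult_right_mono) auto
    also have "\<dots> = ?e * real n" by simp
    finally have G: "opt ?J C \<le> ?G" "?G \<le> opt ?J C + ?e * real n"
      using opt_near_descent[OF _ C _ q] by force+
    have "opt ?J C / real n \<le> ?G / real n" by (rule divide_right_mono[OF G(1)]) simp
    moreover have "?G / real n \<le> (opt ?J C + ?e * real n) / real n" by (rule divide_right_mono[OF G(2)]) simp
    moreover have "(opt ?J C + ?e * real n) / real n = opt ?J C / real n + ?e"
      using n0 by (simp add: add_divide_distrib)
    ultimately show ?thesis unfolding F instance_opt_def by (simp only: conj_absorb)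
  qed
  note bounds = this
  have "mean_opt c n \<le> expect (instance_law c n) ?F"
    unfolding mean_opt_def by (rule expect_mono[OF fin]) (rule bounds[THEN conjunct1])
  moreover have "expect (instance_law c n) ?F \<le> expect (instance_law c n) (\<lambda>C. instance_opt c n C + ?e)"
    by (rule expect_mono[OF fin]) (rule bounds[THEN conjunct2])
  moreover have "expect (instance_law c n) (\<lambda>C. instance_opt c n C + ?e) = mean_opt c n + ?e"
    unfolding mean_opt_def expect_add[OF fin] by simp
  ultimately show ?thesis unfolding eq by linarith
qed

lemma mean_opt_convergent:
  assumes c: "0 \<le> c" shows "convergent (mean_opt c)"
proof (rule convergent_if_approximable)
  fix \<epsilon> :: real assume \<epsilon>: "\<epsilon> > 0"
  let ?M = "c * real K * ((B2 - B1)\<^sup>2 + coef_bound\<^sup>2)"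
  obtain q :: nat where q: "?M / \<epsilon> < real q" using reals_Archimedean2 by blast
  have M: "0 \<le> ?M" using c by simp
  have q0: "0 < q" using q M \<epsilon> by (metis divide_nonneg_pos not_less of_nat_0 gr0I)
  let ?w = "\<lambda>n. (\<Sum>t<q\<^sup>2. mean_descent c (1 / real q) t n) / real (q\<^sup>2)"
  have "convergent (\<lambda>n. (1 / real (q\<^sup>2)) * (\<Sum>t<q\<^sup>2. mean_descent c (1 / real q) t n))"
    by (intro convergent_mult convergent_const convergent_sum mean_descent_convergent c)
  then have conv: "convergent ?w" by simp
  have "?M / (2 * real q) \<le> \<epsilon>"
  proof -
    have "?M \<le> \<epsilon> * real q" using q \<epsilon> by (simp add: field_simps)
    also have "\<dots> \<le> \<epsilon> * (2 * real q)" using \<epsilon> by (intro mult_left_mono) auto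
    finally show ?thesis using q0 by (simp add: divide_le_eq)
  qed
  note bound = this
  have "\<forall>\<^sub>F n in sequentially. \<bar>mean_opt c n - ?w n\<bar> \<le> \<epsilon>"
    using eventually_ge_at_top[of K]
  proof eventually_elim
    case (elim n)
    then show ?case using bound mean_opt_near_descent[OF c _ q0, of n] by linarith
  qed
  then show "\<exists>w. convergent w \<and> (\<forall>\<^sub>F n in sequentially. \<bar>mean_opt c n - w n\<bar> \<le> \<epsilon>)"
    using conv by (intro exI[of _ ?w] conjI)
qed

text \<open>
  A genuine limit for \<open>c \<ge> 0\<close>, by \<open>mean_opt_convergent\<close>.
\<close>

definition limit_opt :: "real \<Rightarrow> real" where
  "limit_opt c = lim (mean_opt c)"

lemma mean_opt_tendsto: "0 \<le> c \<Longrightarrow> mean_opt c \<longlonglongrightarrow> limit_opt c"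
  unfolding limit_opt_def using mean_opt_convergent convergent_LIMSEQ_iff by blast

lemma instance_opt_nonneg: "0 \<le> instance_opt c n C"
  by (simp add: instance_opt_def opt_nonneg)

lemma mean_opt_nonneg: "0 \<le> mean_opt c n"
  unfolding mean_opt_def by (intro integral_nonneg_AE) (simp add: instance_opt_nonneg)

lemma limit_opt_nonneg: "0 \<le> c \<Longrightarrow> 0 \<le> limit_opt c"
  by (rule LIMSEQ_le_const[OF mean_opt_tendsto]) (auto simp: mean_opt_nonneg)

lemma limit_opt_0: "limit_opt 0 = 0"
proof -
  have "mean_opt 0 n = 0" for n
    by (simp add: mean_opt_def instance_opt_def[abs_def] num_constraints_def opt_empty)
  then have "mean_opt 0 = (\<lambda>_. 0)" by blast
  then have "mean_opt 0 \<longlonglongrightarrow> 0" by (simp only: tendsto_const)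
  moreover have "mean_opt 0 \<longlonglongrightarrow> limit_opt 0" by (rule mean_opt_tendsto) simp
  ultimately show ?thesis by (rule LIMSEQ_unique[symmetric])
qed

lemma opt_depends_on: "depends_on J (\<lambda>C. opt J C / x)"
  unfolding depends_on_def using opt_cong[of J] by metis

text \<open>
  Couple the densities by taking the first constraints of the denser instance.
\<close>

lemma limit_opt_mono:
  assumes "0 \<le> c" "c \<le> d" shows "limit_opt c \<le> limit_opt d"
proof (rule LIMSEQ_le[OF mean_opt_tendsto mean_opt_tendsto])
  have "mean_opt c n \<le> mean_opt d n" if n: "K \<le> n" for n
  proof -
    let ?I = "{..<num_constraints c n}" and ?J = "{..<num_constraints d n}"
    have "c * real n \<le> d * real n" using assms by (intro mult_right_mono) auto
    then have "num_constraints c n \<le> num_constraints d n"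
      unfolding num_constraints_def by (intro nat_mono floor_mono)
    then have IJ: "?I \<subseteq> ?J" by simp
    have "mean_opt c n = expect (iid ?J (law n)) (\<lambda>C. opt ?I C / real n)"
      unfolding mean_opt_def instance_law_def instance_opt_def
      by (rule expect_iid_subset[symmetric, OF _ IJ opt_depends_on]) simp
    also have "\<dots> \<le> mean_opt d n"
      unfolding mean_opt_def instance_law_def instance_opt_def
      by (intro expect_mono finite_set_iid_law n divide_right_mono opt_mono IJ) auto
    finally show ?thesis .
  qed
  then show "\<exists>N. \<forall>n\<ge>N. mean_opt c n \<le> mean_opt d n" by blast
  show "0 \<le> c" "0 \<le> d" using assms by simp_all
qed

section \<open>Concentration and the threshold\<close>

lemma variance_instance_opt:
  assumes c: "0 \<le> c" and n: "K \<le> n"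
  shows "expect (instance_law c n) (\<lambda>C. (instance_opt c n C - mean_opt c n)\<^sup>2) \<le> c * pen_bound\<^sup>2 / real n"
proof -
  let ?J = "{..<num_constraints c n}"
  have n0: "real n > 0" using n K_pos by simp
  have "expect (instance_law c n) (\<lambda>C. (instance_opt c n C - mean_opt c n)\<^sup>2)
     \<le> real (card ?J) * (pen_bound / real n)\<^sup>2"
    unfolding mean_opt_def instance_law_def
  proof (rule variance_iid_le)
    show "finite (set_pmf (law n))" by (rule finite_set_law[OF n])
    show "0 \<le> pen_bound / real n" using pen_bound_nonneg by simp
    fix C j y assume "C ` ?J \<subseteq> set_pmf (law n)" "j \<in> ?J" "y \<in> set_pmf (law n)"
    then have "C j \<in> constrs {..<n}" "y \<in> constrs {..<n}" "j \<in> ?J" using set_law[OF n] by auto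
    then have "\<bar>opt ?J (C(j := y)) - opt ?J C\<bar> \<le> pen_bound"
      by (intro opt_update_diff constrsD(3)[of _ "{..<n}"]) auto
    then have "\<bar>opt ?J (C(j := y)) - opt ?J C\<bar> / real n \<le> pen_bound / real n"
      by (rule divide_right_mono) simp
    then show "\<bar>instance_opt c n (C(j := y)) - instance_opt c n C\<bar> \<le> pen_bound / real n"
      unfolding instance_opt_def by (simp add: diff_divide_distrib[symmetric])
  qed simp
  also have "\<dots> \<le> (c * real n) * (pen_bound / real n)\<^sup>2"
    using num_constraints_le[OF c] by (intro mult_right_mono) auto
  also have "\<dots> = c * pen_bound\<^sup>2 / real n" using n0 by (simp add: power2_eq_square)
  finally show ?thesis .
qed

lemma prob_lp_value_eq:
  assumes "K \<le> n"
  shows "measure_pmf.prob (random_klsat repl K R n c) {C. P (lp_value K a b B1 B2 n c C / real n)}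
    = measure_pmf.prob (instance_law c n) {C. P (instance_opt c n C)}"
proof -
  have "{C. P (lp_value K a b B1 B2 n c C / real n)} \<inter> set_pmf (instance_law c n)
      = {C. P (instance_opt c n C)} \<inter> set_pmf (instance_law c n)"
  proof -
    have "lp_value K a b B1 B2 n c C / real n = instance_opt c n C" if "C \<in> set_pmf (instance_law c n)" for C
    proof -
      have "C j \<in> constrs {..<n}" if "j < num_constraints c n" for j
        using instance_law_D[OF assms \<open>C \<in> set_pmf (instance_law c n)\<close>] that by blast
      then show ?thesis unfolding instance_opt_def by (simp only: lp_value_eq_opt)
    qed
    then show ?thesis by auto
  qed
  then show ?thesis
    unfolding random_klsat_eq_iid[OF assms] instance_law_def[symmetric]
    using measure_Int_set_pmf[of "instance_law c n" "{C. P (lp_value K a b B1 B2 n c C / real n)}"]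
      measure_Int_set_pmf[of "instance_law c n" "{C. P (instance_opt c n C)}"] by presburger
qed

lemma prob_large_tendsto_0:
  assumes c: "0 \<le> c" and lim: "limit_opt c = 0" and \<epsilon>: "\<epsilon> > 0"
  shows "(\<lambda>n. measure_pmf.prob (random_klsat repl K R n c) {C. lp_value K a b B1 B2 n c C / real n > \<epsilon>}) \<longlonglongrightarrow> 0"
proof (rule tendsto_sandwich[where f = "\<lambda>_. 0" and h = "\<lambda>n. mean_opt c n / \<epsilon>"])
  let ?P = "\<lambda>n. measure_pmf.prob (random_klsat repl K R n c) {C. lp_value K a b B1 B2 n c C / real n > \<epsilon>}"
  show "\<forall>\<^sub>F n in sequentially. ?P n
     \<le> mean_opt c n / \<epsilon>"
    using eventually_ge_at_top[of K]
  proof eventually_elim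
    case (elim n)
    show ?case unfolding prob_lp_value_eq[OF elim, of c "\<lambda>v. v > \<epsilon>"] mean_opt_def
      by (rule prob_le_expect[OF finite_set_instance_law[OF elim] \<epsilon>]) (auto intro: instance_opt_nonneg)
  qed
  show "(\<lambda>n. mean_opt c n / \<epsilon>) \<longlonglongrightarrow> 0"
    using tendsto_divide[OF mean_opt_tendsto[OF c] tendsto_const[of \<epsilon>]] lim \<epsilon> by simp
  show "\<forall>\<^sub>F n in sequentially. 0 \<le> ?P n"
    by (simp add: measure_nonneg)
  show "(\<lambda>_. 0) \<longlonglongrightarrow> (0::real)" by (rule tendsto_const)
qed

text \<open>
  Chebyshev's inequality: the mean is eventually above \<open>3/4\<close> of its limit, and a deviation by \<open>1/4\<close>
  of the limit has probability of order \<open>1/n\<close>.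
\<close>

lemma prob_bounded_below_tendsto_1:
  assumes c: "0 \<le> c" and lim: "0 < limit_opt c"
  shows "(\<lambda>n. measure_pmf.prob (random_klsat repl K R n c)
    {C. lp_value K a b B1 B2 n c C / real n \<ge> limit_opt c / 2}) \<longlonglongrightarrow> 1"
proof -
  define \<delta> where "\<delta> = limit_opt c / 4"
  have \<delta>: "0 < \<delta>" using lim by (simp add: \<delta>_def)
  have "\<forall>\<^sub>F n in sequentially. 3 * \<delta> < mean_opt c n"
    using mean_opt_tendsto[OF c] by (rule order_tendstoD) (use lim in \<open>simp add: \<delta>_def\<close>)
  then have lower: "\<forall>\<^sub>F n in sequentially. 1 - c * pen_bound\<^sup>2 / real n / \<delta>\<^sup>2 \<le>
     measure_pmf.prob (random_klsat repl K R n c) {C. lp_value K a b B1 B2 n c C / real n \<ge> limit_opt c / 2}"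
    using eventually_ge_at_top[of K]
  proof eventually_elim
    case (elim n)
    let ?p = "instance_law c n" and ?A = "{C. instance_opt c n C \<ge> limit_opt c / 2}"
    have "measure_pmf.prob ?p (- ?A) \<le> expect ?p (\<lambda>C. (instance_opt c n C - mean_opt c n)\<^sup>2) / \<delta>\<^sup>2"
    proof (rule prob_le_expect[OF finite_set_instance_law[OF elim(2)]])
      fix C assume "C \<in> - ?A"
      then have "\<delta> \<le> mean_opt c n - instance_opt c n C" using elim(1) by (simp add: \<delta>_def)
      then have "\<bar>\<delta>\<bar> \<le> \<bar>instance_opt c n C - mean_opt c n\<bar>" using \<delta> by linarith
      then show "\<delta>\<^sup>2 \<le> (instance_opt c n C - mean_opt c n)\<^sup>2" by (simp add: abs_le_square_iff)
    qed (use \<delta> in auto)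
    also have "\<dots> \<le> c * pen_bound\<^sup>2 / real n / \<delta>\<^sup>2"
      using variance_instance_opt[OF c elim(2)] by (rule divide_right_mono) simp
    finally show ?case
      unfolding prob_lp_value_eq[OF elim(2), of c "\<lambda>v. v \<ge> limit_opt c / 2"]
      using measure_pmf.prob_compl[of ?A ?p] by (simp add: Compl_eq_Diff_UNIV)
  qed
  have "(\<lambda>n. 1 - (c * pen_bound\<^sup>2 / real n) / \<delta>\<^sup>2) \<longlonglongrightarrow> 1 - 0 / \<delta>\<^sup>2"
    using \<delta> by (intro tendsto_intros lim_const_over_n) auto
  then have lim1: "(\<lambda>n. 1 - c * pen_bound\<^sup>2 / real n / \<delta>\<^sup>2) \<longlonglongrightarrow> 1" by simp
  show ?thesis
    by (rule tendsto_sandwich[OF lower _ lim1 tendsto_const]) simp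
qed

theorem threshold_exists:
  "\<exists>cstar :: ereal. 0 \<le> cstar \<and> (\<forall>c\<ge>0. ereal c < cstar \<longrightarrow> limit_opt c = 0) \<and>
     (\<forall>c. cstar < ereal c \<longrightarrow> 0 < limit_opt c)"
proof (intro exI conjI allI impI)
  define Z where "Z = {c. 0 \<le> c \<and> limit_opt c = 0}"
  let ?cstar = "SUP c\<in>Z. ereal c"
  have ge: "ereal c \<le> ?cstar" if "0 \<le> c" "limit_opt c = 0" for c
    by (rule SUP_upper) (use that in \<open>simp add: Z_def\<close>)
  show nonneg: "0 \<le> ?cstar" using ge[of 0] limit_opt_0 by (simp add: zero_ereal_def)
  show "limit_opt c = 0" if c: "0 \<le> c" "ereal c < ?cstar" for c
  proof -
    have "\<exists>d\<in>Z. ereal c < ereal d" using c(2) unfolding less_SUP_iff .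
    then obtain d where "d \<in> Z" "c < d" by auto
    then show ?thesis using limit_opt_mono[of c d] limit_opt_nonneg[of c] c(1) by (simp add: Z_def)
  qed
  show "0 < limit_opt c" if "?cstar < ereal c" for c
  proof (rule ccontr)
    assume *: "\<not> 0 < limit_opt c"
    have "0 \<le> c" using le_less_trans[OF nonneg that] by simp
    then have "ereal c \<le> ?cstar" using ge[of c] limit_opt_nonneg[of c] * by simp
    then show False using that by simp
  qed
qed

end

text \<open>
  One term of the exponential series.
\<close>

lemma power_self_le_exp_fact: "real k ^ k \<le> exp (real k) * fact k"
proof -
  have s: "summable (\<lambda>n. real k ^ n /\<^sub>R fact n)" by (rule summable_exp_generic)
  have "real k ^ k /\<^sub>R fact k = (\<Sum>n\<in>{k}. real k ^ n /\<^sub>R fact n)" by simp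
  also have "\<dots> \<le> (\<Sum>n. real k ^ n /\<^sub>R fact n)"
    by (rule sum_le_suminf[OF s]) auto
  also have "\<dots> = exp (real k)" by (simp add: exp_def)
  finally show ?thesis by (simp add: field_simps)
qed

text \<open>
  The estimate \<open>(N choose k) \<le> (e N / k)\<^sup>k\<close>, written without division so that \<open>k = 0\<close> is included.
\<close>

lemma binomial_power_self_le: "real (N choose k) * real k ^ k \<le> exp (real k) * real N ^ k"
proof -
  have "real ((N choose k) * fact k) \<le> real (N ^ k)"
    by (subst of_nat_le_iff) (rule binomial_fact_pow)
  then have *: "real (N choose k) * fact k \<le> real N ^ k" by simp
  have "real (N choose k) * real k ^ k \<le> real (N choose k) * (exp (real k) * fact k)"
    by (intro mult_left_mono power_self_le_exp_fact) auto
  also have "\<dots> = exp (real k) * (real (N choose k) * fact k)" by (simp add: mult_ac)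
  also have "\<dots> \<le> exp (real k) * real N ^ k" by (intro mult_left_mono *) auto
  finally show ?thesis .
qed

context lsat
begin

section \<open>Sparse instances under Condition A\<close>

text \<open>
  Fewer variables than a hypertree with the same number of constraints would have.
\<close>

definition crowded :: "nat set \<Rightarrow> (nat \<Rightarrow> constr) \<Rightarrow> bool" where
  "crowded J C \<longleftrightarrow> J \<noteq> {} \<and> card (verts J C) \<le> (K - 1) * card J"

text \<open>
  Otherwise every constraint shares at least two variables.  Each variable either occurs in two
  constraints or is private to one, so counting every constraint's variables once and its private
  variables once more reaches each variable at least twice.  The count is at most \<open>K + (K - 2)\<close> per
  constraint, which makes the whole family crowded.
\<close>

lemma leaf_exists:
  assumes J: "finite J" "C ` J \<subseteq> constrs U" "J \<noteq> {}" and nc: "\<not> crowded J C"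
  shows "\<exists>j\<in>J. card (set (fst (C j)) \<inter> verts (J - {j}) C) \<le> 1"
proof (rule ccontr)
  assume "\<not> ?thesis"
  then have two: "2 \<le> card (set (fst (C j)) \<inter> verts (J - {j}) C)" if "j \<in> J" for j
    using that by force
  let ?s = "\<lambda>j. set (fst (C j))" and ?p = "\<lambda>j. set (fst (C j)) - verts (J - {j}) C"
  let ?V = "verts J C"
  have fV: "finite ?V" by (rule finite_verts[OF J(1)])
  have pointwise: "2 \<le> (\<Sum>j\<in>J. of_bool (i \<in> ?s j)) + (\<Sum>j\<in>J. of_bool (i \<in> ?p j) :: nat)" if i: "i \<in> ?V" for i
  proof -
    obtain j where j: "j \<in> J" "i \<in> ?s j" using i by (auto simp: verts_def)
    show ?thesis
    proof (cases "i \<in> verts (J - {j}) C")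
      case True
      then obtain l where l: "l \<in> J" "l \<noteq> j" "i \<in> ?s l" by (auto simp: verts_def)
      have "(\<Sum>x\<in>{j, l}. of_bool (i \<in> ?s x)) \<le> (\<Sum>x\<in>J. of_bool (i \<in> ?s x) :: nat)"
        using j l J(1) by (intro sum_mono2) auto
      moreover have "(\<Sum>x\<in>{j, l}. of_bool (i \<in> ?s x)) = (2::nat)" using j l by simp
      ultimately show ?thesis by linarith
    next
      case False
      have "of_bool (i \<in> ?s j) \<le> (\<Sum>x\<in>J. of_bool (i \<in> ?s x) :: nat)"
        using j J(1) by (intro member_le_sum) auto
      moreover have "of_bool (i \<in> ?p j) \<le> (\<Sum>x\<in>J. of_bool (i \<in> ?p x) :: nat)"
        using j(1) J(1) by (intro member_le_sum) auto
      ultimately show ?thesis using j False by simp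
    qed
  qed
  have count: "(\<Sum>i\<in>?V. of_bool (i \<in> A)) = card A" if "A \<subseteq> ?V" for A :: "nat set"
  proof -
    have "(\<Sum>i\<in>?V. of_bool (i \<in> A)) = (\<Sum>i\<in>A. 1 :: nat)"
      using that fV by (intro sum.mono_neutral_cong_right) auto
    then show ?thesis by simp
  qed
  have sub: "?s j \<subseteq> ?V" "?p j \<subseteq> ?V" if "j \<in> J" for j using that by (auto simp: verts_def)
  have "2 * card ?V = (\<Sum>i\<in>?V. 2)" by simp
  also have "\<dots> \<le> (\<Sum>i\<in>?V. (\<Sum>j\<in>J. of_bool (i \<in> ?s j)) + (\<Sum>j\<in>J. of_bool (i \<in> ?p j)))"
    by (rule sum_mono) (rule pointwise)
  also have "\<dots> = (\<Sum>j\<in>J. \<Sum>i\<in>?V. of_bool (i \<in> ?s j)) + (\<Sum>j\<in>J. \<Sum>i\<in>?V. of_bool (i \<in> ?p j))"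
    unfolding sum.distrib by (intro arg_cong2[where f = "(+)"] sum.swap)
  also have "\<dots> = (\<Sum>j\<in>J. card (?s j)) + (\<Sum>j\<in>J. card (?p j))"
    by (intro arg_cong2[where f = "(+)"] sum.cong refl count sub)
  also have "\<dots> = (\<Sum>j\<in>J. card (?s j) + card (?p j))" by (simp add: sum.distrib)
  also have "\<dots> \<le> (\<Sum>j\<in>J. 2 * (K - 1))"
  proof (rule sum_mono)
    fix j assume j: "j \<in> J"
    have "C j \<in> constrs U" using j J(2) by blast
    then have "card (?s j) \<le> K" using constrsD(1) card_length by metis
    moreover have "card (?p j) + card (?s j \<inter> verts (J - {j}) C) = card (?s j)"
      by (subst card_Un_disjoint[symmetric]) (auto intro: arg_cong[where f = card])
    ultimately show "card (?s j) + card (?p j) \<le> 2 * (K - 1)" using two[OF j] by linarith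
  qed
  also have "\<dots> = 2 * ((K - 1) * card J)" by simp
  finally show False using nc J(3) by (simp add: crowded_def)
qed

text \<open>
  Remove a leaf, satisfy the rest, and extend: at most one variable of the leaf is already
  fixed, and Condition A lets the other variables be chosen to suit it.  A single constraint that is not
  crowded has \<open>K\<close> distinct variables, so they can be set independently.
\<close>

lemma satisfiable_if_not_crowded:
  assumes A: "condition_A K R a b B1 B2" and "finite J" "C ` J \<subseteq> constrs U"
    "\<And>I. I \<subseteq> J \<Longrightarrow> \<not> crowded I C"
  shows "\<exists>x\<in>box. \<forall>j\<in>J. pen (C j) x = 0"
  using assms(2-4)
proof (induction J rule: finite_psubset_induct)
  case (psubset J)
  show ?case
  proof (cases "J = {}")
    case True
    then show ?thesis using const_in_box by blast
  next
    case False
    obtain j where j: "j \<in> J" and leaf: "card (set (fst (C j)) \<inter> verts (J - {j}) C) \<le> 1"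
      using leaf_exists[OF psubset.hyps psubset.prems(1) False psubset.prems(2)] by blast
    have "\<exists>x\<in>box. \<forall>l\<in>J - {j}. pen (C l) x = 0"
    proof (rule psubset.IH)
      show "J - {j} \<subset> J" using j by blast
      show "C ` (J - {j}) \<subseteq> constrs U" using psubset.prems(1) by blast
      show "\<not> crowded I C" if "I \<subseteq> J - {j}" for I using psubset.prems(2)[of I] that by blast
    qed
    then obtain x where x: "x \<in> box" and sat: "\<And>l. l \<in> J - {j} \<Longrightarrow> pen (C l) x = 0" by blast
    let ?s = "fst (C j)" and ?r = "snd (C j)" and ?W = "set (fst (C j)) \<inter> verts (J - {j}) C"
    have Cj: "C j \<in> constrs U" using j psubset.prems(1) by blast
    note s = constrsD(1,3)[OF Cj]
    have "\<not> crowded {j} C" using psubset.prems(2)[of "{j}"] j by blast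
    then have "K \<le> card (set ?s)" using K_pos by (simp add: crowded_def verts_def)
    then have dist: "distinct ?s" using s(1) card_length[of ?s] by (intro card_distinct) simp
    \<comment> \<open>The slot of the shared variable, or any slot if nothing is shared.\<close>
    obtain k where k: "k < K" "?W \<subseteq> {?s ! k}"
    proof (cases "?W = {}")
      case True
      then show ?thesis using that[of 0] K_pos by simp
    next
      case False
      then have "card ?W = 1" using leaf by (simp add: le_Suc_eq)
      then obtain w where w: "?W = {w}" by (rule card_1_singletonE)
      then have "w \<in> set ?s" by blast
      then obtain k where "k < K" "?s ! k = w" using s(1) by (metis in_set_conv_nth)
      then show ?thesis using that[of k] w by simp
    qed
    have "x (?s ! k) \<in> {B1..B2}" using x by (simp add: box_def)
    then obtain y where y: "\<forall>k'<K. y k' \<in> {B1..B2}" "y k = x (?s ! k)"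
        "(\<Sum>k'<K. a ?r k' * y k') \<le> b ?r"
      using A[unfolded condition_A_def, rule_format, OF s(2) k(1), of "x (?s ! k)"] by blast
    define pos where "pos i = (SOME k'. k' < K \<and> ?s ! k' = i)" for i
    have pos: "pos (?s ! k') = k'" if "k' < K" for k'
    proof -
      have "pos (?s ! k') < K \<and> ?s ! pos (?s ! k') = ?s ! k'"
        unfolding pos_def by (rule someI[of _ k']) (use that in simp)
      then show ?thesis using nth_eq_iff_index_eq[OF dist, of "pos (?s ! k')" k'] s(1) that by simp
    qed
    define x' where "x' i = (if i \<in> set ?s then y (pos i) else x i)" for i
    have x'_nth: "x' (?s ! k') = y k'" if "k' < K" for k'
      using that s(1) pos[OF that] by (simp add: x'_def)
    have "x' \<in> box"
    proof -
      have "x' i \<in> {B1..B2}" for i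
      proof (cases "i \<in> set ?s")
        case True
        then obtain k' where "k' < K" "?s ! k' = i" using s(1) by (metis in_set_conv_nth)
        then show ?thesis using x'_nth[of k'] y(1) by auto
      next
        case False
        then show ?thesis using x by (simp add: x'_def box_def)
      qed
      then show ?thesis by (simp add: box_def)
    qed
    moreover have "pen (C l) x' = 0" if l: "l \<in> J" for l
    proof (cases "l = j")
      case True
      have "slack (C j) x' = (\<Sum>k'<K. a ?r k' * y k') - b ?r"
        unfolding slack_def using x'_nth by simp
      then show ?thesis using y(3) True by (simp add: pen_def)
    next
      case False
      have same: "x' i = x i" if i: "i \<in> set (fst (C l))" for i
      proof (cases "i \<in> set ?s")
        case True
        then have "i \<in> ?W" using i l False by (auto simp: verts_def)
        then have "i = ?s ! k" using k(2) by blast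
        then show ?thesis using x'_nth[OF k(1)] y(2) by simp
      qed (simp add: x'_def)
      have "C l \<in> constrs U" using l psubset.prems(1) by blast
      then have "pen (C l) x' = pen (C l) x" using same by (rule slack_cong(2))
      then show ?thesis using sat l False by simp
    qed
    ultimately show ?thesis by blast
  qed
qed

text \<open>
  Delete one constraint from every crowded subfamily; what remains is satisfiable.
\<close>

lemma opt_le_card_crowded:
  assumes A: "condition_A K R a b B1 B2" and J: "finite J" "C ` J \<subseteq> constrs U"
  shows "opt J C \<le> pen_bound * real (card {I. I \<subseteq> J \<and> crowded I C})"
proof -
  let ?Bad = "{I. I \<subseteq> J \<and> crowded I C}"
  \<comment> \<open>One constraint to give up in each crowded subfamily.\<close>
  define pick where "pick I = (SOME j. j \<in> I)" for I :: "nat set"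
  define X where "X = pick ` ?Bad"
  have finBad: "finite ?Bad" by (rule finite_subset[of _ "Pow J"]) (use J in auto)
  have pick: "pick I \<in> I" if "crowded I C" for I
  proof -
    have "\<exists>j. j \<in> I" using that unfolding crowded_def by blast
    then show ?thesis unfolding pick_def by (rule someI_ex)
  qed
  have XJ: "X \<subseteq> J" unfolding X_def using pick by blast
  have "\<exists>x\<in>box. \<forall>j\<in>J - X. pen (C j) x = 0"
  proof (rule satisfiable_if_not_crowded[OF A])
    show "\<not> crowded I C" if "I \<subseteq> J - X" for I
      using that pick[of I] unfolding X_def by blast
    show "C ` (J - X) \<subseteq> constrs U" using J(2) by blast
  qed (use J in auto)
  then obtain x where x: "x \<in> box" "\<And>j. j \<in> J - X \<Longrightarrow> pen (C j) x = 0" by blast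
  have "opt J C \<le> cost J C x" by (rule opt_le_cost[OF x(1)])
  also have "\<dots> = (\<Sum>j\<in>X. pen (C j) x)"
    unfolding cost_def using x(2) XJ J(1) by (intro sum.mono_neutral_right) auto
  also have "\<dots> \<le> (\<Sum>j\<in>X. pen_bound)"
  proof (rule sum_mono)
    fix j assume "j \<in> X"
    then have "C j \<in> constrs U" using XJ J(2) by blast
    then show "pen (C j) x \<le> pen_bound" by (intro pen_le x(1) constrsD(3))
  qed
  also have "\<dots> = pen_bound * real (card X)" by simp
  also have "\<dots> \<le> pen_bound * real (card ?Bad)"
    unfolding X_def using card_image_le[OF finBad, of pick] by (intro mult_left_mono pen_bound_nonneg) simp
  finally show ?thesis .
qed

text \<open>
  A union bound over the sets of \<open>v\<close> variables that could contain all the variables used.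
\<close>

lemma expect_crowded:
  assumes n: "K \<le> n" and I: "finite I" "I \<noteq> {}" and v: "(K - 1) * card I \<le> n"
  defines "v \<equiv> (K - 1) * card I"
  shows "expect (iid I (law n)) (\<lambda>C. of_bool (crowded I C))
    \<le> real (n choose v) * (real v / real n) ^ (K * card I)"
proof -
  let ?T = "{V. V \<subseteq> {..<n} \<and> card V = v}"
  let ?E = "expect (iid I (law n))"
  have finT: "finite ?T" by (rule finite_subset[of _ "Pow {..<n}"]) auto
  note fin = finite_set_iid_law[OF n I(1)]
  have "?E (\<lambda>C. of_bool (crowded I C)) \<le> ?E (\<lambda>C. \<Sum>V\<in>?T. \<Prod>j\<in>I. of_bool (set (fst (C j)) \<subseteq> V))"
  proof (rule expect_mono[OF fin])
    fix C assume "C \<in> set_pmf (iid I (law n))"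
    then have C: "C ` I \<subseteq> constrs {..<n}" by (rule iid_law_D[OF n I(1)])
    show "of_bool (crowded I C) \<le> (\<Sum>V\<in>?T. \<Prod>j\<in>I. of_bool (set (fst (C j)) \<subseteq> V) :: real)"
    proof (cases "crowded I C")
      case True
      then have "card (verts I C) \<le> v" by (simp add: crowded_def v_def)
      then obtain V where V: "verts I C \<subseteq> V" "V \<subseteq> {..<n}" "card V = v"
        using exists_subset_between[of "verts I C" v "{..<n}"] verts_subset[OF C] v by (auto simp: v_def)
      have "1 = (\<Prod>j\<in>I. of_bool (set (fst (C j)) \<subseteq> V) :: real)"
        using V(1) by (intro prod.neutral[symmetric]) (auto simp: verts_def)
      also have "\<dots> \<le> (\<Sum>V\<in>?T. \<Prod>j\<in>I. of_bool (set (fst (C j)) \<subseteq> V))"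
        using V finT by (intro member_le_sum[of V]) (auto intro: prod_nonneg)
      finally show ?thesis using True by simp
    next
      case False
      then show ?thesis by (auto intro!: sum_nonneg prod_nonneg)
    qed
  qed
  also have "\<dots> = (\<Sum>V\<in>?T. ?E (\<lambda>C. \<Prod>j\<in>I. of_bool (set (fst (C j)) \<subseteq> V)))"
    by (rule expect_sum[OF fin])
  also have "\<dots> \<le> (\<Sum>V\<in>?T. ((real v / real n) ^ K) ^ card I)"
  proof (rule sum_mono)
    fix V assume V: "V \<in> ?T"
    have "?E (\<lambda>C. \<Prod>j\<in>I. of_bool (set (fst (C j)) \<subseteq> V))
       = (\<Prod>j\<in>I. expect (law n) (\<lambda>c. of_bool (set (fst c) \<subseteq> V)))"
      by (rule expectation_prod_Pi_pmf[OF I(1)]) (auto intro: integrable_measure_pmf_finite finite_set_law[OF n])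
    also have "\<dots> = (real (ntuples v) / real (ntuples n)) ^ card I"
      using expect_law_inside[OF n, of V] V by simp
    also have "\<dots> \<le> ((real v / real n) ^ K) ^ card I"
      using v by (intro power_mono ntuples_ratio_le[OF n]) (auto simp: v_def)
    finally show "?E (\<lambda>C. \<Prod>j\<in>I. of_bool (set (fst (C j)) \<subseteq> V)) \<le> ((real v / real n) ^ K) ^ card I" .
  qed
  also have "\<dots> = real (card ?T) * ((real v / real n) ^ K) ^ card I" by simp
  also have "card ?T = n choose v" using n_subsets[of "{..<n}" v] by simp
  finally show ?thesis by (simp add: power_mult)
qed

text \<open>
  Splitting the exponent as \<open>K s = v + s\<close>, the factor \<open>(v/n)\<^sup>v\<close> compensates the choice of the
  variables, and the factor \<open>(v/n)\<^sup>s\<close>, of order \<open>(s/n)\<^sup>s\<close>, the choice of the constraints.  What is left is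
  exponential in \<open>s\<close> with a base proportional to the density.
\<close>

lemma crowded_count_bound:
  assumes n: "0 < n" and s: "0 < s" and m: "real m \<le> c * real n" and c: "0 \<le> c"
  defines "v \<equiv> (K - 1) * s"
  shows "real (m choose s) * (real (n choose v) * (real v / real n) ^ (K * s)) \<le> (exp (real K) * c * real K) ^ s"
proof -
  have Ks: "K * s = v + s"
    unfolding v_def using K_pos by (metis Suc_pred' add.commute less_eq_Suc_le mult_Suc One_nat_def)
  have n': "real n > 0" and s': "real s > 0" using n s by auto
  have 1: "real (n choose v) * (real v / real n) ^ v \<le> exp (real v)"
  proof -
    have "real (n choose v) * (real v / real n) ^ v = real (n choose v) * real v ^ v / real n ^ v"
      by (simp add: power_divide)
    also have "\<dots> \<le> exp (real v) * real n ^ v / real n ^ v"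
      by (intro divide_right_mono binomial_power_self_le) auto
    finally show ?thesis using n' by simp
  qed
  have 2: "real (m choose s) * (real v / real n) ^ s \<le> exp (real s) * (c * real K) ^ s"
  proof -
    have "real (m choose s) * (real v / real n) ^ s = real (m choose s) * real s ^ s * (real (K - 1) / real n) ^ s"
      by (simp add: v_def power_mult_distrib power_divide)
    also have "\<dots> \<le> exp (real s) * real m ^ s * (real (K - 1) / real n) ^ s"
      by (intro mult_right_mono binomial_power_self_le) auto
    also have "\<dots> = exp (real s) * (real m / real n * real (K - 1)) ^ s"
      by (simp add: power_mult_distrib power_divide)
    also have "\<dots> \<le> exp (real s) * (c * real K) ^ s"
      using m n' c by (intro mult_left_mono power_mono mult_mono) (auto simp: divide_le_eq)
    finally show ?thesis .
  qed
  have "real (m choose s) * (real (n choose v) * (real v / real n) ^ (K * s))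
     = (real (n choose v) * (real v / real n) ^ v) * (real (m choose s) * (real v / real n) ^ s)"
    unfolding Ks power_add by (simp only: mult_ac)
  also have "\<dots> \<le> exp (real v) * (exp (real s) * (c * real K) ^ s)"
    by (intro mult_mono 1 2) auto
  also have "\<dots> = exp (real (K * s)) * (c * real K) ^ s"
    unfolding Ks by (simp add: exp_add mult_ac)
  also have "exp (real (K * s)) = exp (real K) ^ s"
    by (simp add: exp_of_nat_mult[symmetric] mult.commute)
  finally show ?thesis by (simp add: power_mult_distrib mult_ac)
qed

text \<open>
  The density is chosen so that the expected number of crowded subfamilies of size \<open>s\<close> is at
  most \<open>2\<^bsup>-s\<^esup>\<close>.
\<close>

lemma expect_card_crowded:
  assumes n: "K \<le> n" and J: "finite J" and m: "real (card J) \<le> real n / (2 * exp (real K) * real K)"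
  shows "expect (iid J (law n)) (\<lambda>C. real (card {I. I \<subseteq> J \<and> crowded I C})) \<le> 1"
proof -
  let ?b = "\<lambda>s. real (n choose ((K - 1) * s)) * (real ((K - 1) * s) / real n) ^ (K * s)"
  let ?E = "expect (iid J (law n))"
  define c where "c = 1 / (2 * exp (real K) * real K)"
  let ?T = "Pow J - {{}}"
  have n0: "0 < n" using n K_pos by simp
  have c: "0 \<le> c" "exp (real K) * c * real K = 1 / 2" using K_pos by (auto simp: c_def)
  have mc: "real (card J) \<le> c * real n" using m by (simp add: c_def)
  note fin = finite_set_iid_law[OF n J]
  have finT: "finite ?T" using J by simp
  have "?E (\<lambda>C. real (card {I. I \<subseteq> J \<and> crowded I C})) = ?E (\<lambda>C. \<Sum>I\<in>?T. of_bool (crowded I C))"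
  proof -
    have "real (card {I. I \<subseteq> J \<and> crowded I C}) = (\<Sum>I\<in>?T. of_bool (crowded I C))" for C
    proof -
      have "{I. I \<subseteq> J \<and> crowded I C} = {I\<in>?T. crowded I C}" by (auto simp: crowded_def)
      then show ?thesis using finT by (simp add: of_bool_def sum.If_cases Int_def)
    qed
    then show ?thesis by simp
  qed
  also have "\<dots> = (\<Sum>I\<in>?T. ?E (\<lambda>C. of_bool (crowded I C)))"
    by (rule expect_sum[OF fin])
  also have "\<dots> \<le> (\<Sum>I\<in>?T. ?b (card I))"
  proof (rule sum_mono)
    fix I assume I: "I \<in> ?T"
    have "card I \<le> card J" using I J by (simp add: card_mono)
    then have "real ((K - 1) * card I) \<le> real K * (c * real n)"
      using mc by (simp add: mult_mono)
    also have "\<dots> \<le> 1 * real n"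
    proof -
      have "1 * (real K * c) \<le> exp (real K) * (real K * c)"
        using c(1) by (intro mult_right_mono) auto
      then have "real K * c \<le> 1" using c(2) by (simp add: mult_ac)
      then have "real K * c * real n \<le> 1 * real n" by (intro mult_right_mono) auto
      then show ?thesis by (simp add: mult.assoc)
    qed
    finally have v: "(K - 1) * card I \<le> n" by (simp only: of_nat_le_iff mult_1)
    have "?E (\<lambda>C. of_bool (crowded I C)) = expect (iid I (law n)) (\<lambda>C. of_bool (crowded I C))"
    proof (rule expect_iid_subset[OF J])
      show "depends_on I (\<lambda>C. of_bool (crowded I C) :: real)"
        unfolding depends_on_def
      proof (intro allI impI)
        fix C C' :: "nat \<Rightarrow> constr" assume "\<forall>j\<in>I. C j = C' j"
        then have "verts I C = verts I C'" by (intro verts_cong) blast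
        then show "of_bool (crowded I C) = (of_bool (crowded I C') :: real)" by (simp add: crowded_def)
      qed
    qed (use I in auto)
    also have "\<dots> \<le> ?b (card I)"
      using I J finite_subset by (intro expect_crowded[OF n _ _ v]) auto
    finally show "?E (\<lambda>C. of_bool (crowded I C))
      \<le> ?b (card I)" .
  qed
  also have "\<dots> = (\<Sum>s\<in>{1..card J}. \<Sum>I\<in>{I\<in>?T. card I = s}.
      ?b (card I))"
  proof (rule sum.group[symmetric, OF finT])
    have sizes: "1 \<le> card I \<and> card I \<le> card J" if "I \<in> ?T" for I
    proof -
      have "finite I" using that J finite_subset by blast
      then show ?thesis using that J by (auto simp: card_mono Suc_le_eq card_gt_0_iff)
    qed
    show "card ` ?T \<subseteq> {1..card J}"
      by (intro image_subsetI) (unfold atLeastAtMost_iff, rule sizes)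
  qed simp
  also have "\<dots> = (\<Sum>s\<in>{1..card J}. real (card J choose s) *
      (?b s))"
  proof (rule sum.cong[OF refl])
    fix s assume s: "s \<in> {1..card J}"
    have "{I\<in>?T. card I = s} = {I. I \<subseteq> J \<and> card I = s}" using s by auto
    then show "(\<Sum>I\<in>{I\<in>?T. card I = s}. ?b (card I))
      = real (card J choose s) * (?b s)"
      using n_subsets[OF J, of s] by simp
  qed
  also have "\<dots> \<le> (\<Sum>s\<in>{1..card J}. (1 / 2) ^ s)"
  proof (rule sum_mono)
    fix s assume "s \<in> {1..card J}"
    then have "0 < s" by simp
    from crowded_count_bound[OF n0 this mc c(1)]
    show "real (card J choose s) * (?b s) \<le> (1 / 2) ^ s"
      unfolding c(2) .
  qed
  also have "\<dots> \<le> 1"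
  proof -
    have "(\<Sum>s\<in>{1..N}. (1 / 2) ^ s) = 1 - (1 / 2 :: real) ^ N" for N
      by (induction N) auto
    then show ?thesis by simp
  qed
  finally show ?thesis .
qed

text \<open>
  The expected optimum stays bounded, so it vanishes after division by \<open>n\<close>.
\<close>

theorem condition_A_threshold:
  assumes A: "condition_A K R a b B1 B2"
  shows "limit_opt (1 / (2 * exp (real K) * real K)) = 0"
proof -
  define c where "c = 1 / (2 * exp (real K) * real K)"
  have c: "0 \<le> c" by (simp add: c_def)
  have bound: "mean_opt c n \<le> pen_bound / real n" if n: "K \<le> n" for n
  proof -
    let ?J = "{..<num_constraints c n}"
    note fin = finite_set_iid_law[OF n, of ?J, OF finite_lessThan]
    have "mean_opt c n \<le> expect (iid ?J (law n))
       (\<lambda>C. pen_bound / real n * real (card {I. I \<subseteq> ?J \<and> crowded I C}))"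
      unfolding mean_opt_def instance_law_def
    proof (rule expect_mono[OF fin])
      fix C assume "C \<in> set_pmf (iid ?J (law n))"
      then have C: "C ` ?J \<subseteq> constrs {..<n}" by (rule iid_law_D[OF n finite_lessThan])
      have "opt ?J C / real n \<le> pen_bound * real (card {I. I \<subseteq> ?J \<and> crowded I C}) / real n"
        by (intro divide_right_mono opt_le_card_crowded[OF A _ C]) auto
      then show "instance_opt c n C \<le> pen_bound / real n * real (card {I. I \<subseteq> ?J \<and> crowded I C})"
        by (simp add: instance_opt_def)
    qed
    also have "\<dots> = pen_bound / real n * expect (iid ?J (law n)) (\<lambda>C. real (card {I. I \<subseteq> ?J \<and> crowded I C}))"
      by simp
    also have "\<dots> \<le> pen_bound / real n * 1"
      using num_constraints_le[OF c, of n]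
      by (intro mult_left_mono expect_card_crowded[OF n] divide_nonneg_nonneg pen_bound_nonneg) (auto simp: c_def)
    finally show ?thesis by simp
  qed
  have "limit_opt c \<le> 0"
    by (rule LIMSEQ_le[OF mean_opt_tendsto[OF c] lim_const_over_n]) (use bound in blast)
  then show ?thesis using limit_opt_nonneg[OF c] by (simp add: c_def)
qed


section \<open>Dense instances under Condition B\<close>

lemma everywhere_violated:
  assumes "violated_cubes_cover K R a b B1 B2 l \<nu>" "\<And>k. k < K \<Longrightarrow> y k \<in> {B1..B2}"
  shows "\<exists>r<R. \<nu> \<le> (\<Sum>k<K. a r k * y k) - b r"
  using assms unfolding violated_cubes_cover_def violated_on_def by blast

lemma pen_lipschitz:
  assumes c: "c \<in> constrs U" and close: "\<And>i. i \<in> U \<Longrightarrow> \<bar>x i - y i\<bar> \<le> \<delta>"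
  shows "pen c y - coef_bound * real K * \<delta> \<le> pen c x"
proof -
  have "slack c y - slack c x = (\<Sum>k<K. a (snd c) k * (y (fst c ! k) - x (fst c ! k)))"
    by (simp add: slack_def right_diff_distrib sum_subtractf)
  also have "\<dots> \<le> (\<Sum>k<K. coef_bound * \<delta>)"
  proof (rule sum_mono)
    fix k assume "k \<in> {..<K}"
    then have k: "k < K" by simp
    have "fst c ! k \<in> U" using constrsD(2,4)[OF c] k by blast
    then have "\<bar>y (fst c ! k) - x (fst c ! k)\<bar> \<le> \<delta>" using close by (simp add: abs_minus_commute)
    then have "\<bar>a (snd c) k\<bar> * \<bar>y (fst c ! k) - x (fst c ! k)\<bar> \<le> coef_bound * \<delta>"
      by (intro mult_mono coef_le constrsD(3)[OF c] k coef_bound_nonneg) auto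
    then show "a (snd c) k * (y (fst c ! k) - x (fst c ! k)) \<le> coef_bound * \<delta>"
      by (metis abs_ge_self abs_mult order_trans)
  qed
  finally have "slack c y - slack c x \<le> coef_bound * real K * \<delta>" by (simp add: mult_ac)
  moreover have "0 \<le> coef_bound * real K * \<delta>"
  proof -
    obtain i where i: "i \<in> set (fst c)" using constrs_nonempty[OF c] by (metis ex_in_conv)
    then have "\<bar>x i - y i\<bar> \<le> \<delta>" using constrsD(2)[OF c] by (intro close) auto
    then have "0 \<le> \<delta>" by linarith
    then show ?thesis using coef_bound_nonneg by simp
  qed
  ultimately show ?thesis unfolding pen_def by linarith
qed

definition net :: "nat \<Rightarrow> real set" where
  "net N = (\<lambda>i. B1 + (B2 - B1) * (real i / real N)) ` {..N}"

lemma card_net: "finite (net N)" "card (net N) \<le> N + 1"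
  unfolding net_def using card_image_le[of "{..N}"] by auto

lemma net_subset:
  assumes "z \<in> net N" shows "B1 \<le> z \<and> z \<le> B2"
proof -
  obtain i where i: "i \<le> N" "z = B1 + (B2 - B1) * (real i / real N)" using assms by (auto simp: net_def)
  define d where "d = (B2 - B1) * (real i / real N)"
  have "real i / real N \<le> 1" using i by (cases "N = 0") auto
  then have "d \<le> (B2 - B1) * 1" unfolding d_def using B_le by (intro mult_left_mono) auto
  moreover have "0 \<le> d" unfolding d_def using B_le by simp
  moreover have "z = B1 + d" unfolding d_def by (rule i(2))
  ultimately show ?thesis by simp
qed

lemma net_dense:
  assumes N: "0 < N" and x: "B1 \<le> x" "x \<le> B2"
  shows "\<exists>z\<in>net N. \<bar>x - z\<bar> \<le> (B2 - B1) / real N"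
proof (cases "B1 = B2")
  case True
  then have "x = B1 + (B2 - B1) * (real 0 / real N)" using x by simp
  then have "x \<in> net N" unfolding net_def by blast
  then show ?thesis using True by force
next
  case False
  define D where "D = B2 - B1"
  have D: "D > 0" using False B_le by (simp add: D_def)
  define u where "u = (x - B1) * real N / D"
  have u: "0 \<le> u" "u \<le> real N"
    using x D N unfolding u_def by (simp_all add: D_def divide_le_eq mult.commute)
  let ?i = "nat \<lfloor>u\<rfloor>"
  have i: "real ?i \<le> u" "u \<le> real ?i + 1" using u(1) by linarith+
  have "?i \<le> N" using i(1) u(2) by linarith
  then have "B1 + D * (real ?i / real N) \<in> net N" unfolding net_def D_def by blast
  moreover have "x = B1 + D * (u / real N)" using D N by (simp add: u_def)
  then have "x - (B1 + D * (real ?i / real N)) = D * ((u - real ?i) / real N)"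
    by (simp add: diff_divide_distrib right_diff_distrib)
  then have "\<bar>x - (B1 + D * (real ?i / real N))\<bar> \<le> D / real N"
  proof -
    assume eq: "x - (B1 + D * (real ?i / real N)) = D * ((u - real ?i) / real N)"
    have "0 \<le> D * ((u - real ?i) / real N)" using i(1) D by simp
    moreover have "D * ((u - real ?i) / real N) \<le> D * (1 / real N)"
      using i(2) D by (intro mult_left_mono divide_right_mono) auto
    ultimately show ?thesis unfolding eq by simp
  qed
  ultimately show ?thesis unfolding D_def by blast
qed

definition grid :: "nat \<Rightarrow> nat \<Rightarrow> (nat \<Rightarrow> real) set" where
  "grid N n = PiE_dflt {..<n} B1 (\<lambda>_. net N)"

lemma finite_grid: "finite (grid N n)"
  unfolding grid_def by (intro finite_PiE_dflt card_net) auto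

lemma card_grid_le: "card (grid N n) \<le> (N + 1) ^ n"
proof -
  have "card (grid N n) = card (net N) ^ n"
    unfolding grid_def by (subst card_PiE_dflt) (auto simp: card_net)
  also have "\<dots> \<le> (N + 1) ^ n" by (intro power_mono card_net) simp
  finally show ?thesis .
qed

lemma grid_subset_box: "g \<in> grid N n \<Longrightarrow> g \<in> box"
proof -
  assume g: "g \<in> grid N n"
  have "g i \<in> {B1..B2}" for i
  proof (cases "i < n")
    case True
    then have "g i \<in> net N" using g by (simp add: grid_def PiE_dflt_def)
    then show ?thesis using net_subset by simp
  next
    case False
    then have "g i = B1" using g by (simp add: grid_def PiE_dflt_def)
    then show ?thesis using B_le by simp
  qed
  then show "g \<in> box" by (simp add: box_def)
qed

lemma grid_dense:
  assumes "0 < N" "x \<in> box"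
  shows "\<exists>g\<in>grid N n. \<forall>i<n. \<bar>x i - g i\<bar> \<le> (B2 - B1) / real N"
proof -
  have "\<exists>z. z \<in> net N \<and> \<bar>x i - z\<bar> \<le> (B2 - B1) / real N" for i
    using net_dense[OF assms(1), of "x i"] boxD[OF assms(2), of i] by (simp add: Bex_def)
  then obtain f where f: "\<And>i. f i \<in> net N \<and> \<bar>x i - f i\<bar> \<le> (B2 - B1) / real N" by metis
  let ?g = "\<lambda>i. if i < n then f i else B1"
  show ?thesis
  proof (intro bexI allI impI)
    show "?g \<in> grid N n" using f by (simp add: grid_def PiE_dflt_def)
    show "\<bar>x i - ?g i\<bar> \<le> (B2 - B1) / real N" if "i < n" for i using f[of i] that by simp
  qed
qed

text \<open>
  A constraint that is violated by \<open>\<nu>\<close> at \<open>g\<close> counts one half, so that the product of the weights of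
  all constraints is small exactly when many are violated.
\<close>

definition weight :: "real \<Rightarrow> (nat \<Rightarrow> real) \<Rightarrow> constr \<Rightarrow> real" where
  "weight \<nu> g c = (if \<nu> \<le> pen c g then 1 / 2 else 1)"

text \<open>
  For every index tuple at least one of the \<open>R\<close> equally likely constraint numbers is violated
  by \<open>\<nu>\<close> at \<open>g\<close>.
\<close>

lemma expect_weight:
  assumes n: "K \<le> n" and cover: "violated_cubes_cover K R a b B1 B2 l \<nu>" and g: "g \<in> box"
  shows "expect (law n) (weight \<nu> g) \<le> 1 - 1 / (2 * real R)"
proof -
  let ?T = "{xs. length xs = K \<and> set xs \<subseteq> {..<n} \<and> (\<not> repl \<longrightarrow> distinct xs)}"
  have T: "finite ?T" "card ?T = ntuples n" using card_lists_eq_ntuples[of "{..<n}"] by auto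
  have per_tuple: "(\<Sum>r<R. weight \<nu> g (xs, r)) \<le> real R - 1 / 2" if "xs \<in> ?T" for xs
  proof -
    obtain r where r: "r < R" "\<nu> \<le> (\<Sum>k<K. a r k * g (xs ! k)) - b r"
      using everywhere_violated[OF cover, of "\<lambda>k. g (xs ! k)"] g by (auto simp: box_def)
    then have wr: "weight \<nu> g (xs, r) = 1 / 2" by (simp add: weight_def pen_def slack_def)
    have "(\<Sum>r<R. weight \<nu> g (xs, r)) = weight \<nu> g (xs, r) + (\<Sum>r'\<in>{..<R} - {r}. weight \<nu> g (xs, r'))"
      using r(1) by (intro sum.remove) auto
    also have "\<dots> \<le> 1 / 2 + (\<Sum>r'\<in>{..<R} - {r}. 1)"
      unfolding wr by (intro add_mono sum_mono) (auto simp: weight_def)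
    also have "(\<Sum>r'\<in>{..<R} - {r}. 1) = real R - 1" using r(1) by (simp add: of_nat_diff)
    finally show ?thesis by simp
  qed
  have N0: "real (ntuples n) > 0" using ntuples_pos[OF n] by simp
  have R0: "real R > 0" using R_pos by simp
  have "expect (law n) (weight \<nu> g) = (\<Sum>c\<in>constrs {..<n}. weight \<nu> g c) / real (card (constrs {..<n}))"
    unfolding law_def by (intro integral_pmf_of_set constrs_lessThan_nonempty finite_constrs n) auto
  also have "(\<Sum>c\<in>constrs {..<n}. weight \<nu> g c) = (\<Sum>xs\<in>?T. \<Sum>r<R. weight \<nu> g (xs, r))"
    unfolding constrs_eq by (simp add: sum.cartesian_product)
  also have "\<dots> \<le> (\<Sum>xs\<in>?T. real R - 1 / 2)" by (rule sum_mono) (rule per_tuple)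
  then have "(\<Sum>xs\<in>?T. \<Sum>r<R. weight \<nu> g (xs, r)) / real (card (constrs {..<n}))
     \<le> (\<Sum>xs\<in>?T. real R - 1 / 2) / real (card (constrs {..<n}))"
    by (rule divide_right_mono) simp
  also have "\<dots> = 1 - 1 / (2 * real R)"
    using N0 R0 T by (simp add: card_constrs field_simps)
  finally show ?thesis .
qed

text \<open>
  An assignment of cost \<open>v\<close> is close to a grid assignment at which at most \<open>2 v / \<nu>\<close> constraints are
  violated by \<open>\<nu>\<close>, so the sum of the weights over the grid is at least \<open>2\<^bsup>-2v/\<nu>\<^esup>\<close>.
\<close>

lemma opt_ge_partition:
  assumes J: "finite J" "C ` J \<subseteq> constrs {..<n}" and N: "0 < N" and \<nu>: "0 < \<nu>"
    and fine: "coef_bound * real K * ((B2 - B1) / real N) \<le> \<nu> / 2"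
  shows "- ln (\<Sum>g\<in>grid N n. \<Prod>j\<in>J. weight \<nu> g (C j)) * (\<nu> / (2 * ln 2)) \<le> opt J C"
proof (rule opt_greatest)
  let ?p = "\<lambda>g. \<Prod>j\<in>J. weight \<nu> g (C j)"
  fix x assume "x \<in> box"
  then obtain g where g: "g \<in> grid N n" "\<forall>i<n. \<bar>x i - g i\<bar> \<le> (B2 - B1) / real N"
    using grid_dense[OF N] by blast
  let ?W = "\<Sum>g\<in>grid N n. ?p g" and ?s = "\<nu> / (2 * ln 2)"
  have s: "?s > 0" using \<nu> by simp
  have per: "- ln (weight \<nu> g (C j)) * ?s \<le> pen (C j) x" if j: "j \<in> J" for j
  proof (cases "\<nu> \<le> pen (C j) g")
    case True
    have "C j \<in> constrs {..<n}" using J(2) j by blast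
    then have "pen (C j) g - coef_bound * real K * ((B2 - B1) / real N) \<le> pen (C j) x"
      by (rule pen_lipschitz) (use g(2) in auto)
    moreover have "- ln (weight \<nu> g (C j)) * ?s = \<nu> / 2"
    proof -
      have "ln (weight \<nu> g (C j)) = - ln 2" using True by (simp add: weight_def ln_div)
      then show ?thesis by simp
    qed
    ultimately show ?thesis using True fine by linarith
  next
    case False
    then show ?thesis by (simp add: weight_def pen_nonneg)
  qed
  have wpos: "0 < (\<Prod>j\<in>J. weight \<nu> h (C j))" for h by (intro prod_pos) (auto simp: weight_def)
  have "(?p g) \<le> ?W"
    by (rule member_le_sum[OF g(1) _ finite_grid]) (rule less_imp_le[OF wpos])
  then have "ln (?p g) \<le> ln ?W"
    using wpos[of g] by (subst ln_le_cancel_iff) auto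
  then have "- ln ?W * ?s \<le> - ln (?p g) * ?s"
    using s by (intro mult_right_mono) auto
  also have "\<dots> = (\<Sum>j\<in>J. - ln (weight \<nu> g (C j)) * ?s)"
  proof -
    have "ln (?p g) = (\<Sum>j\<in>J. ln (weight \<nu> g (C j)))"
      by (rule ln_prod[OF J(1)]) (auto simp: weight_def)
    then show ?thesis by (simp only: sum_negf[symmetric] sum_distrib_right)
  qed
  also have "\<dots> \<le> cost J C x" unfolding cost_def by (rule sum_mono) (rule per)
  finally show "- ln ?W * ?s \<le> cost J C x" .
qed

text \<open>
  Take expectations in \<open>opt_ge_partition\<close>.  The expected sum of weights is at most the number of grid
  assignments times \<open>(1 - 1/(2R))\<^bsup>|J|\<^esup>\<close>, and concavity of the logarithm passes the bound to the expectation.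
\<close>

lemma expect_opt_ge:
  assumes n: "K \<le> n" and J: "finite J" and N: "0 < N" and \<nu>: "0 < \<nu>"
    and fine: "coef_bound * real K * ((B2 - B1) / real N) \<le> \<nu> / 2"
    and cover: "violated_cubes_cover K R a b B1 B2 l \<nu>"
  shows "(real (card J) * - ln (1 - 1 / (2 * real R)) - real n * ln (real (N + 1))) * (\<nu> / (2 * ln 2))
    \<le> expect (iid J (law n)) (opt J)"
proof -
  let ?p = "\<lambda>g C. \<Prod>j\<in>J. weight \<nu> g (C j)"
  let ?E = "expect (iid J (law n))" and ?s = "\<nu> / (2 * ln 2)" and ?\<gamma> = "1 - 1 / (2 * real R)"
  let ?W = "\<lambda>C. \<Sum>g\<in>grid N n. ?p g C"
  let ?w = "real (N + 1) ^ n * ?\<gamma> ^ card J"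
  note fin = finite_set_iid_law[OF n J]
  have s: "?s > 0" using \<nu> by simp
  have \<gamma>: "?\<gamma> > 0" using R_pos by (simp add: field_simps)
  have w: "?w > 0" using \<gamma> by simp
  have wpos: "0 < (\<Prod>j\<in>J. weight \<nu> h (C j))" for h C by (intro prod_pos) (auto simp: weight_def)
  have "grid N n \<noteq> {}" using grid_dense[OF N const_in_box] by blast
  then have Wpos: "0 < ?W C" for C by (intro sum_pos finite_grid wpos)
  have EW: "?E ?W \<le> ?w"
  proof -
    have "?E ?W = (\<Sum>g\<in>grid N n. ?E (?p g))" by (rule expect_sum[OF fin])
    also have "\<dots> \<le> (\<Sum>g\<in>grid N n. ?\<gamma> ^ card J)"
    proof (rule sum_mono)
      fix g assume g: "g \<in> grid N n"
      have "?E (?p g) = (\<Prod>j\<in>J. expect (law n) (weight \<nu> g))"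
        by (rule expectation_prod_Pi_pmf[OF J])
           (auto intro: integrable_measure_pmf_finite finite_set_law[OF n] simp: weight_def)
      also have "\<dots> = expect (law n) (weight \<nu> g) ^ card J" by simp
      also have "\<dots> \<le> ?\<gamma> ^ card J"
        by (intro power_mono expect_weight[OF n cover grid_subset_box[OF g]] const_le_expect finite_set_law[OF n])
           (auto simp: weight_def)
      finally show "?E (?p g) \<le> ?\<gamma> ^ card J" .
    qed
    also have "\<dots> = real (card (grid N n)) * ?\<gamma> ^ card J" by simp
    also have "\<dots> \<le> ?w"
    proof (rule mult_right_mono)
      have "real (card (grid N n)) \<le> real ((N + 1) ^ n)" using card_grid_le of_nat_le_iff by blast
      then show "real (card (grid N n)) \<le> real (N + 1) ^ n" by simp
    qed (use \<gamma> in simp)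
    finally show ?thesis .
  qed
  have "ln ?w = real n * ln (real (N + 1)) + real (card J) * ln ?\<gamma>"
    using \<gamma> by (simp add: ln_mult_pos ln_realpow)
  then have "(real (card J) * - ln ?\<gamma> - real n * ln (real (N + 1))) * ?s = - ln ?w * ?s"
    by simp
  also have "\<dots> \<le> - (ln ?w + (?E ?W / ?w - 1)) * ?s"
  proof (rule mult_right_mono)
    have "?E ?W / ?w \<le> 1" using EW w by (simp only: divide_le_eq_1_pos)
    then show "- ln ?w \<le> - (ln ?w + (?E ?W / ?w - 1))" by linarith
  qed (use s in simp)
  also have "\<dots> = ?E (\<lambda>C. - (ln ?w + (?W C / ?w - 1)) * ?s)"
  proof -
    have "?E (\<lambda>C. - (ln ?w + (?W C / ?w - 1)) * ?s) = ?E (\<lambda>C. (1 - ln ?w) * ?s - ?W C * (?s / ?w))"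
      by (intro expect_cong) (simp add: algebra_simps)
    also have "\<dots> = (1 - ln ?w) * ?s - ?E ?W * (?s / ?w)"
      unfolding expect_diff[OF fin] integral_mult_left_zero by simp
    finally show ?thesis by (simp add: algebra_simps)
  qed
  also have "\<dots> \<le> ?E (opt J)"
  proof (rule expect_mono[OF fin])
    fix C assume "C \<in> set_pmf (iid J (law n))"
    then have C: "C ` J \<subseteq> constrs {..<n}" by (rule iid_law_D[OF n J])
    \<comment> \<open>The tangent of the logarithm at \<open>?w\<close>, which is the form of Jensen's inequality used here.\<close>
    have "ln (?W C / ?w) \<le> ?W C / ?w - 1" by (intro ln_le_minus_one divide_pos_pos Wpos w)
    then have "ln (?W C) \<le> ln ?w + (?W C / ?w - 1)"
      using ln_divide_pos[OF Wpos[of C] w] by linarith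
    then have "- (ln ?w + (?W C / ?w - 1)) * ?s \<le> - ln (?W C) * ?s"
      using s by (intro mult_right_mono) auto
    also have "\<dots> \<le> opt J C" by (rule opt_ge_partition[OF J C N \<nu> fine])
    finally show "- (ln ?w + (?W C / ?w - 1)) * ?s \<le> opt J C" .
  qed
  finally show ?thesis .
qed

text \<open>
  The lower bound of \<open>expect_opt_ge\<close> grows linearly with the density, while the entropy of the
  grid, \<open>ln (N + 1)\<close> per variable, stays fixed.
\<close>

theorem condition_B_threshold:
  assumes \<nu>: "0 < \<nu>" and cover: "violated_cubes_cover K R a b B1 B2 l \<nu>"
  shows "\<exists>c\<ge>0. 0 < limit_opt c"
proof -
  let ?M = "2 * coef_bound * real K * (B2 - B1) / \<nu>"
  obtain N :: nat where N: "?M < real N" using reals_Archimedean2 by blast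
  have "0 \<le> ?M" using coef_bound_nonneg B_le \<nu> by simp
  then have N0: "0 < N" using N by linarith
  have fine: "coef_bound * real K * ((B2 - B1) / real N) \<le> \<nu> / 2"
  proof -
    have "2 * coef_bound * real K * (B2 - B1) < real N * \<nu>" using N \<nu> by (simp only: pos_divide_less_eq)
    then show ?thesis using N0 by (simp add: field_simps)
  qed
  define L where "L = - ln (1 - 1 / (2 * real R))"
  define s where "s = \<nu> / (2 * ln 2)"
  have "1 - 1 / (2 * real R) > 0" using R_pos by (simp add: field_simps)
  then have L: "L > 0" using R_pos by (simp add: L_def)
  have s: "s > 0" using \<nu> by (simp add: s_def)
  \<comment> \<open>The density at which the lower bound per variable is \<open>(c L - ln (N + 1)) s = s\<close>.\<close>
  define c where "c = (ln (real (N + 1)) + 1) / L"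
  have c: "0 \<le> c" unfolding c_def using L by (intro divide_nonneg_pos add_nonneg_nonneg) auto
  have cL: "c * L - ln (real (N + 1)) = 1" using L by (simp add: c_def)
  have bound: "(real (num_constraints c n) / real n * L - ln (real (N + 1))) * s \<le> mean_opt c n" if n: "K \<le> n" for n
  proof -
    have n0: "real n > 0" using n K_pos by simp
    have "(real (num_constraints c n) * L - real n * ln (real (N + 1))) * s / real n
      \<le> expect (instance_law c n) (opt {..<num_constraints c n}) / real n"
      using expect_opt_ge[OF n finite_lessThan N0 \<nu> fine cover, of "num_constraints c n"]
      unfolding instance_law_def L_def s_def by (intro divide_right_mono) simp_all
    also have "\<dots> = mean_opt c n" by (simp add: mean_opt_def instance_opt_def[abs_def])
    also have "(real (num_constraints c n) * L - real n * ln (real (N + 1))) * s / real n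
       = (real (num_constraints c n) / real n * L - ln (real (N + 1))) * s"
      using n0 by (simp add: field_simps)
    finally show ?thesis .
  qed
  have "(\<lambda>n. (real (num_constraints c n) / real n * L - ln (real (N + 1))) * s) \<longlonglongrightarrow> (c * L - ln (real (N + 1))) * s"
    by (intro tendsto_mult tendsto_diff tendsto_const num_constraints_ratio c)
  then have "(c * L - ln (real (N + 1))) * s \<le> limit_opt c"
    by (rule LIMSEQ_le[OF _ mean_opt_tendsto[OF c]]) (use bound in blast)
  then show ?thesis using c cL s by auto
qed

end

theorem theorem2:
  fixes K R :: nat and a :: "nat \<Rightarrow> nat \<Rightarrow> real" and b :: "nat \<Rightarrow> real"
    and B1 B2 :: real and repl :: bool
  assumes "K \<ge> 1" and "R \<ge> 1" and "B1 \<le> B2"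
  shows "\<exists>cstar::ereal. 0 \<le> cstar \<and>
    (\<forall>c\<ge>0. ereal c < cstar \<longrightarrow>
       (\<forall>\<epsilon>>0. (\<lambda>n. measure_pmf.prob (random_klsat repl K R n c)
                     {C. lp_value K a b B1 B2 n c C / real n > \<epsilon>}) \<longlonglongrightarrow> 0)) \<and>
    (\<forall>c. cstar < ereal c \<longrightarrow>
       (\<exists>\<delta>>0. (\<lambda>n. measure_pmf.prob (random_klsat repl K R n c)
                     {C. lp_value K a b B1 B2 n c C / real n \<ge> \<delta>}) \<longlonglongrightarrow> 1)) \<and>
    (condition_A K R a b B1 B2 \<longrightarrow> 0 < cstar) \<and>
    ((\<exists>l>0. \<exists>\<nu>>0. condition_B K R a b B1 B2 l \<nu> \<and> violated_cubes_cover K R a b B1 B2 l \<nu>)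
       \<longrightarrow> cstar < \<infinity>)"
proof -
  interpret lsat K R a b B1 B2 repl
    using assms by unfold_locales
  obtain cstar :: ereal where cstar: "0 \<le> cstar"
    and below: "\<forall>c\<ge>0. ereal c < cstar \<longrightarrow> limit_opt c = 0"
    and above: "\<forall>c. cstar < ereal c \<longrightarrow> 0 < limit_opt c"
    using threshold_exists by (elim exE conjE)
  show ?thesis
  proof (intro exI[of _ cstar] conjI allI impI)
    show "0 \<le> cstar" by (rule cstar)
  next
    fix c \<epsilon> :: real assume "0 \<le> c" "ereal c < cstar" "0 < \<epsilon>"
    then show "(\<lambda>n. measure_pmf.prob (random_klsat repl K R n c)
                     {C. lp_value K a b B1 B2 n c C / real n > \<epsilon>}) \<longlonglongrightarrow> 0"
      using below by (intro prob_large_tendsto_0) simp_all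
  next
    fix c assume c: "cstar < ereal c"
    have c0: "0 \<le> c" using le_less_trans[OF cstar c] by simp
    have lim: "0 < limit_opt c" using above c by simp
    then have "0 < limit_opt c / 2" by simp
    then show "\<exists>\<delta>>0. (\<lambda>n. measure_pmf.prob (random_klsat repl K R n c)
                     {C. lp_value K a b B1 B2 n c C / real n \<ge> \<delta>}) \<longlonglongrightarrow> 1"
      using prob_bounded_below_tendsto_1[OF c0 lim] by blast
  next
    assume "condition_A K R a b B1 B2"
    then have "limit_opt (1 / (2 * exp (real K) * real K)) = 0" by (rule condition_A_threshold)
    then have "\<not> cstar < ereal (1 / (2 * exp (real K) * real K))" using above by fastforce
    then have "ereal (1 / (2 * exp (real K) * real K)) \<le> cstar" by simp
    moreover have "0 < ereal (1 / (2 * exp (real K) * real K))" using assms(1) by simp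
    ultimately show "0 < cstar" by (rule less_le_trans[rotated])
  next
    assume "\<exists>l>0. \<exists>\<nu>>0. condition_B K R a b B1 B2 l \<nu> \<and> violated_cubes_cover K R a b B1 B2 l \<nu>"
    then obtain l \<nu> where "0 < \<nu>" "violated_cubes_cover K R a b B1 B2 l \<nu>" by blast
    then obtain c where "0 \<le> c" "0 < limit_opt c" using condition_B_threshold by blast
    then have "\<not> ereal c < cstar" using below by force
    then have "cstar \<le> ereal c" by simp
    then show "cstar < \<infinity>" by (rule le_less_trans) simp
  qed
qed

end
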